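(* Let $\mathcal G=(V,E)$ be a finite simple graph with $V=\{1,\dots,N\}$ and chromatic index $\chi\ge 1$, let $\nu=\lceil\chi/2\rceil$, and let $$H=\sum_{(i,j)\in E}t_{ij}(a_i^\dagger a_j+a_j^\dagger a_i),\qquad t_{ij}\in\mathbb R .$$ Then one can orient every edge of $\mathcal G$ and assign to every edge $e$ a layer $\ell(e)\in\{1,\dots,\nu\}$ such that, writing $P_{ij}=i\,c_i^{(\ell)}d_j^{(\ell)}$ with $\ell=\ell(i,j)$ for each edge oriented from $i$ to $j$: 1. the Hermitian operators $P_{ij}$, over all edges, commute pairwise and square to the identity; 2. under the Jordan--Wigner transformation, each transformed hopping term $(a_i^\dagger a_j+a_j^\dagger a_i)P_{ij}$ acts nontrivially only on qubits of the sites $i$ and $j$ and has Pauli weight $2(\ell(i,j)+1)\le 2(\nu+1)$, independently of $|i-j|$ and $N$; 3. there is a state $|\Psi_{\mathrm{aux}}\rangle$ of the auxiliary modes with $P_{ij}|\Psi_{\mathrm{aux}}\rangle=|\Psi_{\mathrm{aux}}\rangle$ for every edge, and for every such state, every state $|\Psi_{\mathrm{phys}}\rangle$ of the physical modes and every $T\in\mathbb R$, $$e^{-i\tilde HT}\,|\Psi_{\mathrm{aux}}\rangle|\Psi_{\mathrm{phys}}\rangle=|\Psi_{\mathrm{aux}}\rangle\,e^{-iHT}|\Psi_{\mathrm{phys}}\rangle,\qquad \tilde H=\sum_{(i,j)\in E}t_{ij}(a_i^\dagger a_j+a_j^\dagger a_i)P_{ij}.$$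
   Context: Fermionic modes: $a_i$ ($1\le i\le N$) are the annihilation operators of the physical modes and $b_i^{(\ell)}$ ($1\le i\le N$, $1\le\ell\le\nu$) those of the auxiliary modes; all of these satisfy the canonical anticommutation relations jointly. The auxiliary Majorana operators are $c_i^{(\ell)}=b_i^{(\ell)}+b_i^{(\ell)\dagger}$ and $d_i^{(\ell)}=-i(b_i^{(\ell)}-b_i^{(\ell)\dagger})$. Jordan--Wigner transformation: one qubit per mode, with Pauli operators $X_i^{(k)},Y_i^{(k)},Z_i^{(k)}$, where $k=0$ denotes the physical mode $a_i$ and $k=\ell$ the mode $b_i^{(\ell)}$. With $S_i=\prod_{j=1}^{i-1}\prod_{k=0}^{\nu}Z_j^{(k)}$ and $Z_{i,<\ell}=\prod_{m=0}^{\ell-1}Z_i^{(m)}$, $$a_i=S_i\tfrac{X_i^{(0)}-iY_i^{(0)}}{2},\qquad b_i^{(\ell)}=S_iZ_{i,<\ell}\tfrac{X_i^{(\ell)}-iY_i^{(\ell)}}{2}.$$ The Pauli weight of an operator is the number of qubits on which it acts nontrivially. If $A$ (resp. $B$) is a polynomial in the auxiliary (resp. physical) creation operators, with $A|\mathrm{vac}\rangle=|\Psi_{\mathrm{aux}}\rangle$ and $B|\mathrm{vac}\rangle=|\Psi_{\mathrm{phys}}\rangle$, then $|\Psi_{\mathrm{aux}}\rangle|\Psi_{\mathrm{phys}}\rangle$ denotes $AB|\mathrm{vac}\rangle$; $P_{ij}$ acts on auxiliary states via $P_{ij}A|\mathrm{vac}\rangle$. The chromatic index of $\mathcal G$ is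 the minimum number of colors in a proper edge coloring (edges sharing a vertex have distinct colors). *)

theory Defs
  imports "Jordan_Normal_Form.Schur_Decomposition"
begin

text \<open>Operators on a \<open>d\<close>-dimensional Hilbert space are complex \<open>d \<times> d\<close> matrices.
  Matrices of varying dimension form no type-class monoid, hence explicit sums and products.\<close>

definition mat_sum :: "nat \<Rightarrow> ('e \<Rightarrow> complex mat) \<Rightarrow> 'e set \<Rightarrow> complex mat" where
  "mat_sum d F S = mat d d (\<lambda>rc. \<Sum>e\<in>S. F e $$ rc)"

definition mat_prod :: "nat \<Rightarrow> complex mat list \<Rightarrow> complex mat" where
  "mat_prod d As = foldr (*) As (1\<^sub>m d)"

definition mat_exp :: "complex mat \<Rightarrow> complex mat" where
  "mat_exp A = mat (dim_row A) (dim_row A) (\<lambda>rc. \<Sum>m. (A ^\<^sub>m m) $$ rc / fact m)"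


section \<open>Graphs\<close>

definition simple_graph :: "nat set \<Rightarrow> nat set set \<Rightarrow> bool" where
  "simple_graph V E \<longleftrightarrow> finite V \<and> (\<forall>e\<in>E. e \<subseteq> V \<and> card e = 2)"

definition proper_edge_coloring :: "nat set set \<Rightarrow> (nat set \<Rightarrow> nat) \<Rightarrow> bool" where
  "proper_edge_coloring E g \<longleftrightarrow>
     (\<forall>e\<in>E. \<forall>e'\<in>E. e \<noteq> e' \<and> e \<inter> e' \<noteq> {} \<longrightarrow> g e \<noteq> g e')"

definition chromatic_index :: "nat set set \<Rightarrow> nat" where
  "chromatic_index E = (LEAST k. \<exists>g. g ` E \<subseteq> {..<k} \<and> proper_edge_coloring E g)"

text \<open>Exactly one of \<open>(i, j)\<close> and \<open>(j, i)\<close> is chosen for each edge \<open>{i, j}\<close>.\<close>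

definition orientation :: "nat set set \<Rightarrow> (nat \<times> nat) set \<Rightarrow> bool" where
  "orientation E D \<longleftrightarrow> bij_betw (\<lambda>(i, j). {i, j}) D E"


section \<open>Fermionic modes\<close>

text \<open>The physical and auxiliary modes form a single family: \<open>f i 0\<close> is the physical
  annihilation operator \<open>a\<^sub>i\<close>, and \<open>f i l\<close> with \<open>1 \<le> l \<le> \<nu>\<close> is the auxiliary one
  \<open>b\<^sub>i\<^sup>(\<^sup>l\<^sup>)\<close>. Neither a particular representation of the anticommutation relations nor its
  irreducibility is assumed, only the presence of a vacuum vector.\<close>

locale fermion_modes =
  fixes N \<nu> d :: nat and f :: "nat \<Rightarrow> nat \<Rightarrow> complex mat" and vac :: "complex vec"
  assumes mode_carrier: "\<And>i k. i \<in> {1..N} \<Longrightarrow> k \<in> {0..\<nu>} \<Longrightarrow> f i k \<in> carrier_mat d d"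
    and anticommute: "\<And>i k j l. i \<in> {1..N} \<Longrightarrow> k \<in> {0..\<nu>} \<Longrightarrow> j \<in> {1..N} \<Longrightarrow> l \<in> {0..\<nu>} \<Longrightarrow>
      f i k * f j l + f j l * f i k = 0\<^sub>m d d"
    and anticommute_adjoint: "\<And>i k j l. i \<in> {1..N} \<Longrightarrow> k \<in> {0..\<nu>} \<Longrightarrow> j \<in> {1..N} \<Longrightarrow> l \<in> {0..\<nu>} \<Longrightarrow>
      f i k * mat_adjoint (f j l) + mat_adjoint (f j l) * f i k =
        (if i = j \<and> k = l then 1\<^sub>m d else 0\<^sub>m d d)"
    and vac_carrier: "vac \<in> carrier_vec d"
    and vac_nonzero: "vac \<noteq> 0\<^sub>v d"
    and annihilates_vac: "\<And>i k. i \<in> {1..N} \<Longrightarrow> k \<in> {0..\<nu>} \<Longrightarrow> f i k *\<^sub>v vac = 0\<^sub>v d"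

definition majorana_c :: "(nat \<Rightarrow> nat \<Rightarrow> complex mat) \<Rightarrow> nat \<Rightarrow> nat \<Rightarrow> complex mat" where
  "majorana_c f i l = f i l + mat_adjoint (f i l)"

definition majorana_d :: "(nat \<Rightarrow> nat \<Rightarrow> complex mat) \<Rightarrow> nat \<Rightarrow> nat \<Rightarrow> complex mat" where
  "majorana_d f i l = (- \<i>) \<cdot>\<^sub>m (f i l - mat_adjoint (f i l))"

definition edge_op :: "(nat \<Rightarrow> nat \<Rightarrow> complex mat) \<Rightarrow> nat \<Rightarrow> nat \<Rightarrow> nat \<Rightarrow> complex mat" where
  "edge_op f l i j = \<i> \<cdot>\<^sub>m (majorana_c f i l * majorana_d f j l)"

definition hopping :: "(nat \<Rightarrow> nat \<Rightarrow> complex mat) \<Rightarrow> nat \<Rightarrow> nat \<Rightarrow> complex mat" where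
  "hopping f i j = mat_adjoint (f i 0) * f j 0 + mat_adjoint (f j 0) * f i 0"

text \<open>The hopping term is symmetric in its two sites, so each edge is represented here by its
  increasing pair of endpoints.\<close>

definition hamiltonian ::
    "nat \<Rightarrow> (nat \<Rightarrow> nat \<Rightarrow> complex mat) \<Rightarrow> nat set set \<Rightarrow> (nat set \<Rightarrow> real) \<Rightarrow> complex mat" where
  "hamiltonian d f E t =
     mat_sum d (\<lambda>(i, j). complex_of_real (t {i, j}) \<cdot>\<^sub>m hopping f i j)
       {(i, j). i < j \<and> {i, j} \<in> E}"

definition transformed_hamiltonian ::
    "nat \<Rightarrow> (nat \<Rightarrow> nat \<Rightarrow> complex mat) \<Rightarrow> (nat \<times> nat) set \<Rightarrow> (nat set \<Rightarrow> nat) \<Rightarrow>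
      (nat set \<Rightarrow> real) \<Rightarrow> complex mat" where
  "transformed_hamiltonian d f D lay t =
     mat_sum d (\<lambda>(i, j). complex_of_real (t {i, j}) \<cdot>\<^sub>m
       (hopping f i j * edge_op f (lay {i, j}) i j)) D"

text \<open>Noncommutative polynomials in the creation operators of the modes in \<open>M\<close>.\<close>

inductive_set creation_polynomials ::
    "nat \<Rightarrow> (nat \<Rightarrow> nat \<Rightarrow> complex mat) \<Rightarrow> (nat \<times> nat) set \<Rightarrow> complex mat set"
  for d :: nat and f :: "nat \<Rightarrow> nat \<Rightarrow> complex mat" and M :: "(nat \<times> nat) set" where
  one: "1\<^sub>m d \<in> creation_polynomials d f M"
| creation: "(i, k) \<in> M \<Longrightarrow> mat_adjoint (f i k) \<in> creation_polynomials d f M"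
| smult: "A \<in> creation_polynomials d f M \<Longrightarrow> c \<cdot>\<^sub>m A \<in> creation_polynomials d f M"
| add: "A \<in> creation_polynomials d f M \<Longrightarrow> B \<in> creation_polynomials d f M \<Longrightarrow>
    A + B \<in> creation_polynomials d f M"
| mult: "A \<in> creation_polynomials d f M \<Longrightarrow> B \<in> creation_polynomials d f M \<Longrightarrow>
    A * B \<in> creation_polynomials d f M"

definition aux_polynomials ::
    "nat \<Rightarrow> nat \<Rightarrow> nat \<Rightarrow> (nat \<Rightarrow> nat \<Rightarrow> complex mat) \<Rightarrow> complex mat set" where
  "aux_polynomials N \<nu> d f = creation_polynomials d f ({1..N} \<times> {1..\<nu>})"

definition phys_polynomials ::
    "nat \<Rightarrow> nat \<Rightarrow> (nat \<Rightarrow> nat \<Rightarrow> complex mat) \<Rightarrow> complex mat set" where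
  "phys_polynomials N d f = creation_polynomials d f ({1..N} \<times> {0})"

text \<open>States are nonzero vectors, not necessarily normalized.\<close>

definition aux_states ::
    "nat \<Rightarrow> nat \<Rightarrow> nat \<Rightarrow> (nat \<Rightarrow> nat \<Rightarrow> complex mat) \<Rightarrow> complex vec \<Rightarrow> complex vec set" where
  "aux_states N \<nu> d f vac = (\<lambda>A. A *\<^sub>v vac) ` aux_polynomials N \<nu> d f - {0\<^sub>v d}"

definition phys_states ::
    "nat \<Rightarrow> nat \<Rightarrow> (nat \<Rightarrow> nat \<Rightarrow> complex mat) \<Rightarrow> complex vec \<Rightarrow> complex vec set" where
  "phys_states N d f vac = (\<lambda>B. B *\<^sub>v vac) ` phys_polynomials N d f - {0\<^sub>v d}"

text \<open>The vector \<open>|\<psi>\<rangle>|\<phi>\<rangle>\<close>. The anticommutation relations imply that \<open>AB|vac\<rangle>\<close> does not depend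
  on the choice of \<open>A\<close> and \<open>B\<close>.\<close>

definition joint_state ::
    "nat \<Rightarrow> nat \<Rightarrow> nat \<Rightarrow> (nat \<Rightarrow> nat \<Rightarrow> complex mat) \<Rightarrow> complex vec \<Rightarrow>
      complex vec \<Rightarrow> complex vec \<Rightarrow> complex vec" where
  "joint_state N \<nu> d f vac \<psi> \<phi> =
     (THE \<xi>. \<exists>A \<in> aux_polynomials N \<nu> d f. \<exists>B \<in> phys_polynomials N d f.
        A *\<^sub>v vac = \<psi> \<and> B *\<^sub>v vac = \<phi> \<and> \<xi> = (A * B) *\<^sub>v vac)"


section \<open>Qubits and the Jordan--Wigner transformation\<close>

text \<open>The computational basis of \<open>n\<close> qubits is indexed by \<open>{..<2^n}\<close>; the state of qubit \<open>q\<close>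
  is the \<open>q\<close>-th binary digit of the index, and \<open>unset_bit q\<close> forgets it.\<close>

definition pauli_X :: "complex mat" where
  "pauli_X = mat_of_rows_list 2 [[0, 1], [1, 0]]"

definition pauli_Y :: "complex mat" where
  "pauli_Y = mat_of_rows_list 2 [[0, - \<i>], [\<i>, 0]]"

definition pauli_Z :: "complex mat" where
  "pauli_Z = mat_of_rows_list 2 [[1, 0], [0, - 1]]"

definition on_qubit :: "nat \<Rightarrow> nat \<Rightarrow> complex mat \<Rightarrow> complex mat" where
  "on_qubit n q M = mat (2 ^ n) (2 ^ n) (\<lambda>(r, c).
     if unset_bit q r = unset_bit q c then M $$ (of_bool (bit r q), of_bool (bit c q)) else 0)"

text \<open>\<open>W\<close> is the tensor product of the identity of qubit \<open>q\<close> with an operator, with matrix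
  entries \<open>g\<close>, on the other qubits.\<close>

definition acts_trivially :: "nat \<Rightarrow> complex mat \<Rightarrow> nat \<Rightarrow> bool" where
  "acts_trivially n W q \<longleftrightarrow> (\<exists>g. \<forall>r < 2 ^ n. \<forall>c < 2 ^ n.
     W $$ (r, c) = (if bit r q = bit c q then g (unset_bit q r) (unset_bit q c) else 0))"

definition pauli_weight :: "nat \<Rightarrow> complex mat \<Rightarrow> nat" where
  "pauli_weight n W = card {q. q < n \<and> \<not> acts_trivially n W q}"

definition num_qubits :: "nat \<Rightarrow> nat \<Rightarrow> nat" where
  "num_qubits N \<nu> = N * (\<nu> + 1)"

definition qubit :: "nat \<Rightarrow> nat \<Rightarrow> nat \<Rightarrow> nat" where
  "qubit \<nu> i k = (i - 1) * (\<nu> + 1) + k"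

definition jw_string :: "nat \<Rightarrow> nat \<Rightarrow> nat \<Rightarrow> complex mat" where
  "jw_string N \<nu> i = mat_prod (2 ^ num_qubits N \<nu>)
     [on_qubit (num_qubits N \<nu>) (qubit \<nu> j k) pauli_Z. j \<leftarrow> [1..<i], k \<leftarrow> [0..<\<nu> + 1]]"

definition jw_site_string :: "nat \<Rightarrow> nat \<Rightarrow> nat \<Rightarrow> nat \<Rightarrow> complex mat" where
  "jw_site_string N \<nu> i l = mat_prod (2 ^ num_qubits N \<nu>)
     [on_qubit (num_qubits N \<nu>) (qubit \<nu> i m) pauli_Z. m \<leftarrow> [0..<l]]"

text \<open>For \<open>k = 0\<close> the string on the site itself is empty, so this covers both \<open>a\<^sub>i\<close> and
  \<open>b\<^sub>i\<^sup>(\<^sup>l\<^sup>)\<close>.\<close>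

definition jw :: "nat \<Rightarrow> nat \<Rightarrow> nat \<Rightarrow> nat \<Rightarrow> complex mat" where
  "jw N \<nu> i k = jw_string N \<nu> i * jw_site_string N \<nu> i k *
     ((1 / 2) \<cdot>\<^sub>m (on_qubit (num_qubits N \<nu>) (qubit \<nu> i k) pauli_X
        - \<i> \<cdot>\<^sub>m on_qubit (num_qubits N \<nu>) (qubit \<nu> i k) pauli_Y))"

end

theory Submission
  imports Defs
begin

text \<open>
  Two colour classes of an optimal edge colouring form a graph of maximal degree two, whose paths and
  cycles can be oriented consistently. Hence in every layer each vertex has at most one outgoing and
  at most one incoming edge, and no Majorana operator occurs in two of the operators \<open>P\<^sub>i\<^sub>j\<close>. They
  therefore commute, and a common \<open>+1\<close> eigenvector is obtained by treating the edges one at a time: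
  a wrong sign of \<open>P\<^sub>i\<^sub>j\<close> is repaired by \<open>c\<^sub>i\<close>.

  If \<open>A|vac\<rangle>\<close> is stabilised then so is \<open>A|\<phi>\<rangle>\<close> for every physical \<open>|\<phi>\<rangle>\<close>, because \<open>|\<phi>\<rangle>\<close> is also
  created from the vacuum by an operator that commutes with all auxiliary modes: dress the physical
  creation operators with the parity of the auxiliary modes. Since hopping terms commute with \<open>A\<close>, this
  gives \<open>H'A|\<phi>\<rangle> = AH|\<phi>\<rangle>\<close> for the transformed Hamiltonian \<open>H'\<close> on the invariant subspace of physical
  states, and hence the same relation for the exponentials.

  Pauli weights are read off from commutation signs: an operator acts trivially on a qubit iff it commutes
  with the \<open>X\<close> and \<open>Z\<close> of this qubit, and both commute or anticommute with each Jordan--Wigner factor,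
  except for \<open>X\<close> with the modes of its own qubit; there the sign of \<open>Z\<close> decides.
\<close>

section \<open>Adjoints and commutation up to a sign\<close>

text \<open>Each layer offers every site two Majorana operators, \<open>c\<close> for an outgoing
  and \<open>d\<close> for an incoming edge; this is why one layer absorbs two colours and \<nu> is
  half the chromatic index, rounded up. Cycles of the graph impose no relation on the eigenvalues:
  the \<open>c\<close> at the tail of an edge anticommutes with the operator of this edge alone, so
  all signs can be corrected independently.

  The representation is arbitrary apart from its vacuum, so the space need not split into a tensor
  product, and |psi>|phi> exists only as AB|vac>. Physical and auxiliary creation operators
  anticommute, hence B cannot be carried past A without signs that depend on parity. Dressing
  removes them and thereby also shows that AB|vac> does not depend on the choice of A and B.

  The evolved vector must again be a physical state for the right-hand side to be meaningful; a
  linear projection onto these states shows this without topology. Signs are tracked by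
  \<open>qcommute d s A B\<close>, where \<open>s\<close> is 1 or -1 in all uses. As the zero
  operator satisfies every such relation, the weights also require the transformed hopping terms to
  be nonzero.\<close>

lemma dim_mat_adjoint [simp]:
  "dim_row (mat_adjoint A) = dim_col A" "dim_col (mat_adjoint A) = dim_row A"
  by (auto simp: mat_adjoint_def)

lemma mat_adjoint_index [simp]:
  "r < dim_col A \<Longrightarrow> c < dim_row A \<Longrightarrow> mat_adjoint A $$ (r, c) = cnj (A $$ (c, r))"
  unfolding mat_adjoint_def by (auto simp: mat_of_rows_index)

lemma mat_adjoint_carrier [simp, intro]:
  "A \<in> carrier_mat n m \<Longrightarrow> mat_adjoint A \<in> carrier_mat m n"
  by (auto intro!: carrier_matI)

lemma mat_adjoint_one: "mat_adjoint (1\<^sub>m n) = (1\<^sub>m n :: complex mat)"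
  by (rule eq_matI) auto

lemma mat_adjoint_smult: "mat_adjoint (k \<cdot>\<^sub>m A) = cnj k \<cdot>\<^sub>m mat_adjoint A"
  by (intro eq_matI) auto

lemma mat_adjoint_mult:
  fixes A B :: "complex mat"
  assumes "dim_col A = dim_row B"
  shows "mat_adjoint (A * B) = mat_adjoint B * mat_adjoint A"
  using assms by (intro eq_matI) (auto simp: scalar_prod_def mult.commute intro!: sum.cong)

section \<open>Calculus of commutation signs\<close>

definition qcommute :: "nat \<Rightarrow> complex \<Rightarrow> complex mat \<Rightarrow> complex mat \<Rightarrow> bool" where
  "qcommute d s A B \<longleftrightarrow>
     A \<in> carrier_mat d d \<and> B \<in> carrier_mat d d \<and> A * B = s \<cdot>\<^sub>m (B * A)"

lemma qcommuteD:
  assumes "qcommute d s A B"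
  shows "A \<in> carrier_mat d d" "B \<in> carrier_mat d d" "A * B = s \<cdot>\<^sub>m (B * A)"
  using assms by (auto simp: qcommute_def)

lemma smult_smult_mat: "(a :: complex) \<cdot>\<^sub>m (b \<cdot>\<^sub>m A) = (a * b) \<cdot>\<^sub>m A"
  by (intro eq_matI) auto

text \<open>The premises are equations between dimensions, which rewriting can discharge; carrier
  premises would leave the dimensions as unknowns to be guessed.\<close>

lemma mat_dim_simps:
  fixes A B C :: "complex mat"
  shows "dim_col A = dim_row B \<Longrightarrow> dim_col B = dim_row C \<Longrightarrow> A * B * C = A * (B * C)"
    and "dim_col A = dim_row B \<Longrightarrow> A * (k \<cdot>\<^sub>m B) = k \<cdot>\<^sub>m (A * B)"
    and "dim_col A = dim_row B \<Longrightarrow> (k \<cdot>\<^sub>m A) * B = k \<cdot>\<^sub>m (A * B)"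
    and "a \<cdot>\<^sub>m (k \<cdot>\<^sub>m A) = (a * k) \<cdot>\<^sub>m A"
  by ((rule assoc_mult_mat[of _ "dim_row A" "dim_col A" _ "dim_col B" _ "dim_col C"]
      | rule mult_smult_distrib[of _ "dim_row A" "dim_col A" _ "dim_col B"]
      | rule mult_smult_assoc_mat[of _ "dim_row A" "dim_col A" _ "dim_col B"]
      | rule smult_smult_mat); auto)+

lemma mat_distrib_simps:
  fixes A B C :: "complex mat"
  shows "dim_col A = dim_row B \<Longrightarrow> dim_row B = dim_row C \<Longrightarrow> dim_col B = dim_col C \<Longrightarrow>
      A * (B + C) = A * B + A * C"
    and "dim_row A = dim_row B \<Longrightarrow> dim_col A = dim_col B \<Longrightarrow> dim_col B = dim_row C \<Longrightarrow>
      (A + B) * C = A * C + B * C"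
    and "dim_col A = dim_row B \<Longrightarrow> dim_row B = dim_row C \<Longrightarrow> dim_col B = dim_col C \<Longrightarrow>
      A * (B - C) = A * B - A * C"
    and "dim_row A = dim_row B \<Longrightarrow> dim_col A = dim_col B \<Longrightarrow> dim_col B = dim_row C \<Longrightarrow>
      (A - B) * C = A * C - B * C"
  by ((rule mult_add_distrib_mat[of _ "dim_row A" "dim_col A" _ "dim_col B"]
      | rule add_mult_distrib_mat[of _ "dim_row B" "dim_col B" _ _ "dim_col C"]
      | rule mult_minus_distrib_mat[of _ "dim_row A" "dim_col A" _ "dim_col B"]
      | rule minus_mult_distrib_mat[of _ "dim_row B" "dim_col B" _ _ "dim_col C"]); auto)+

lemma smult_distrib_mat:
  fixes A B :: "complex mat"
  assumes "dim_row A = dim_row B" "dim_col A = dim_col B"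
  shows "k \<cdot>\<^sub>m (A + B) = k \<cdot>\<^sub>m A + k \<cdot>\<^sub>m B" and "k \<cdot>\<^sub>m (A - B) = k \<cdot>\<^sub>m A - k \<cdot>\<^sub>m B"
  using assms by (auto intro!: eq_matI simp: distrib_left right_diff_distrib)

lemma one_smult_mat [simp]: "(1 :: complex) \<cdot>\<^sub>m A = A"
  by (intro eq_matI) auto

lemma minus_one_smult_mat: "(- 1 :: complex) \<cdot>\<^sub>m A = - A"
  by (intro eq_matI) auto

lemma qcommute_one [simp]: "A \<in> carrier_mat d d \<Longrightarrow> qcommute d 1 A (1\<^sub>m d)"
  by (simp add: qcommute_def)

lemma qcommute_self: "A \<in> carrier_mat d d \<Longrightarrow> qcommute d 1 A A"
  by (simp add: qcommute_def)

lemma qcommute_sym: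
  assumes "qcommute d s A B" "s * s = 1"
  shows "qcommute d s B A"
  using assms by (auto simp: qcommute_def smult_smult_mat)

lemma qcommute_mult_right:
  assumes "qcommute d s A B" "qcommute d s' A C"
  shows "qcommute d (s * s') A (B * C)"
proof -
  note cs = qcommuteD[OF assms(1)] qcommuteD[OF assms(2)]
  note dims = carrier_matD[OF cs(1)] carrier_matD[OF cs(2)] carrier_matD[OF cs(5)]
  have "A * (B * C) = (A * B) * C" using dims by (simp add: mat_dim_simps)
  also have "\<dots> = s \<cdot>\<^sub>m (B * (A * C))" unfolding cs(3) using dims by (simp add: mat_dim_simps)
  also have "\<dots> = (s * s') \<cdot>\<^sub>m (B * C * A)"
    unfolding cs(6) using dims by (simp add: mat_dim_simps)
  finally show ?thesis using cs(1,2,5) by (auto simp: qcommute_def)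
qed

lemma qcommute_mult_left:
  assumes "qcommute d s A C" "qcommute d s' B C"
  shows "qcommute d (s * s') (A * B) C"
proof -
  note cs = qcommuteD[OF assms(1)] qcommuteD[OF assms(2)]
  note dims = carrier_matD[OF cs(1)] carrier_matD[OF cs(2)] carrier_matD[OF cs(4)]
  have "A * B * C = A * (B * C)" using dims by (simp add: mat_dim_simps)
  also have "\<dots> = s' \<cdot>\<^sub>m ((A * C) * B)" unfolding cs(6) using dims by (simp add: mat_dim_simps)
  also have "\<dots> = (s * s') \<cdot>\<^sub>m (C * (A * B))"
    unfolding cs(3) using dims by (simp add: mat_dim_simps mult.commute)
  finally show ?thesis using cs(1,2,4) by (auto simp: qcommute_def)
qed

lemma qcommute_add_right:
  assumes "qcommute d s A B" "qcommute d s A C"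
  shows "qcommute d s A (B + C)"
  using qcommuteD[OF assms(1)] qcommuteD[OF assms(2)]
  by (simp add: qcommute_def mult_add_distrib_mat[of _ d d] add_mult_distrib_mat[of _ d d]
      add_smult_distrib_left_mat[of _ d d])

lemma qcommute_add_left:
  assumes "qcommute d s A C" "qcommute d s B C"
  shows "qcommute d s (A + B) C"
  using qcommuteD[OF assms(1)] qcommuteD[OF assms(2)]
  by (simp add: qcommute_def mult_add_distrib_mat[of _ d d] add_mult_distrib_mat[of _ d d]
      add_smult_distrib_left_mat[of _ d d])

lemma qcommute_smult_right: "qcommute d s A B \<Longrightarrow> qcommute d s A (k \<cdot>\<^sub>m B)"
  by (auto simp: qcommute_def mult_smult_distrib[of _ d d] mult_smult_assoc_mat[of _ d d]
      smult_smult_mat mult.commute)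

lemma qcommute_smult_left: "qcommute d s A B \<Longrightarrow> qcommute d s (k \<cdot>\<^sub>m A) B"
  by (auto simp: qcommute_def mult_smult_distrib[of _ d d] mult_smult_assoc_mat[of _ d d]
      smult_smult_mat mult.commute)

lemma minus_eq_add_smult_mat:
  fixes A B :: "complex mat"
  assumes "A \<in> carrier_mat n m" "B \<in> carrier_mat n m"
  shows "A - B = A + (- 1) \<cdot>\<^sub>m B"
  using assms by (intro eq_matI) auto

lemma qcommute_minus_right:
  assumes "qcommute d s A B" "qcommute d s A C"
  shows "qcommute d s A (B - C)"
  using qcommuteD[OF assms(1)] qcommuteD[OF assms(2)]
  by (simp add: minus_eq_add_smult_mat[of _ d d] qcommute_add_right qcommute_smult_right assms)

lemma qcommute_minus_left:
  assumes "qcommute d s A C" "qcommute d s B C"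
  shows "qcommute d s (A - B) C"
  using qcommuteD[OF assms(1)] qcommuteD[OF assms(2)]
  by (simp add: minus_eq_add_smult_mat[of _ d d] qcommute_add_left qcommute_smult_left assms)

lemma qcommute_adjoint:
  assumes "qcommute d s A B" "cnj s = s" "s * s = 1"
  shows "qcommute d s (mat_adjoint A) (mat_adjoint B)"
proof -
  note cs = qcommuteD[OF assms(1)]
  have "mat_adjoint B * mat_adjoint A = s \<cdot>\<^sub>m (mat_adjoint A * mat_adjoint B)"
    using arg_cong[OF cs(3), of mat_adjoint] cs(1,2) assms(2)
    by (simp add: mat_adjoint_mult mat_adjoint_smult)
  hence "qcommute d s (mat_adjoint B) (mat_adjoint A)" using cs by (auto simp: qcommute_def)
  thus ?thesis using assms(3) by (rule qcommute_sym)
qed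

lemma qcommute_of_anticommute:
  assumes "A \<in> carrier_mat d d" "B \<in> carrier_mat d d" "A * B + B * A = 0\<^sub>m d d"
  shows "qcommute d (- 1) A B"
proof -
  have "A * B = - (B * A)"
  proof (rule eq_matI)
    fix r c assume "r < dim_row (- (B * A))" "c < dim_col (- (B * A))"
    hence rc: "r < d" "c < d" using assms by auto
    have "(A * B + B * A) $$ (r, c) = 0" using assms(3) rc by simp
    thus "(A * B) $$ (r, c) = (- (B * A)) $$ (r, c)"
      using rc assms(1,2) by (simp add: eq_neg_iff_add_eq_0 del: index_mult_mat(1))
  qed (use assms in auto)
  thus ?thesis using assms by (simp add: qcommute_def minus_one_smult_mat)
qed

lemma anticommute_of_qcommute:
  assumes "qcommute d (- 1) A B"
  shows "A * B + B * A = 0\<^sub>m d d"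
  using qcommuteD[OF assms] by (simp add: minus_one_smult_mat uminus_l_inv_mat)

section \<open>Products of lists of operators and action on vectors\<close>

lemma mat_prod_carrier [simp]:
  "(\<And>A. A \<in> set As \<Longrightarrow> A \<in> carrier_mat d d) \<Longrightarrow> mat_prod d As \<in> carrier_mat d d"
  by (induction As) (auto simp: mat_prod_def intro!: mult_carrier_mat)

lemma mat_prod_append:
  "(\<And>A. A \<in> set As \<union> set Bs \<Longrightarrow> A \<in> carrier_mat d d) \<Longrightarrow>
    mat_prod d (As @ Bs) = mat_prod d As * mat_prod d Bs"
proof (induction As)
  case Nil
  thus ?case using mat_prod_carrier[of Bs d] by (simp add: mat_prod_def)
next
  case (Cons A As)
  have "mat_prod d As \<in> carrier_mat d d" "mat_prod d Bs \<in> carrier_mat d d" "A \<in> carrier_mat d d"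
    using Cons.prems by (auto intro!: mat_prod_carrier)
  thus ?case using Cons by (simp add: mat_prod_def assoc_mult_mat[of _ d d _ d _ d])
qed

lemma smult_mat_vec: "A \<in> carrier_mat n m \<Longrightarrow> v \<in> carrier_vec m \<Longrightarrow>
    ((k :: complex) \<cdot>\<^sub>m A) *\<^sub>v v = k \<cdot>\<^sub>v (A *\<^sub>v v)"
  by (intro eq_vecI) auto

lemma mat_vec_zero: "(A :: complex mat) \<in> carrier_mat n m \<Longrightarrow> A *\<^sub>v 0\<^sub>v m = 0\<^sub>v n"
  by (intro eq_vecI) (auto simp: scalar_prod_def)

section \<open>Orienting graphs of maximal degree two\<close>

lemma orientationD:
  assumes "orientation E D"
  shows "(i, j) \<in> D \<Longrightarrow> {i, j} \<in> E"
    and "(i, j) \<in> D \<Longrightarrow> (i', j') \<in> D \<Longrightarrow> {i, j} = {i', j'} \<Longrightarrow> i = i' \<and> j = j'"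
  using assms by (auto simp: orientation_def bij_betw_def inj_on_def)

text \<open>Swapping the components of a pair leaves its edge unchanged, so the map from pairs to
  edges stays a bijection.\<close>

lemma orientation_relabel:
  assumes D: "orientation E D" and h: "\<And>i j. (i, j) \<in> D \<Longrightarrow> h (i, j) \<in> {(i, j), (j, i)}"
  shows "orientation E (h ` D)"
proof -
  let ?g = "\<lambda>(i, j). {i, j}"
  have eq: "(?g \<circ> h) p = ?g p" if "p \<in> D" for p
    using h[of "fst p" "snd p"] that by (auto split: prod.splits)
  have "inj_on ?g (h ` D)"
    using D eq by (intro inj_on_imageI) (auto simp: orientation_def bij_betw_def inj_on_def)
  moreover have "?g ` h ` D = E"
    using D eq by (auto simp: orientation_def bij_betw_def image_comp)
  ultimately show ?thesis by (simp add: orientation_def bij_betw_def)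
qed

text \<open>The vertices reachable from the source \<open>u\<close> form a connected component, which avoids the
  second source \<open>v\<close>; reversing the edges of this component makes \<open>u\<close> a sink.\<close>

lemma orientation_reverse_component:
  assumes D: "orientation E D" and fst: "inj_on fst D" and snd: "inj_on snd D"
    and u: "u \<notin> snd ` D" and v: "v \<notin> snd ` D" and "u \<noteq> v"
  shows "\<exists>D'. orientation E D' \<and> inj_on fst D' \<and> inj_on snd D' \<and> u \<notin> fst ` D' \<and> v \<notin> snd ` D'"
proof -
  have no_u: "(x, u) \<notin> D" and no_v: "(x, v) \<notin> D" for x
    using u v by (metis imageI snd_conv)+
  define R where "R = D\<^sup>* `` {u}"
  define h where "h = (\<lambda>(i, j). if i \<in> R then (j, i) else (i, j :: nat))"
  have fwd: "y \<in> R" if "(x, y) \<in> D" "x \<in> R" for x y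
    using that by (auto simp: R_def intro: rtrancl_into_rtrancl)
  \<comment> \<open>A path from \<open>u\<close> to \<open>y\<close> is not empty since nothing
    enters \<open>u\<close>; its last step enters \<open>y\<close>, and as \<open>y\<close> has only
    one incoming edge, that step starts at \<open>x\<close>.\<close>
  have bwd: "x \<in> R" if xy: "(x, y) \<in> D" and "y \<in> R" for x y
  proof -
    have "(u, y) \<in> D\<^sup>*" using that by (simp add: R_def)
    moreover have "y \<noteq> u" using xy no_u by blast
    ultimately obtain x' where "(u, x') \<in> D\<^sup>*" "(x', y) \<in> D" by (metis rtranclE)
    moreover have "x' = x" using inj_onD[OF snd _ calculation(2) xy] by simp
    ultimately show ?thesis by (simp add: R_def)
  qed
  have vR: "v \<notin> R"
  proof
    assume "v \<in> R"
    hence "(u, v) \<in> D\<^sup>*" by (simp add: R_def)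
    with \<open>u \<noteq> v\<close> obtain x where "(x, v) \<in> D" by (metis rtranclE)
    with no_v show False by blast
  qed
  have uR: "u \<in> R" by (simp add: R_def)
  \<comment> \<open>Every edge has both endpoints in \<open>R\<close> or neither, so the first
    component still tells after relabelling whether the edge was reversed.\<close>
  have mem: "(a, b) \<in> h ` D \<longleftrightarrow> (if a \<in> R then (b, a) \<in> D else (a, b) \<in> D)" for a b
  proof -
    have "(a, b) \<in> h ` D \<longleftrightarrow> (\<exists>(x, y) \<in> D. if x \<in> R then a = y \<and> b = x else a = x \<and> b = y)"
      by (auto simp: h_def image_iff split: if_splits prod.splits)
    also have "\<dots> \<longleftrightarrow> (if a \<in> R then (b, a) \<in> D else (a, b) \<in> D)"
      using fwd bwd by (auto split: if_splits)
    finally show ?thesis .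
  qed
  have "orientation E (h ` D)"
    by (rule orientation_relabel[OF D]) (auto simp: h_def)
  moreover have "inj_on fst (h ` D)"
  proof (rule inj_onI)
    fix p q assume "p \<in> h ` D" "q \<in> h ` D" "fst p = fst q"
    then obtain a b b' where p: "p = (a, b)" "q = (a, b')" "(a, b) \<in> h ` D" "(a, b') \<in> h ` D"
      by (metis prod.collapse)
    show "p = q"
    proof (cases "a \<in> R")
      case True
      hence "(b, a) \<in> D" "(b', a) \<in> D" using p mem by auto
      thus ?thesis using inj_onD[OF snd, of "(b, a)" "(b', a)"] p by simp
    next
      case False
      hence "(a, b) \<in> D" "(a, b') \<in> D" using p mem by auto
      thus ?thesis using inj_onD[OF fst, of "(a, b)" "(a, b')"] p by simp
    qed
  qed
  moreover have "inj_on snd (h ` D)"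
  proof (rule inj_onI)
    fix p q assume "p \<in> h ` D" "q \<in> h ` D" "snd p = snd q"
    then obtain a a' b where p: "p = (a, b)" "q = (a', b)" "(a, b) \<in> h ` D" "(a', b) \<in> h ` D"
      by (metis prod.collapse)
    show "p = q"
    proof (cases "b \<in> R")
      case True
      hence "(b, a) \<in> D" "(b, a') \<in> D" using p mem fwd bwd by metis+
      thus ?thesis using inj_onD[OF fst, of "(b, a)" "(b, a')"] p by simp
    next
      case False
      hence "(a, b) \<in> D" "(a', b) \<in> D" using p mem fwd bwd by metis+
      thus ?thesis using inj_onD[OF snd, of "(a, b)" "(a', b)"] p by simp
    qed
  qed
  moreover have "u \<notin> fst ` h ` D"
  proof
    assume "u \<in> fst ` h ` D"
    then obtain b where "(u, b) \<in> h ` D" by (metis imageE prod.collapse)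
    with uR no_u mem show False by metis
  qed
  moreover have "v \<notin> snd ` h ` D"
  proof
    assume "v \<in> snd ` h ` D"
    then obtain a where a: "(a, v) \<in> h ` D" by (metis imageE prod.collapse)
    show False
    proof (cases "a \<in> R")
      case True
      thus False using a mem bwd vR fwd by metis
    next
      case False
      thus False using a mem no_v by metis
    qed
  qed
  ultimately show ?thesis by blast
qed

text \<open>Induction on the edges. An endpoint of the new edge has at most one old edge, so it
  lacks an incoming or an outgoing one. If the two endpoints lack complementary directions, the edge
  can be inserted at once; otherwise a component is reversed first.\<close>

lemma orientation_max_degree_two:
  assumes "finite E" and "\<And>e. e \<in> E \<Longrightarrow> card e = 2" and "\<And>v. card {e \<in> E. v \<in> e} \<le> 2"
  shows "\<exists>D. orientation E D \<and> inj_on fst D \<and> inj_on snd D"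
  using assms
proof (induction E rule: finite_induct)
  case empty
  show ?case by (rule exI[of _ "{}"]) (simp add: orientation_def bij_betw_def)
next
  case (insert e F)
  have degF: "card {e' \<in> F. w \<in> e'} \<le> 2" for w
    by (rule order_trans[OF card_mono insert.prems(2)[of w]]) (use insert.hyps in auto)
  obtain D where D: "orientation F D" "inj_on fst D" "inj_on snd D"
    using insert.IH insert.prems(1) degF by auto
  obtain u v where e: "e = {u, v}" "u \<noteq> v"
    using insert.prems(1)[of e] by (auto simp: card_2_iff)
  have source_or_sink: "w \<notin> fst ` D \<or> w \<notin> snd ` D" if w: "w \<in> e" for w
  proof (rule ccontr)
    assume "\<not> ?thesis"
    then obtain x y where xy: "(x, w) \<in> D" "(w, y) \<in> D" by auto
    have "card {x, w} = 2" "card {w, y} = 2"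
      using insert.prems(1) orientationD(1)[OF D(1)] xy by auto
    hence ne: "x \<noteq> w" "w \<noteq> y" by auto
    have "{x, w} \<noteq> {w, y}" using orientationD(2)[OF D(1) xy] ne by auto
    moreover have "{x, w} \<in> F" "{w, y} \<in> F" using orientationD(1)[OF D(1)] xy by auto
    \<comment> \<open>The new edge and these two would be three distinct edges at
      \<open>w\<close>.\<close>
    ultimately have "card {e, {x, w}, {w, y}} = 3" using insert.hyps(2) by (auto simp: card_insert_if)
    moreover have "card {e, {x, w}, {w, y}} \<le> card {e' \<in> insert e F. w \<in> e'}"
      using w \<open>{x, w} \<in> F\<close> \<open>{w, y} \<in> F\<close> insert.hyps(1) by (intro card_mono) auto
    ultimately show False using insert.prems(2)[of w] by linarith
  qed
  have extend: "\<exists>D. orientation (insert e F) D \<and> inj_on fst D \<and> inj_on snd D"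
    if D': "orientation F D'" "inj_on fst D'" "inj_on snd D'"
      and free: "a \<notin> fst ` D'" "b \<notin> snd ` D'" and ab: "e = {a, b}" for D' a b
  proof (intro exI[of _ "insert (a, b) D'"] conjI)
    have "(a, b) \<notin> D'" using free by force
    thus "orientation (insert e F) (insert (a, b) D')"
      using D'(1) insert.hyps(2) ab by (auto simp: orientation_def bij_betw_def)
    show "inj_on fst (insert (a, b) D')" "inj_on snd (insert (a, b) D')"
      using D'(2,3) free \<open>(a, b) \<notin> D'\<close> by (auto simp: inj_on_insert)
  qed
  consider "u \<notin> fst ` D" "v \<notin> snd ` D" | "v \<notin> fst ` D" "u \<notin> snd ` D"
    | "u \<notin> snd ` D" "v \<notin> snd ` D" | "u \<notin> fst ` D" "v \<notin> fst ` D"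
    using source_or_sink[of u] source_or_sink[of v] e by auto
  thus ?case
  proof cases
    case 1
    thus ?thesis using extend[OF D] e by blast
  next
    case 2
    thus ?thesis using extend[OF D, of v u] e by (simp add: insert_commute)
  next
    case 3
    then obtain D' where "orientation F D'" "inj_on fst D'" "inj_on snd D'" "u \<notin> fst ` D'" "v \<notin> snd ` D'"
      using orientation_reverse_component[OF D] e(2) by blast
    thus ?thesis using extend e by blast
  next
    case 4
    \<comment> \<open>Reversing all edges exchanges sources and sinks and leads back to the previous
      case.\<close>
    have "orientation F (prod.swap ` D)"
      by (rule orientation_relabel[OF D(1)]) auto
    moreover have "inj_on fst (prod.swap ` D)" "inj_on snd (prod.swap ` D)"
      using D(2,3) by (auto simp: inj_on_def)
    moreover have "u \<notin> snd ` prod.swap ` D" "v \<notin> snd ` prod.swap ` D"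
      using 4 by (auto simp: image_comp)
    ultimately obtain D' where "orientation F D'" "inj_on fst D'" "inj_on snd D'"
        "u \<notin> fst ` D'" "v \<notin> snd ` D'"
      using orientation_reverse_component[of F "prod.swap ` D" u v] e(2) by blast
    thus ?thesis using extend e by blast
  qed
qed

section \<open>From optimal edge colourings to layers\<close>

lemma chromatic_index_coloring:
  assumes "finite E"
  shows "\<exists>g. g ` E \<subseteq> {..<chromatic_index E} \<and> proper_edge_coloring E g"
proof -
  \<comment> \<open>Giving every edge its own colour shows that some number of colours suffices, so
    the \<open>LEAST\<close> is attained.\<close>
  obtain g :: "nat set \<Rightarrow> nat" where g: "bij_betw g E {0..<card E}"
    using ex_bij_betw_finite_nat[OF assms] by blast
  hence "g ` E \<subseteq> {..<card E}" "proper_edge_coloring E g"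
    by (auto simp: bij_betw_def proper_edge_coloring_def inj_on_def)
  hence "\<exists>k g. g ` E \<subseteq> {..<k} \<and> proper_edge_coloring E g" by blast
  from LeastI_ex[OF this] show ?thesis unfolding chromatic_index_def .
qed

text \<open>Two colour classes make up one layer, in which every vertex has degree at most two.\<close>

lemma layered_orientation:
  assumes graph: "simple_graph V E"
  obtains D lay where "orientation E D"
    and "\<And>e. e \<in> E \<Longrightarrow> lay e \<in> {1..nat \<lceil>real (chromatic_index E) / 2\<rceil>}"
    and "\<And>i j i' j'. (i, j) \<in> D \<Longrightarrow> (i', j') \<in> D \<Longrightarrow> lay {i, j} = lay {i', j'} \<Longrightarrow>
      (i, j) \<noteq> (i', j') \<Longrightarrow> i \<noteq> i' \<and> j \<noteq> j'"
proof -
  have "finite E"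
    using graph finite_subset[of E "Pow V"] by (auto simp: simple_graph_def)
  then obtain g where g: "g ` E \<subseteq> {..<chromatic_index E}" "proper_edge_coloring E g"
    using chromatic_index_coloring by blast
  \<comment> \<open>Colours start at 0 and layers at 1: layer \<open>l\<close> collects the colours
    \<open>2 * (l - 1)\<close> and \<open>2 * (l - 1) + 1\<close>.\<close>
  define lay where "lay e = g e div 2 + 1" for e
  define L where "L l = {e \<in> E. lay e = l}" for l
  have "\<exists>D. orientation (L l) D \<and> inj_on fst D \<and> inj_on snd D" for l
  proof (rule orientation_max_degree_two)
    show "finite (L l)" using \<open>finite E\<close> by (simp add: L_def)
    show "card e = 2" if "e \<in> L l" for e
      using that graph by (auto simp: L_def simple_graph_def)
    show "card {e \<in> L l. v \<in> e} \<le> 2" for v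
    proof -
      have "inj_on g {e \<in> L l. v \<in> e}"
        using g(2) by (fastforce simp: inj_on_def proper_edge_coloring_def L_def)
      moreover have "g ` {e \<in> L l. v \<in> e} \<subseteq> {2 * (l - 1), 2 * (l - 1) + 1}"
        by (auto simp: L_def lay_def)
      ultimately have "card {e \<in> L l. v \<in> e} \<le> card {2 * (l - 1), 2 * (l - 1) + 1}"
        by (metis card_inj_on_le finite.emptyI finite.insertI)
      thus ?thesis by simp
    qed
  qed
  then obtain \<Delta> where \<Delta>: "\<And>l. orientation (L l) (\<Delta> l)" "\<And>l. inj_on fst (\<Delta> l)" "\<And>l. inj_on snd (\<Delta> l)"
    by metis
  define D where "D = (\<Union>l. \<Delta> l)"
  have D: "(i, j) \<in> D \<longleftrightarrow> (i, j) \<in> \<Delta> (lay {i, j})" for i j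
  proof
    assume "(i, j) \<in> D"
    then obtain l where l: "(i, j) \<in> \<Delta> l" by (auto simp: D_def)
    hence "{i, j} \<in> L l" by (rule orientationD(1)[OF \<Delta>(1)])
    thus "(i, j) \<in> \<Delta> (lay {i, j})" using l by (simp add: L_def)
  qed (auto simp: D_def)
  show ?thesis
  proof (rule that[of D lay])
    have "inj_on (\<lambda>(i, j). {i, j}) D"
    proof (rule inj_onI)
      fix p q assume pq: "p \<in> D" "q \<in> D" "(case p of (i, j) \<Rightarrow> {i, j}) = (case q of (i, j) \<Rightarrow> {i, j})"
      obtain i j i' j' where ij: "p = (i, j)" "q = (i', j')" by fastforce
      have eq: "{i, j} = {i', j'}" using pq ij by simp
      have "(i, j) \<in> \<Delta> (lay {i, j})" "(i', j') \<in> \<Delta> (lay {i, j})"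
        using D[of i j] D[of i' j'] pq(1,2) unfolding ij eq by simp_all
      from orientationD(2)[OF \<Delta>(1) this eq] show "p = q" by (simp add: ij)
    qed
    moreover have "(\<lambda>(i, j). {i, j}) ` D = E"
    proof -
      have "(\<lambda>(i, j). {i, j}) ` D = (\<Union>l. (\<lambda>(i, j). {i, j}) ` \<Delta> l)" by (auto simp: D_def)
      also have "\<dots> = (\<Union>l. L l)" using \<Delta>(1) by (simp add: orientation_def bij_betw_def)
      finally show ?thesis by (auto simp: L_def)
    qed
    ultimately show "orientation E D" by (simp add: orientation_def bij_betw_def)
    show "lay e \<in> {1..nat \<lceil>real (chromatic_index E) / 2\<rceil>}" if "e \<in> E" for e
    proof -
      have "g e < chromatic_index E" using g(1) that by auto
      hence "real (g e div 2 + 1) < real (chromatic_index E) / 2 + 1" by linarith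
      \<comment> \<open>An integer below x + 1 is at most the ceiling of x.\<close>
      hence "int (g e div 2 + 1) \<le> \<lceil>real (chromatic_index E) / 2\<rceil>" by linarith
      thus ?thesis by (auto simp: lay_def)
    qed
    show "i \<noteq> i' \<and> j \<noteq> j'" if "(i, j) \<in> D" "(i', j') \<in> D" "lay {i, j} = lay {i', j'}"
      "(i, j) \<noteq> (i', j')" for i j i' j'
    proof -
      have "(i, j) \<in> \<Delta> (lay {i, j})" "(i', j') \<in> \<Delta> (lay {i, j})"
        using D[of i j] D[of i' j'] that(1-3) by simp_all
      thus ?thesis
        using inj_onD[OF \<Delta>(2)[of "lay {i, j}"], of "(i, j)" "(i', j')"]
          inj_onD[OF \<Delta>(3)[of "lay {i, j}"], of "(i, j)" "(i', j')"] that(4) by auto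
    qed
  qed
qed

section \<open>Majorana operators and hopping terms\<close>

text \<open>A representation of the anticommutation relations in which no vacuum is singled out, so that
  it covers the Jordan--Wigner operators as well.\<close>

locale car_modes =
  fixes N \<nu> d :: nat and f :: "nat \<Rightarrow> nat \<Rightarrow> complex mat"
  assumes mode_carrier: "i \<in> {1..N} \<Longrightarrow> k \<in> {0..\<nu>} \<Longrightarrow> f i k \<in> carrier_mat d d"
    and anticommute: "i \<in> {1..N} \<Longrightarrow> k \<in> {0..\<nu>} \<Longrightarrow> j \<in> {1..N} \<Longrightarrow> l \<in> {0..\<nu>} \<Longrightarrow>
      f i k * f j l + f j l * f i k = 0\<^sub>m d d"
    and anticommute_adjoint: "i \<in> {1..N} \<Longrightarrow> k \<in> {0..\<nu>} \<Longrightarrow> j \<in> {1..N} \<Longrightarrow> l \<in> {0..\<nu>} \<Longrightarrow>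
      f i k * mat_adjoint (f j l) + mat_adjoint (f j l) * f i k =
        (if i = j \<and> k = l then 1\<^sub>m d else 0\<^sub>m d d)"
begin

definition modes :: "(nat \<times> nat) set" where
  "modes = {1..N} \<times> {0..\<nu>}"

lemma modesD: "(i, k) \<in> modes \<Longrightarrow> i \<in> {1..N}" "(i, k) \<in> modes \<Longrightarrow> k \<in> {0..\<nu>}"
  by (auto simp: modes_def)

lemma carrier: "(i, k) \<in> modes \<Longrightarrow> f i k \<in> carrier_mat d d"
  using mode_carrier modesD by blast

lemma dims [simp]: "(i, k) \<in> modes \<Longrightarrow> dim_row (f i k) = d" "(i, k) \<in> modes \<Longrightarrow> dim_col (f i k) = d"
  using carrier by auto

lemma qcommute_modes:
  assumes "(i, k) \<in> modes" "(j, l) \<in> modes"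
  shows "qcommute d (- 1) (f i k) (f j l)"
  using assms anticommute carrier modesD by (blast intro!: qcommute_of_anticommute)

lemma qcommute_modes_adjoint:
  assumes "(i, k) \<in> modes" "(j, l) \<in> modes" "(i, k) \<noteq> (j, l)"
  shows "qcommute d (- 1) (f i k) (mat_adjoint (f j l))"
  using assms anticommute_adjoint[of i k j l] carrier modesD
  by (intro qcommute_of_anticommute) (auto intro!: carrier_matI)

lemma qcommute_adjoint_modes:
  assumes "(i, k) \<in> modes" "(j, l) \<in> modes" "(i, k) \<noteq> (j, l)"
  shows "qcommute d (- 1) (mat_adjoint (f i k)) (f j l)"
  using assms by (intro qcommute_sym[OF qcommute_modes_adjoint]) auto

lemma qcommute_adjoint_modes_adjoint:
  assumes "(i, k) \<in> modes" "(j, l) \<in> modes"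
  shows "qcommute d (- 1) (mat_adjoint (f i k)) (mat_adjoint (f j l))"
  using qcommute_modes[OF assms] by (rule qcommute_adjoint) auto

lemma nilpotent_mode:
  assumes "(i, k) \<in> modes"
  shows "f i k * f i k = 0\<^sub>m d d"
proof (rule eq_matI)
  fix r c assume "r < dim_row (0\<^sub>m d d :: complex mat)" "c < dim_col (0\<^sub>m d d :: complex mat)"
  hence rc: "r < d" "c < d" by auto
  have "(f i k * f i k + f i k * f i k) $$ (r, c) = 0" using anticommute[of i k i k] modesD[OF assms] rc by simp
  thus "(f i k * f i k) $$ (r, c) = 0\<^sub>m d d $$ (r, c)"
    using rc assms by (simp del: index_mult_mat(1))
qed (use assms in auto)

lemma nilpotent_mode_adjoint:
  assumes "(i, k) \<in> modes"
  shows "mat_adjoint (f i k) * mat_adjoint (f i k) = 0\<^sub>m d d"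
proof -
  have "mat_adjoint (f i k * f i k) = 0\<^sub>m d d"
    unfolding nilpotent_mode[OF assms] by (rule eq_matI) auto
  thus ?thesis using carrier[OF assms] by (simp add: mat_adjoint_mult)
qed

lemma mode_anticommutator_adjoint:
  assumes "(i, k) \<in> modes"
  shows "f i k * mat_adjoint (f i k) + mat_adjoint (f i k) * f i k = 1\<^sub>m d"
  using anticommute_adjoint[of i k i k] modesD[OF assms] by auto

section \<open>Majorana operators\<close>

lemma dim_majorana [simp]:
  "(i, k) \<in> modes \<Longrightarrow> dim_row (majorana_c f i k) = d" "(i, k) \<in> modes \<Longrightarrow> dim_col (majorana_c f i k) = d"
  "(i, k) \<in> modes \<Longrightarrow> dim_row (majorana_d f i k) = d" "(i, k) \<in> modes \<Longrightarrow> dim_col (majorana_d f i k) = d"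
  by (simp_all add: majorana_c_def majorana_d_def)

lemma majorana_c_carrier: "(i, k) \<in> modes \<Longrightarrow> majorana_c f i k \<in> carrier_mat d d"
  and majorana_d_carrier: "(i, k) \<in> modes \<Longrightarrow> majorana_d f i k \<in> carrier_mat d d"
  by (auto intro!: carrier_matI)

lemma qcommute_majorana_c:
  assumes "qcommute d s A (f i k)" "qcommute d s A (mat_adjoint (f i k))"
  shows "qcommute d s A (majorana_c f i k)"
  using assms by (auto simp: majorana_c_def intro!: qcommute_add_right)

lemma qcommute_majorana_d:
  assumes "qcommute d s A (f i k)" "qcommute d s A (mat_adjoint (f i k))"
  shows "qcommute d s A (majorana_d f i k)"
  using assms by (auto simp: majorana_d_def intro!: qcommute_smult_right qcommute_minus_right)

lemma qcommute_mode_majorana: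
  assumes "(i, k) \<in> modes" "(j, l) \<in> modes" "(i, k) \<noteq> (j, l)"
  shows "qcommute d (- 1) (f i k) (majorana_c f j l)"
    and "qcommute d (- 1) (f i k) (majorana_d f j l)"
    and "qcommute d (- 1) (mat_adjoint (f i k)) (majorana_c f j l)"
    and "qcommute d (- 1) (mat_adjoint (f i k)) (majorana_d f j l)"
  using assms
  by (auto intro!: qcommute_majorana_c qcommute_majorana_d qcommute_modes qcommute_modes_adjoint
      qcommute_adjoint_modes qcommute_adjoint_modes_adjoint)

lemma qcommute_majoranas:
  assumes "(i, k) \<in> modes" "(j, l) \<in> modes" "(i, k) \<noteq> (j, l)"
  shows "qcommute d (- 1) (majorana_c f i k) (majorana_c f j l)"
    and "qcommute d (- 1) (majorana_c f i k) (majorana_d f j l)"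
    and "qcommute d (- 1) (majorana_d f i k) (majorana_c f j l)"
    and "qcommute d (- 1) (majorana_d f i k) (majorana_d f j l)"
  using assms qcommute_mode_majorana[of j l i k, THEN qcommute_sym]
  by (auto intro!: qcommute_majorana_c qcommute_majorana_d)

lemma majorana_c_square:
  assumes "(i, k) \<in> modes"
  shows "majorana_c f i k * majorana_c f i k = 1\<^sub>m d"
proof -
  let ?b = "f i k" and ?b' = "mat_adjoint (f i k)"
  have "majorana_c f i k * majorana_c f i k = (?b * ?b + ?b' * ?b) + (?b * ?b' + ?b' * ?b')"
    using assms by (simp add: majorana_c_def mat_distrib_simps)
  also have "\<dots> = 1\<^sub>m d"
    unfolding nilpotent_mode[OF assms] nilpotent_mode_adjoint[OF assms]
      mode_anticommutator_adjoint[OF assms, symmetric]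
    using assms by (intro eq_matI) (auto simp del: index_mult_mat(1))
  finally show ?thesis .
qed

lemma majorana_d_square:
  assumes "(i, k) \<in> modes"
  shows "majorana_d f i k * majorana_d f i k = 1\<^sub>m d"
proof -
  let ?b = "f i k" and ?b' = "mat_adjoint (f i k)"
  have "majorana_d f i k * majorana_d f i k = (- 1) \<cdot>\<^sub>m ((?b * ?b - ?b' * ?b) - (?b * ?b' - ?b' * ?b'))"
    using assms by (simp add: majorana_d_def mat_distrib_simps mat_dim_simps smult_distrib_mat)
  also have "\<dots> = 1\<^sub>m d"
    unfolding nilpotent_mode[OF assms] nilpotent_mode_adjoint[OF assms]
      mode_anticommutator_adjoint[OF assms, symmetric]
    using assms by (intro eq_matI) (auto simp del: index_mult_mat(1))
  finally show ?thesis .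
qed

text \<open>Holds at equal modes too, although b = \<open>f i k\<close> and its adjoint b' do not
  anticommute there: since the squares of b and b' vanish, (b + b')(b - b') and (b - b')(b + b') are
  opposite.\<close>

lemma qcommute_majorana_c_d:
  assumes m: "(i, k) \<in> modes" "(j, l) \<in> modes"
  shows "qcommute d (- 1) (majorana_c f i k) (majorana_d f j l)"
proof (cases "(i, k) = (j, l)")
  case True
  let ?b = "f i k" and ?b' = "mat_adjoint (f i k)"
  have "majorana_c f i k * majorana_d f i k = (- \<i>) \<cdot>\<^sub>m ((?b * ?b + ?b' * ?b) - (?b * ?b' + ?b' * ?b'))"
    using m(1) by (simp add: majorana_c_def majorana_d_def mat_distrib_simps mat_dim_simps smult_distrib_mat)
  moreover have "majorana_d f i k * majorana_c f i k = (- \<i>) \<cdot>\<^sub>m ((?b * ?b - ?b' * ?b) + (?b * ?b' - ?b' * ?b'))"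
    using m(1) by (simp add: majorana_c_def majorana_d_def mat_distrib_simps mat_dim_simps smult_distrib_mat)
  ultimately have "majorana_c f i k * majorana_d f i k
      = (- 1) \<cdot>\<^sub>m (majorana_d f i k * majorana_c f i k)"
    unfolding nilpotent_mode[OF m(1)] nilpotent_mode_adjoint[OF m(1)]
    using m(1) by (intro eq_matI) (auto simp: right_diff_distrib simp del: index_mult_mat(1))
  thus ?thesis
    using True m majorana_c_carrier majorana_d_carrier by (auto simp: qcommute_def)
qed (use m in \<open>simp add: qcommute_majoranas(2)\<close>)

lemma majorana_c_adjoint: "(i, k) \<in> modes \<Longrightarrow> mat_adjoint (majorana_c f i k) = majorana_c f i k"
  by (auto simp: majorana_c_def intro!: eq_matI)

lemma majorana_d_adjoint: "(i, k) \<in> modes \<Longrightarrow> mat_adjoint (majorana_d f i k) = majorana_d f i k"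
  by (auto simp: majorana_d_def right_diff_distrib intro!: eq_matI)

section \<open>Edge operators\<close>

lemma edge_op_carrier:
  "(i, l) \<in> modes \<Longrightarrow> (j, l) \<in> modes \<Longrightarrow> edge_op f l i j \<in> carrier_mat d d"
  by (auto simp: edge_op_def intro!: carrier_matI)

lemma qcommute_edge_op:
  assumes "qcommute d s A (majorana_c f i l)" "qcommute d s' A (majorana_d f j l)"
  shows "qcommute d (s * s') A (edge_op f l i j)"
  using assms by (auto simp: edge_op_def intro!: qcommute_smult_right qcommute_mult_right)

text \<open>The adjoint conjugates the prefactor \<i> and reverses the two anticommuting factors;
  the two signs cancel.\<close>

lemma edge_op_adjoint:
  assumes m: "(i, l) \<in> modes" "(j, l) \<in> modes" and "i \<noteq> j"
  shows "mat_adjoint (edge_op f l i j) = edge_op f l i j"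
proof -
  have "mat_adjoint (edge_op f l i j) = (- \<i>) \<cdot>\<^sub>m (majorana_d f j l * majorana_c f i l)"
    using m majorana_c_carrier[of i l] majorana_d_carrier[of j l]
    by (simp add: edge_op_def mat_adjoint_smult mat_adjoint_mult majorana_c_adjoint
        majorana_d_adjoint)
  also have "majorana_d f j l * majorana_c f i l = (- 1) \<cdot>\<^sub>m (majorana_c f i l * majorana_d f j l)"
    using qcommute_majoranas(3)[of j l i l] m \<open>i \<noteq> j\<close> by (auto dest: qcommuteD)
  finally show ?thesis by (simp add: edge_op_def smult_smult_mat)
qed

lemma edge_op_square:
  assumes m: "(i, l) \<in> modes" "(j, l) \<in> modes" and "i \<noteq> j"
  shows "edge_op f l i j * edge_op f l i j = 1\<^sub>m d"
proof -
  let ?c = "majorana_c f i l" and ?d = "majorana_d f j l"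
  have cs: "?c \<in> carrier_mat d d" "?d \<in> carrier_mat d d"
    using m majorana_c_carrier majorana_d_carrier by auto
  have dc: "?d * ?c = (- 1) \<cdot>\<^sub>m (?c * ?d)"
    using qcommute_majoranas(3)[of j l i l] m \<open>i \<noteq> j\<close> by (auto dest: qcommuteD)
  have "edge_op f l i j * edge_op f l i j = (- 1) \<cdot>\<^sub>m (?c * ((?d * ?c) * ?d))"
    using carrier_matD[OF cs(1)] carrier_matD[OF cs(2)] by (simp add: edge_op_def mat_dim_simps)
  also have "\<dots> = ?c * ?c * (?d * ?d)"
    unfolding dc using carrier_matD[OF cs(1)] carrier_matD[OF cs(2)] by (simp add: mat_dim_simps)
  finally show ?thesis using m by (simp add: majorana_c_square majorana_d_square)
qed

text \<open>An edge may enter the vertex that another edge of its layer leaves: \<open>c\<close> and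
  \<open>d\<close> of one mode still anticommute. Only a common tail or a common head would make a
  Majorana operator occur twice. Otherwise each factor passes two anticommuting ones.\<close>

lemma qcommute_edge_ops:
  assumes m: "(i, l) \<in> modes" "(j, l) \<in> modes" "(i', l') \<in> modes" "(j', l') \<in> modes"
    and ne: "l = l' \<Longrightarrow> i \<noteq> i' \<and> j \<noteq> j'" and ij: "i \<noteq> j" "i' \<noteq> j'"
  shows "qcommute d 1 (edge_op f l i j) (edge_op f l' i' j')"
proof -
  have c: "qcommute d (- 1 * - 1) (majorana_c f i l) (edge_op f l' i' j')"
    using assms by (intro qcommute_edge_op qcommute_majoranas(1) qcommute_majorana_c_d) auto
  have "qcommute d (- 1 * - 1) (majorana_d f j l) (edge_op f l' i' j')"
    using assms
    by (intro qcommute_edge_op qcommute_majoranas(4) qcommute_sym[OF qcommute_majorana_c_d]) auto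
  with c have "qcommute d (1 * 1) (majorana_c f i l * majorana_d f j l) (edge_op f l' i' j')"
    by (intro qcommute_mult_left) auto
  thus ?thesis by (simp add: edge_op_def[of f l i j] qcommute_smult_left)
qed

section \<open>Hopping terms\<close>

lemma hopping_carrier:
  "(i, 0) \<in> modes \<Longrightarrow> (j, 0) \<in> modes \<Longrightarrow> hopping f i j \<in> carrier_mat d d"
  by (auto simp: hopping_def intro!: carrier_matI)

lemma qcommute_hopping:
  assumes "qcommute d s A (f i 0)" "qcommute d s A (mat_adjoint (f i 0))"
    and "qcommute d s' A (f j 0)" "qcommute d s' A (mat_adjoint (f j 0))"
  shows "qcommute d (s * s') A (hopping f i j)"
proof -
  have "qcommute d (s * s') A (mat_adjoint (f i 0) * f j 0)"
    using assms by (intro qcommute_mult_right)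
  moreover have "qcommute d (s' * s) A (mat_adjoint (f j 0) * f i 0)"
    using assms by (intro qcommute_mult_right)
  ultimately show ?thesis
    unfolding hopping_def by (auto intro!: qcommute_add_right simp: mult.commute[of s s'])
qed

text \<open>The commutator of the hopping term with the creation operator at \<open>i\<close> is the
  creation operator at \<open>j\<close>, which cannot vanish because its anticommutator with
  \<open>f j 0\<close> is the identity.\<close>

lemma hopping_nonzero:
  assumes m: "(i, 0) \<in> modes" "(j, 0) \<in> modes" and "i \<noteq> j" and "0 < d"
  shows "hopping f i j \<noteq> 0\<^sub>m d d"
proof
  assume zero: "hopping f i j = 0\<^sub>m d d"
  let ?a = "f i 0" and ?a' = "mat_adjoint (f i 0)" and ?b = "f j 0" and ?b' = "mat_adjoint (f j 0)"
  have ba: "?b * ?a' = (- 1) \<cdot>\<^sub>m (?a' * ?b)"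
    using qcommute_modes_adjoint[of j 0 i 0] m \<open>i \<noteq> j\<close> by (auto dest: qcommuteD)
  have ab: "?a' * ?b' = (- 1) \<cdot>\<^sub>m (?b' * ?a')"
    using qcommute_adjoint_modes_adjoint[of i 0 j 0] m by (auto dest: qcommuteD)
  have "?b' = ?b' * (?a * ?a' + ?a' * ?a)"
    unfolding mode_anticommutator_adjoint[OF m(1)] using m carrier by simp
  \<comment> \<open>Grouped so that undoing the exchanges \<open>ba\<close> and \<open>ab\<close>
    produces the commutator literally; the summands with a squared creation operator are
    zero.\<close>
  also have "\<dots> = (?a' * ((- 1) \<cdot>\<^sub>m (?a' * ?b)) + ?b' * (?a * ?a')) - ((?a' * ?a') * ?b + ((- 1) \<cdot>\<^sub>m (?b' * ?a')) * ?a)"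
  proof -
    have "?a' * ((- 1) \<cdot>\<^sub>m (?a' * ?b)) = (- 1) \<cdot>\<^sub>m ((?a' * ?a') * ?b)"
      using m by (simp add: mat_dim_simps)
    also have "\<dots> = 0\<^sub>m d d" unfolding nilpotent_mode_adjoint[OF m(1)] using m carrier by simp
    finally have 1: "?a' * ((- 1) \<cdot>\<^sub>m (?a' * ?b)) = 0\<^sub>m d d" .
    have 2: "(?a' * ?a') * ?b = 0\<^sub>m d d"
      unfolding nilpotent_mode_adjoint[OF m(1)] using m carrier by simp
    have cs: "?b' * (?a * ?a') \<in> carrier_mat d d" "?b' * (?a' * ?a) \<in> carrier_mat d d"
      using m by (auto intro!: carrier_matI)
    have 3: "((- 1) \<cdot>\<^sub>m (?b' * ?a')) * ?a = (- 1) \<cdot>\<^sub>m (?b' * (?a' * ?a))"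
      using m by (simp add: mat_dim_simps)
    have 4: "?b' * (?a * ?a' + ?a' * ?a) = ?b' * (?a * ?a') + ?b' * (?a' * ?a)"
      using m by (simp add: mat_distrib_simps)
    show ?thesis
      unfolding 1 2 3 4 using cs by (intro eq_matI) (auto simp del: index_mult_mat(1))
  qed
  also have "\<dots> = hopping f i j * ?a' - ?a' * hopping f i j"
    unfolding ba[symmetric] ab[symmetric] hopping_def
    using m by (simp add: mat_distrib_simps mat_dim_simps smult_distrib_mat)
  also have "\<dots> = 0\<^sub>m d d" unfolding zero using m carrier by simp
  finally have "?b' = 0\<^sub>m d d" .
  with mode_anticommutator_adjoint[OF m(2)] have "1\<^sub>m d = (0\<^sub>m d d :: complex mat)"
    using m carrier by simp
  hence "(1\<^sub>m d :: complex mat) $$ (0, 0) = 0\<^sub>m d d $$ (0, 0)" by simp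
  thus False using \<open>0 < d\<close> by simp
qed

end

section \<open>Operators on qubits\<close>

lemma unset_bit_less: "r < 2 ^ n \<Longrightarrow> unset_bit q r < (2 ^ n :: nat)"
  unfolding take_bit_nat_eq_self_iff[symmetric]
  by (rule bit_eqI) (metis bit_take_bit_iff bit_unset_bit_iff)

lemma set_bit_less: "q < n \<Longrightarrow> r < 2 ^ n \<Longrightarrow> set_bit q r < (2 ^ n :: nat)"
  by (simp add: take_bit_nat_eq_self_iff[symmetric] take_bit_set_bit_eq)

lemma unset_bit_eq_iff: "unset_bit q r = unset_bit q c \<longleftrightarrow> (\<forall>p. p \<noteq> q \<longrightarrow> bit r p = bit (c::nat) p)"
  by (subst bit_eq_iff) (auto simp: bit_simps)

lemma unset_bit_eq_and_bit_iff: "unset_bit q r = unset_bit q c \<and> bit r q = bit c q \<longleftrightarrow> r = (c::nat)"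
  unfolding unset_bit_eq_iff by (metis bit_eqI)

lemma unset_bit_bits:
  "unset_bit q (unset_bit q r) = unset_bit q (r::nat)" "unset_bit q (set_bit q r) = unset_bit q r"
  "\<not> bit (unset_bit q r) q" "bit (set_bit q r) q"
  "\<not> bit r q \<Longrightarrow> unset_bit q r = r" "bit r q \<Longrightarrow> set_bit q r = r"
  "bit r q \<Longrightarrow> set_bit q (unset_bit q r) = r"
  by (auto simp: bit_simps intro!: bit_eqI)

lemma set_unset_bit_neq: "set_bit q r \<noteq> unset_bit q (r::nat)"
  using unset_bit_bits(3,4) by metis

lemma unset_bit_fibre: "unset_bit q c = unset_bit q r \<Longrightarrow> c \<in> {unset_bit q r, set_bit q (r::nat)}"
  by (cases "bit c q"; cases "bit r q")
    (metis insertCI unset_bit_bits unset_bit_eq_and_bit_iff)+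

section \<open>One-qubit operators\<close>

lemma on_qubit_carrier [simp]: "on_qubit n q M \<in> carrier_mat (2 ^ n) (2 ^ n)"
  by (simp add: on_qubit_def)

lemma dim_on_qubit [simp]: "dim_row (on_qubit n q M) = 2 ^ n" "dim_col (on_qubit n q M) = 2 ^ n"
  by (simp_all add: on_qubit_def)

lemma on_qubit_index:
  "r < 2 ^ n \<Longrightarrow> c < 2 ^ n \<Longrightarrow> on_qubit n q M $$ (r, c) =
    (if unset_bit q r = unset_bit q c then M $$ (of_bool (bit r q), of_bool (bit c q)) else 0)"
  by (simp add: on_qubit_def)

text \<open>Row \<open>r\<close> of a one-qubit operator is supported on the two indices that agree
  with \<open>r\<close> away from qubit \<open>q\<close>, so the sum over all indices collapses to
  two terms.\<close>

lemma on_qubit_mult_index: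
  assumes W: "W \<in> carrier_mat (2 ^ n) (2 ^ n)" and "q < n" and rc: "r < 2 ^ n" "c < 2 ^ n"
  shows "(on_qubit n q M * W) $$ (r, c) =
      M $$ (of_bool (bit r q), 0) * W $$ (unset_bit q r, c) +
      M $$ (of_bool (bit r q), 1) * W $$ (set_bit q r, c)"
proof -
  have "(on_qubit n q M * W) $$ (r, c) = (\<Sum>k\<in>{0..<2^n}. on_qubit n q M $$ (r, k) * W $$ (k, c))"
    using W rc by (auto simp: scalar_prod_def intro!: sum.cong)
  also have "\<dots> = (\<Sum>k\<in>{unset_bit q r, set_bit q r}. on_qubit n q M $$ (r, k) * W $$ (k, c))"
    using rc unset_bit_less set_bit_less[OF \<open>q < n\<close>]
    by (intro sum.mono_neutral_right) (auto simp: on_qubit_index dest: unset_bit_fibre[OF sym])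
  also have "\<dots> = M $$ (of_bool (bit r q), 0) * W $$ (unset_bit q r, c) +
      M $$ (of_bool (bit r q), 1) * W $$ (set_bit q r, c)"
    using rc unset_bit_less set_bit_less[OF \<open>q < n\<close>] set_unset_bit_neq[of q r]
    by (simp add: on_qubit_index unset_bit_bits)
  finally show ?thesis .
qed

lemma mult_on_qubit_index:
  assumes W: "W \<in> carrier_mat (2 ^ n) (2 ^ n)" and "q < n" and rc: "r < 2 ^ n" "c < 2 ^ n"
  shows "(W * on_qubit n q M) $$ (r, c) =
      W $$ (r, unset_bit q c) * M $$ (0, of_bool (bit c q)) +
      W $$ (r, set_bit q c) * M $$ (1, of_bool (bit c q))"
proof -
  have "(W * on_qubit n q M) $$ (r, c) = (\<Sum>k\<in>{0..<2^n}. W $$ (r, k) * on_qubit n q M $$ (k, c))"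
    using W rc by (auto simp: scalar_prod_def intro!: sum.cong)
  also have "\<dots> = (\<Sum>k\<in>{unset_bit q c, set_bit q c}. W $$ (r, k) * on_qubit n q M $$ (k, c))"
    using rc unset_bit_less set_bit_less[OF \<open>q < n\<close>]
    by (intro sum.mono_neutral_right) (auto simp: on_qubit_index dest: unset_bit_fibre)
  also have "\<dots> = W $$ (r, unset_bit q c) * M $$ (0, of_bool (bit c q)) +
      W $$ (r, set_bit q c) * M $$ (1, of_bool (bit c q))"
    using rc unset_bit_less set_bit_less[OF \<open>q < n\<close>] set_unset_bit_neq[of q c]
    by (simp add: on_qubit_index unset_bit_bits)
  finally show ?thesis .
qed

lemma acts_trivially_qcommute:
  assumes W: "W \<in> carrier_mat (2 ^ n) (2 ^ n)" and q: "q < n" and triv: "acts_trivially n W q"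
  shows "qcommute (2 ^ n) 1 (on_qubit n q M) W"
proof -
  obtain g where g: "\<And>r c. r < 2 ^ n \<Longrightarrow> c < 2 ^ n \<Longrightarrow>
     W $$ (r, c) = (if bit r q = bit c q then g (unset_bit q r) (unset_bit q c) else 0)"
    using triv by (auto simp: acts_trivially_def)
  have "on_qubit n q M * W = W * on_qubit n q M"
  proof (rule eq_matI)
    fix r c assume "r < dim_row (W * on_qubit n q M)" "c < dim_col (W * on_qubit n q M)"
    hence rc: "r < 2 ^ n" "c < 2 ^ n" using W by auto
    show "(on_qubit n q M * W) $$ (r, c) = (W * on_qubit n q M) $$ (r, c)"
      unfolding on_qubit_mult_index[OF W q rc] mult_on_qubit_index[OF W q rc]
      using rc unset_bit_less[OF rc(1)] unset_bit_less[OF rc(2)]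
        set_bit_less[OF q rc(1)] set_bit_less[OF q rc(2)]
      by (simp add: g unset_bit_bits)
  qed (use W in auto)
  thus ?thesis using W by (simp add: qcommute_def)
qed

section \<open>Pauli matrices and trivial action\<close>

lemma pauli_index [simp]:
  "pauli_X $$ (0, 0) = 0" "pauli_X $$ (0, Suc 0) = 1" "pauli_X $$ (Suc 0, 0) = 1"
  "pauli_X $$ (Suc 0, Suc 0) = 0"
  "pauli_Y $$ (0, 0) = 0" "pauli_Y $$ (0, Suc 0) = - \<i>" "pauli_Y $$ (Suc 0, 0) = \<i>"
  "pauli_Y $$ (Suc 0, Suc 0) = 0"
  "pauli_Z $$ (0, 0) = 1" "pauli_Z $$ (0, Suc 0) = 0" "pauli_Z $$ (Suc 0, 0) = 0"
  "pauli_Z $$ (Suc 0, Suc 0) = - 1"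
  by (simp_all add: pauli_X_def pauli_Y_def pauli_Z_def mat_of_rows_list_def)

lemma dim_pauli [simp]:
  "dim_row pauli_X = 2" "dim_row pauli_Y = 2" "dim_row pauli_Z = 2"
  "dim_col pauli_X = 2" "dim_col pauli_Y = 2" "dim_col pauli_Z = 2"
  by (simp_all add: pauli_X_def pauli_Y_def pauli_Z_def mat_of_rows_list_def)

lemma pauli_carrier [simp]:
  "pauli_X \<in> carrier_mat 2 2" "pauli_Y \<in> carrier_mat 2 2" "pauli_Z \<in> carrier_mat 2 2"
  by (auto intro!: carrier_matI)

lemma mat2_eqI:
  assumes "A \<in> carrier_mat 2 2" "B \<in> carrier_mat 2 2"
    and "A $$ (0, 0) = B $$ (0, 0)" "A $$ (0, Suc 0) = B $$ (0, Suc 0)"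
    "A $$ (Suc 0, 0) = B $$ (Suc 0, 0)" "A $$ (Suc 0, Suc 0) = B $$ (Suc 0, Suc 0)"
  shows "A = B"
  using assms by (intro eq_matI) (auto simp: less_2_cases_iff)

lemma mult_mat2_index:
  assumes "A \<in> carrier_mat 2 2" "B \<in> carrier_mat 2 2" "r < 2" "c < 2"
  shows "(A * B) $$ (r, c) = A $$ (r, 0) * B $$ (0, c) + A $$ (r, Suc 0) * B $$ (Suc 0, c)"
  using assms by (simp add: scalar_prod_def numeral_2_eq_2)

text \<open>Commuting with \<open>Z\<close> kills the entries between indices that differ at qubit
  \<open>q\<close>, and commuting with \<open>X\<close> equates the two remaining blocks.\<close>

lemma acts_triviallyI:
  assumes q: "q < n" and X: "qcommute (2 ^ n) 1 (on_qubit n q pauli_X) W"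
    and Z: "qcommute (2 ^ n) 1 (on_qubit n q pauli_Z) W"
  shows "acts_trivially n W q"
  unfolding acts_trivially_def
\<comment> \<open>The operator on the other qubits is read off from the block in which qubit
  \<open>q\<close> is 0 on both sides.\<close>
proof (intro exI[of _ "\<lambda>a b. W $$ (a, b)"] allI impI)
  fix r c :: nat assume rc: "r < 2 ^ n" "c < 2 ^ n"
  note W = qcommuteD(2)[OF X]
  have Xeq: "(on_qubit n q pauli_X * W) $$ (a, b) = (W * on_qubit n q pauli_X) $$ (a, b)" for a b
    using qcommuteD(3)[OF X] by simp
  have Zeq: "(on_qubit n q pauli_Z * W) $$ (a, b) = (W * on_qubit n q pauli_Z) $$ (a, b)" for a b
    using qcommuteD(3)[OF Z] by simp
  show "W $$ (r, c) = (if bit r q = bit c q then W $$ (unset_bit q r, unset_bit q c) else 0)"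
  proof (cases "bit r q = bit c q")
    case True
    show ?thesis
    proof (cases "bit r q")
      case b: True
      hence "W $$ (unset_bit q r, unset_bit q c) = W $$ (r, c)"
        using Xeq[of r "unset_bit q c"] rc unset_bit_less[OF rc(2)] True
        unfolding on_qubit_mult_index[OF W q rc(1) unset_bit_less[OF rc(2)]]
          mult_on_qubit_index[OF W q rc(1) unset_bit_less[OF rc(2)]]
        by (simp add: unset_bit_bits)
      thus ?thesis using True by simp
    next
      case False
      thus ?thesis using True by (simp add: unset_bit_bits)
    qed
  next
    case False
    have "W $$ (r, c) = - W $$ (r, c)"
      using Zeq[of r c] False
      unfolding on_qubit_mult_index[OF W q rc] mult_on_qubit_index[OF W q rc]
      by (cases "bit r q"; cases "bit c q") (auto simp: unset_bit_bits)
    thus ?thesis using False by simp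
  qed
qed

lemma acts_trivially_on_other_qubit:
  assumes "q \<noteq> q'"
  shows "acts_trivially n (on_qubit n q' M) q"
  unfolding acts_trivially_def
proof (intro exI[of _ "\<lambda>a b. if unset_bit q' a = unset_bit q' b
    then M $$ (of_bool (bit a q'), of_bool (bit b q')) else 0"] allI impI)
  fix r c :: nat assume rc: "r < 2 ^ n" "c < 2 ^ n"
  have "unset_bit q' r = unset_bit q' c \<longleftrightarrow>
      bit r q = bit c q \<and> unset_bit q' (unset_bit q r) = unset_bit q' (unset_bit q c)"
    using assms by (auto simp: unset_bit_eq_iff bit_simps)
  moreover have "bit (unset_bit q x) q' = bit x q'" for x :: nat
    using assms by (simp add: bit_simps)
  ultimately show "on_qubit n q' M $$ (r, c) =
      (if bit r q = bit c q then
        (if unset_bit q' (unset_bit q r) = unset_bit q' (unset_bit q c)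
         then M $$ (of_bool (bit (unset_bit q r) q'), of_bool (bit (unset_bit q c) q')) else 0)
       else 0)"
    using rc by (simp add: on_qubit_index)
qed

lemma qcommute_on_other_qubit:
  assumes "q \<noteq> q'" "q < n"
  shows "qcommute (2 ^ n) 1 (on_qubit n q A) (on_qubit n q' B)"
  using acts_trivially_qcommute acts_trivially_on_other_qubit assms by simp

lemma on_qubit_mult:
  assumes "A \<in> carrier_mat 2 2" "B \<in> carrier_mat 2 2" "q < n"
  shows "on_qubit n q A * on_qubit n q B = on_qubit n q (A * B)"
proof (rule eq_matI)
  fix r c assume "r < dim_row (on_qubit n q (A * B))" "c < dim_col (on_qubit n q (A * B))"
  hence rc: "r < 2 ^ n" "c < 2 ^ n" by auto
  show "(on_qubit n q A * on_qubit n q B) $$ (r, c) = on_qubit n q (A * B) $$ (r, c)"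
    unfolding on_qubit_mult_index[OF on_qubit_carrier assms(3) rc]
    using rc unset_bit_less[OF rc(1)] set_bit_less[OF assms(3) rc(1)]
    by (simp add: on_qubit_index unset_bit_bits mult_mat2_index[OF assms(1,2)] del: index_mult_mat(1))
qed auto

lemma on_qubit_one: "on_qubit n q (1\<^sub>m 2) = 1\<^sub>m (2 ^ n)"
  using unset_bit_eq_and_bit_iff[of q]
  by (intro eq_matI) (auto simp: on_qubit_index)

lemma on_qubit_zero: "on_qubit n q (0\<^sub>m 2 2) = 0\<^sub>m (2 ^ n) (2 ^ n)"
  by (intro eq_matI) (auto simp: on_qubit_index)

lemma on_qubit_adjoint:
  "M \<in> carrier_mat 2 2 \<Longrightarrow> mat_adjoint (on_qubit n q M) = on_qubit n q (mat_adjoint M)"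
  by (intro eq_matI) (auto simp: on_qubit_index)

lemma on_qubit_add:
  "A \<in> carrier_mat 2 2 \<Longrightarrow> B \<in> carrier_mat 2 2 \<Longrightarrow>
    on_qubit n q A + on_qubit n q B = on_qubit n q (A + B)"
  by (intro eq_matI) (auto simp: on_qubit_index)

lemma on_qubit_minus:
  "A \<in> carrier_mat 2 2 \<Longrightarrow> B \<in> carrier_mat 2 2 \<Longrightarrow>
    on_qubit n q A - on_qubit n q B = on_qubit n q (A - B)"
  by (intro eq_matI) (auto simp: on_qubit_index)

lemma on_qubit_smult:
  "A \<in> carrier_mat 2 2 \<Longrightarrow> k \<cdot>\<^sub>m on_qubit n q A = on_qubit n q (k \<cdot>\<^sub>m A)"
  by (intro eq_matI) (auto simp: on_qubit_index)

lemma qcommute_on_same_qubit: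
  assumes "qcommute 2 s A B" "q < n"
  shows "qcommute (2 ^ n) s (on_qubit n q A) (on_qubit n q B)"
  using qcommuteD[OF assms(1)] assms(2)
  by (simp add: qcommute_def on_qubit_mult on_qubit_smult)

lemma qcommute_pauli:
  "qcommute 2 (- 1) pauli_X pauli_Z" "qcommute 2 1 pauli_Z pauli_Z" 
  by (auto simp: qcommute_def mult_mat2_index simp del: index_mult_mat(1) intro!: mat2_eqI)

lemma pauli_square: "pauli_X * pauli_X = 1\<^sub>m 2" "pauli_Z * pauli_Z = 1\<^sub>m 2"
  by (auto simp: mult_mat2_index simp del: index_mult_mat(1) intro!: mat2_eqI)

lemma pauli_Z_adjoint: "mat_adjoint pauli_Z = pauli_Z"
  by (auto intro!: mat2_eqI)

text \<open>A trivially acting \<open>W\<close> would both commute and anticommute with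
  \<open>A\<close> on qubit \<open>q\<close>, so their product would vanish; as \<open>A\<close>
  squares to the identity, so would \<open>W\<close>.\<close>

lemma not_acts_trivially:
  assumes q: "q < n" and W: "W \<noteq> 0\<^sub>m (2 ^ n) (2 ^ n)"
    and A: "A \<in> carrier_mat 2 2" "A * A = 1\<^sub>m 2"
    and anti: "qcommute (2 ^ n) (- 1) (on_qubit n q A) W"
  shows "\<not> acts_trivially n W q"
proof
  assume "acts_trivially n W q"
  note cs = qcommuteD[OF anti]
  let ?O = "on_qubit n q A"
  have "?O * W = W * ?O"
    using qcommuteD(3)[OF acts_trivially_qcommute[OF cs(2) q \<open>acts_trivially n W q\<close>]] by simp
  hence eq: "?O * W = (- 1) \<cdot>\<^sub>m (?O * W)" using cs(3) by simp
  have z: "?O * W = 0\<^sub>m (2 ^ n) (2 ^ n)"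
  proof (rule eq_matI)
    fix r c assume "r < dim_row (0\<^sub>m (2 ^ n) (2 ^ n) :: complex mat)" "c < dim_col (0\<^sub>m (2 ^ n) (2 ^ n) :: complex mat)"
    thus "(?O * W) $$ (r, c) = 0\<^sub>m (2 ^ n) (2 ^ n) $$ (r, c)"
      using arg_cong[OF eq, of "\<lambda>M. M $$ (r, c)"] cs(2) by (simp del: index_mult_mat(1))
  qed (use cs(2) in auto)
  have "W = (?O * ?O) * W" using cs(2) A q by (simp add: on_qubit_mult on_qubit_one)
  also have "\<dots> = ?O * (?O * W)" using cs(2) by (simp add: mat_dim_simps)
  also have "\<dots> = 0\<^sub>m (2 ^ n) (2 ^ n)" unfolding z by simp
  finally show False using W by simp
qed

section \<open>The Jordan--Wigner transformation\<close>

text \<open>The matrix of (X - iY)/2. It maps |0> to |1>, so an empty mode corresponds to the qubit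
  state |1>.\<close>

definition jw_lowering :: "complex mat" where
  "jw_lowering = mat_of_rows_list 2 [[0, 0], [1, 0]]"

text \<open>The strings S_i and Z_{i,<l} together fill exactly the qubits numbered below that of the
  mode, so they merge into this single string.\<close>

definition z_string :: "nat \<Rightarrow> nat \<Rightarrow> complex mat" where
  "z_string n q = mat_prod (2 ^ n) (map (\<lambda>p. on_qubit n p pauli_Z) [0..<q])"

text \<open>The one-qubit factor is left arbitrary so that a mode and its adjoint are treated
  alike.\<close>

definition stringed :: "nat \<Rightarrow> nat \<Rightarrow> complex mat \<Rightarrow> complex mat" where
  "stringed n q A = z_string n q * on_qubit n q A"

lemma z_string_carrier [simp]: "z_string n q \<in> carrier_mat (2 ^ n) (2 ^ n)"
  unfolding z_string_def by (rule mat_prod_carrier) auto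

lemma dim_z_string [simp]: "dim_row (z_string n q) = 2 ^ n" "dim_col (z_string n q) = 2 ^ n"
  using z_string_carrier[of n q] by (blast dest: carrier_matD)+

lemma z_string_0 [simp]: "z_string n 0 = 1\<^sub>m (2 ^ n)"
  by (simp add: z_string_def mat_prod_def)

lemma z_string_Suc: "z_string n (Suc q) = z_string n q * on_qubit n q pauli_Z"
proof -
  have "z_string n (Suc q) = mat_prod (2 ^ n) (map (\<lambda>p. on_qubit n p pauli_Z) [0..<q] @ [on_qubit n q pauli_Z])"
    by (simp add: z_string_def)
  also have "\<dots> = z_string n q * mat_prod (2 ^ n) [on_qubit n q pauli_Z]"
    unfolding z_string_def by (rule mat_prod_append) auto
  finally show ?thesis by (simp add: mat_prod_def right_mult_one_mat[of _ "2 ^ n" "2 ^ n"])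
qed

text \<open>Only the factor of the string on qubit \<open>p\<close> itself can contribute a
  sign.\<close>

lemma qcommute_z_string:
  assumes "p < n" and "p < q \<Longrightarrow> qcommute 2 s A pauli_Z"
  shows "qcommute (2 ^ n) (if p < q then s else 1) (on_qubit n p A) (z_string n q)"
  using assms(2)
proof (induction q)
  case 0
  show ?case by simp
next
  case (Suc q)
  have IH: "qcommute (2 ^ n) (if p < q then s else 1) (on_qubit n p A) (z_string n q)"
    using Suc by auto
  have "qcommute (2 ^ n) (if p = q then s else 1) (on_qubit n p A) (on_qubit n q pauli_Z)"
    using Suc.prems assms(1) qcommute_on_other_qubit[of p q n] qcommute_on_same_qubit[of s A pauli_Z p n]
    by auto
  from qcommute_mult_right[OF IH this] show ?case by (auto simp: z_string_Suc split: if_splits)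
qed

lemma qcommute_pauli_Z_z_string:
  "p < n \<Longrightarrow> qcommute (2 ^ n) 1 (on_qubit n p pauli_Z) (z_string n q)"
  using qcommute_z_string[of p n q 1 pauli_Z] qcommute_pauli(2) by simp

lemma qcommute_z_strings:
  assumes "q \<le> n"
  shows "qcommute (2 ^ n) 1 (z_string n q) (z_string n q')"
  using assms
proof (induction q)
  case 0
  show ?case by (simp add: qcommute_sym[OF qcommute_one])
next
  case (Suc q)
  have "qcommute (2 ^ n) (1 * 1) (z_string n q * on_qubit n q pauli_Z) (z_string n q')"
    using Suc by (intro qcommute_mult_left qcommute_pauli_Z_z_string) auto
  thus ?case by (simp add: z_string_Suc)
qed

lemma z_string_square:
  assumes "q \<le> n"
  shows "z_string n q * z_string n q = 1\<^sub>m (2 ^ n)"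
  using assms
proof (induction q)
  case 0
  show ?case by simp
next
  case (Suc q)
  let ?S = "z_string n q" and ?Z = "on_qubit n q pauli_Z"
  have "?S * ?Z * (?S * ?Z) = ?S * ((?Z * ?S) * ?Z)" by (simp add: mat_dim_simps)
  also have "?Z * ?S = ?S * ?Z"
    using qcommuteD(3)[OF qcommute_pauli_Z_z_string[of q n q]] Suc.prems by simp
  also have "?S * (?S * ?Z * ?Z) = (?S * ?S) * (?Z * ?Z)" by (simp add: mat_dim_simps)
  also have "\<dots> = 1\<^sub>m (2 ^ n)"
    using Suc by (simp add: on_qubit_mult pauli_square on_qubit_one)
  finally show ?case by (simp add: z_string_Suc)
qed

lemma z_string_adjoint:
  assumes "q \<le> n"
  shows "mat_adjoint (z_string n q) = z_string n q"
  using assms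
proof (induction q)
  case 0
  show ?case by (simp add: mat_adjoint_one)
next
  case (Suc q)
  have "on_qubit n q pauli_Z * z_string n q = z_string n q * on_qubit n q pauli_Z"
    using qcommuteD(3)[OF qcommute_pauli_Z_z_string[of q n q]] Suc.prems by simp
  thus ?case
    using Suc by (simp add: z_string_Suc mat_adjoint_mult on_qubit_adjoint pauli_Z_adjoint)
qed

lemma stringed_carrier [simp]: "stringed n q A \<in> carrier_mat (2 ^ n) (2 ^ n)"
  by (auto simp: stringed_def intro!: carrier_matI)

lemma stringed_adjoint:
  assumes "q < n" "A \<in> carrier_mat 2 2"
  shows "mat_adjoint (stringed n q A) = stringed n q (mat_adjoint A)"
proof -
  have "qcommute (2 ^ n) 1 (on_qubit n q (mat_adjoint A)) (z_string n q)"
    using qcommute_z_string[of q n q 1 "mat_adjoint A"] assms by simp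
  thus ?thesis
    using assms
    by (simp add: stringed_def mat_adjoint_mult z_string_adjoint on_qubit_adjoint
        qcommute_def)
qed

lemma qcommute_pauli_Z_stringed:
  assumes "q < n" "p < n" "qcommute 2 (- 1) A pauli_Z"
  shows "qcommute (2 ^ n) (if q = p then - 1 else 1) (on_qubit n q pauli_Z) (stringed n p A)"
proof -
  have "qcommute (2 ^ n) (if q = p then - 1 else 1) (on_qubit n q pauli_Z) (on_qubit n p A)"
    using assms qcommute_on_other_qubit[of q p n] qcommute_on_same_qubit[OF qcommute_sym[OF assms(3)], of p n]
    by auto
  from qcommute_mult_right[OF qcommute_pauli_Z_z_string[OF assms(1)] this, of p]
  show ?thesis by (simp add: stringed_def)
qed

text \<open>The sign tells whether the string of \<open>p\<close> passes over \<open>q\<close>. At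
  \<open>q = p\<close> the lowering matrix would have no sign: conjugation by \<open>X\<close> turns
  it into its adjoint.\<close>

lemma qcommute_pauli_X_stringed:
  assumes "q < n" "q \<noteq> p"
  shows "qcommute (2 ^ n) (if q < p then - 1 else 1) (on_qubit n q pauli_X) (stringed n p A)"
proof -
  have "qcommute (2 ^ n) (if q < p then - 1 else 1) (on_qubit n q pauli_X) (z_string n p)"
    using assms qcommute_pauli(1) by (intro qcommute_z_string) auto
  from qcommute_mult_right[OF this qcommute_on_other_qubit[of q p n pauli_X A]] assms
  show ?thesis by (simp add: stringed_def)
qed

text \<open>The sign comes from a single place: \<open>A\<close> on qubit \<open>q\<close> meets the
  \<open>Z\<close> of the longer string there.\<close>

lemma qcommute_stringed_less:
  assumes "q < p" "p < n" "qcommute 2 (- 1) A pauli_Z"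
  shows "qcommute (2 ^ n) (- 1) (stringed n q A) (stringed n p B)"
proof -
  have A: "A \<in> carrier_mat 2 2" using assms(3) by (rule qcommuteD)
  have 1: "qcommute (2 ^ n) 1 (z_string n q) (on_qubit n p B)"
    using qcommute_sym[OF qcommute_z_string[of p n q 1 B]] assms by simp
  have 2: "qcommute (2 ^ n) (- 1) (on_qubit n q A) (z_string n p)"
    using qcommute_z_string[of q n p "- 1" A] assms A by simp
  have "qcommute (2 ^ n) (1 * - 1) (stringed n q A) (z_string n p)"
    unfolding stringed_def using 2 assms by (intro qcommute_mult_left qcommute_z_strings) auto
  moreover have "qcommute (2 ^ n) (1 * 1) (stringed n q A) (on_qubit n p B)"
    unfolding stringed_def using 1 assms
    by (intro qcommute_mult_left qcommute_on_other_qubit) auto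
  ultimately have "qcommute (2 ^ n) (1 * - 1 * (1 * 1)) (stringed n q A) (stringed n p B)"
    unfolding stringed_def[of n p] by (rule qcommute_mult_right)
  thus ?thesis by simp
qed

lemma qcommute_stringed:
  assumes "q \<noteq> p" "q < n" "p < n" "qcommute 2 (- 1) A pauli_Z" "qcommute 2 (- 1) B pauli_Z"
  shows "qcommute (2 ^ n) (- 1) (stringed n q A) (stringed n p B)"
  using assms qcommute_stringed_less[of q p n A B]
    qcommute_sym[OF qcommute_stringed_less[of p q n B A]] by (cases "q < p") auto

lemma stringed_mult:
  assumes "q < n" "A \<in> carrier_mat 2 2" "B \<in> carrier_mat 2 2"
  shows "stringed n q A * stringed n q B = on_qubit n q (A * B)"
proof -
  let ?S = "z_string n q" and ?A = "on_qubit n q A" and ?B = "on_qubit n q B"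
  have AS: "?A * ?S = ?S * ?A"
    using qcommuteD(3)[OF qcommute_z_string[of q n q 1 A]] assms by simp
  have "stringed n q A * stringed n q B = ?S * ((?A * ?S) * ?B)"
    by (simp add: stringed_def mat_dim_simps)
  also have "\<dots> = (?S * ?S) * (?A * ?B)" unfolding AS by (simp add: mat_dim_simps)
  also have "\<dots> = on_qubit n q (A * B)" using assms by (simp add: z_string_square on_qubit_mult)
  finally show ?thesis .
qed

section \<open>Numbering of the qubits\<close>

lemma qubit_less_iff:
  assumes "1 \<le> i" "1 \<le> j" "k \<le> \<nu>" "l \<le> \<nu>"
  shows "qubit \<nu> i k < qubit \<nu> j l \<longleftrightarrow> i < j \<or> i = j \<and> k < l"
proof -
  have less: "qubit \<nu> i k < qubit \<nu> j l" if "i < j" "1 \<le> i" "k \<le> \<nu>" for i j k l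
  proof -
    have "(i - 1) * (\<nu> + 1) + k < (i - 1) * (\<nu> + 1) + (\<nu> + 1)" using that by linarith
    also have "\<dots> = (i - 1 + 1) * (\<nu> + 1)" by (simp only: add_mult_distrib mult_1)
    also have "\<dots> \<le> (j - 1) * (\<nu> + 1)" using that by (intro mult_le_mono1) auto
    finally show ?thesis by (simp add: qubit_def)
  qed
  show ?thesis
    using less[of i j k l] less[of j i l k] assms by (cases i j rule: linorder_cases) (auto simp: qubit_def)
qed

lemma qubit_eq_iff:
  assumes "1 \<le> i" "1 \<le> j" "k \<le> \<nu>" "l \<le> \<nu>"
  shows "qubit \<nu> i k = qubit \<nu> j l \<longleftrightarrow> i = j \<and> k = l"
  using qubit_less_iff[of i j k \<nu> l] qubit_less_iff[of j i l \<nu> k] assms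
  by (metis linorder_neqE_nat nat_neq_iff)

lemma qubit_less_num_qubits: "i \<in> {1..N} \<Longrightarrow> k \<le> \<nu> \<Longrightarrow> qubit \<nu> i k < num_qubits N \<nu>"
  using qubit_less_iff[of i "N + 1" k \<nu> 0] by (auto simp: qubit_def num_qubits_def)

lemma ex_qubit:
  assumes "q < num_qubits N \<nu>"
  obtains i k where "i \<in> {1..N}" "k \<le> \<nu>" "q = qubit \<nu> i k"
proof (rule that)
  show "q div (\<nu> + 1) + 1 \<in> {1..N}"
    using assms by (auto simp: num_qubits_def less_mult_imp_div_less Suc_le_eq)
  show "q mod (\<nu> + 1) \<le> \<nu>" using mod_less_divisor[of "\<nu> + 1" q] by linarith
  show "q = qubit \<nu> (q div (\<nu> + 1) + 1) (q mod (\<nu> + 1))"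
    unfolding qubit_def by (simp only: add_diff_cancel_right' div_mult_mod_eq)
qed

lemma map_shift_upt: "map (\<lambda>k. F (a + k)) [0..<b] = map F [a..<a + b]"
  by (rule nth_equalityI) auto

lemma jw_string_eq:
  assumes "1 \<le> i"
  shows "jw_string N \<nu> i = z_string (num_qubits N \<nu>) ((i - 1) * (\<nu> + 1))"
proof -
  have "concat (map (\<lambda>j. map (\<lambda>k. F (qubit \<nu> j k)) [0..<\<nu> + 1]) [1..<i]) = map F [0..<(i - 1) * (\<nu> + 1)]"
    for F :: "nat \<Rightarrow> complex mat"
    using assms
  proof (induction i rule: dec_induct)
    case (step i)
    \<comment> \<open>Site \<open>i\<close> fills the next \<nu> + 1 qubits; truncated subtraction
      is harmless because sites are numbered from 1.\<close>
    have "map (\<lambda>k. F (qubit \<nu> i k)) [0..<\<nu> + 1] = map F [(i - 1) * (\<nu> + 1)..<(i - 1) * (\<nu> + 1) + (\<nu> + 1)]"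
      unfolding qubit_def by (rule map_shift_upt)
    moreover have "(Suc i - 1) * (\<nu> + 1) = (i - 1) * (\<nu> + 1) + (\<nu> + 1)"
      using step.hyps by (cases i) auto
    ultimately show ?case
      using step by (simp only: upt_Suc_append concat_append map_append upt_add_eq_append[OF le0]) simp
  qed simp
  from arg_cong[OF this] show ?thesis unfolding jw_string_def z_string_def .
qed

lemma jw_site_string_eq:
  "z_string (num_qubits N \<nu>) ((i - 1) * (\<nu> + 1)) * jw_site_string N \<nu> i l =
     z_string (num_qubits N \<nu>) (qubit \<nu> i l)"
proof -
  let ?Z = "\<lambda>p. on_qubit (num_qubits N \<nu>) p pauli_Z"
  have "jw_site_string N \<nu> i l = mat_prod (2 ^ num_qubits N \<nu>) (map ?Z [(i - 1) * (\<nu> + 1)..<qubit \<nu> i l])"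
    unfolding jw_site_string_def qubit_def map_shift_upt[of ?Z] ..
  moreover have "[0..<qubit \<nu> i l] = [0..<(i - 1) * (\<nu> + 1)] @ [(i - 1) * (\<nu> + 1)..<qubit \<nu> i l]"
    unfolding qubit_def by (rule upt_add_eq_append) simp
  moreover have "mat_prod (2 ^ num_qubits N \<nu>) (map ?Z xs @ map ?Z ys) =
      mat_prod (2 ^ num_qubits N \<nu>) (map ?Z xs) * mat_prod (2 ^ num_qubits N \<nu>) (map ?Z ys)" for xs ys
    by (rule mat_prod_append) auto
  ultimately show ?thesis
    unfolding z_string_def by (simp only: map_append)
qed

section \<open>Jordan--Wigner operators and their Pauli weights\<close>

lemma dim_jw_lowering [simp]: "dim_row jw_lowering = 2" "dim_col jw_lowering = 2"
  by (simp_all add: jw_lowering_def mat_of_rows_list_def)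

lemma jw_lowering_carrier [simp]: "jw_lowering \<in> carrier_mat 2 2"
  by (auto intro!: carrier_matI)

lemma jw_lowering_index [simp]:
  "jw_lowering $$ (0, 0) = 0" "jw_lowering $$ (0, Suc 0) = 0" "jw_lowering $$ (Suc 0, 0) = 1"
  "jw_lowering $$ (Suc 0, Suc 0) = 0"
  by (simp_all add: jw_lowering_def mat_of_rows_list_def)

lemma qcommute_jw_lowering:
  "qcommute 2 (- 1) jw_lowering pauli_Z" "qcommute 2 (- 1) (mat_adjoint jw_lowering) pauli_Z"
  by (auto simp: qcommute_def mult_mat2_index simp del: index_mult_mat(1) intro!: mat2_eqI)

lemma jw_eq_stringed:
  assumes "i \<in> {1..N}" "k \<le> \<nu>"
  shows "jw N \<nu> i k = stringed (num_qubits N \<nu>) (qubit \<nu> i k) jw_lowering"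
proof -
  have "(1 / 2) \<cdot>\<^sub>m (pauli_X - \<i> \<cdot>\<^sub>m pauli_Y) = jw_lowering"
    by (rule mat2_eqI) (auto simp: minus_carrier_mat)
  hence "(1 / 2) \<cdot>\<^sub>m (on_qubit n q pauli_X - \<i> \<cdot>\<^sub>m on_qubit n q pauli_Y) = on_qubit n q jw_lowering" for n q
    by (simp add: on_qubit_smult on_qubit_minus minus_carrier_mat)
  moreover have "1 \<le> i" using assms by simp
  ultimately show ?thesis
    unfolding jw_def jw_string_eq[OF \<open>1 \<le> i\<close>] jw_site_string_eq stringed_def by simp
qed

lemma jw_adjoint_eq_stringed:
  assumes "i \<in> {1..N}" "k \<le> \<nu>"
  shows "mat_adjoint (jw N \<nu> i k) = stringed (num_qubits N \<nu>) (qubit \<nu> i k) (mat_adjoint jw_lowering)"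
  using assms by (simp add: jw_eq_stringed stringed_adjoint qubit_less_num_qubits)

lemma jw_lowering_mult:
  "jw_lowering * jw_lowering = 0\<^sub>m 2 2"
  "jw_lowering * mat_adjoint jw_lowering + mat_adjoint jw_lowering * jw_lowering = 1\<^sub>m 2"
  by (auto simp: mult_mat2_index simp del: index_mult_mat(1) intro!: mat2_eqI)

text \<open>Makes the facts derived from the anticommutation relations alone available for the qubit
  operators, in particular that edge operators square to the identity and hopping terms do not
  vanish.\<close>

lemma car_modes_jw: "car_modes N \<nu> (2 ^ num_qubits N \<nu>) (jw N \<nu>)"
proof (unfold_locales, goal_cases)
  case (1 i k)
  thus ?case by (simp add: jw_eq_stringed)
next
  case (2 i k j l)
  hence lt: "qubit \<nu> i k < num_qubits N \<nu>" "qubit \<nu> j l < num_qubits N \<nu>"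
    by (auto intro: qubit_less_num_qubits)
  show ?case
  proof (cases "i = j \<and> k = l")
    case True
    thus ?thesis using 2 lt
      by (simp add: jw_eq_stringed stringed_mult jw_lowering_mult on_qubit_zero)
  next
    case False
    hence "qubit \<nu> i k \<noteq> qubit \<nu> j l" using 2 by (simp add: qubit_eq_iff)
    thus ?thesis using 2 lt
      by (simp add: jw_eq_stringed anticommute_of_qcommute qcommute_stringed qcommute_jw_lowering)
  qed
next
  case (3 i k j l)
  hence lt: "qubit \<nu> i k < num_qubits N \<nu>" "qubit \<nu> j l < num_qubits N \<nu>"
    by (auto intro: qubit_less_num_qubits)
  have c: "jw_lowering * mat_adjoint jw_lowering \<in> carrier_mat 2 2"
    "mat_adjoint jw_lowering * jw_lowering \<in> carrier_mat 2 2" by (auto intro!: carrier_matI)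
  show ?case
  proof (cases "i = j \<and> k = l")
    case True
    thus ?thesis using 3 lt c
      by (simp add: jw_eq_stringed stringed_adjoint stringed_mult jw_lowering_mult on_qubit_add on_qubit_one)
  next
    case False
    hence "qubit \<nu> i k \<noteq> qubit \<nu> j l" using 3 by (simp add: qubit_eq_iff)
    thus ?thesis using 3 lt False
      by (auto simp: jw_eq_stringed stringed_adjoint anticommute_of_qcommute qcommute_stringed
          qcommute_jw_lowering)
  qed
qed

text \<open>Four strings are involved, two ending at each of the sites \<open>i\<close> and
  \<open>j\<close>. A qubit of another site lies under both or neither string of each endpoint, and
  a layer above \<open>l\<close> under neither string of its own site, so all signs cancel. A layer
  strictly between 0 and \<open>l\<close> lies under exactly one string of its own site, which
  leaves a sign against \<open>X\<close>.\<close>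

lemma acts_trivially_jw_term:
  fixes N \<nu> i j l :: nat
  defines "W \<equiv> hopping (jw N \<nu>) i j * edge_op (jw N \<nu>) l i j"
  assumes ij: "i \<in> {1..N}" "j \<in> {1..N}" "i \<noteq> j" and l: "1 \<le> l" "l \<le> \<nu>"
    and s: "s \<in> {1..N}" "k \<le> \<nu>"
  shows "acts_trivially (num_qubits N \<nu>) W (qubit \<nu> s k) \<longleftrightarrow> \<not> (s \<in> {i, j} \<and> k \<le> l)"
proof -
  let ?n = "num_qubits N \<nu>" and ?q = "qubit \<nu>"
  interpret car_modes N \<nu> "2 ^ ?n" "jw N \<nu>" by (rule car_modes_jw)
  have m: "(i, 0) \<in> modes" "(j, 0) \<in> modes" "(i, l) \<in> modes" "(j, l) \<in> modes"
    using ij l by (auto simp: modes_def)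
  have q: "?q s k < ?n" using s by (rule qubit_less_num_qubits)
  have W0: "W \<noteq> 0\<^sub>m (2 ^ ?n) (2 ^ ?n)"
  proof
    assume W0: "W = 0\<^sub>m (2 ^ ?n) (2 ^ ?n)"
    note cs = hopping_carrier[OF m(1,2)] edge_op_carrier[OF m(3,4)]
    \<comment> \<open>The edge operator is invertible, so \<open>W\<close> can vanish only together
      with the hopping term.\<close>
    have "hopping (jw N \<nu>) i j = hopping (jw N \<nu>) i j * (edge_op (jw N \<nu>) l i j * edge_op (jw N \<nu>) l i j)"
      unfolding edge_op_square[OF m(3,4) ij(3)] using cs by simp
    also have "\<dots> = W * edge_op (jw N \<nu>) l i j"
      unfolding W_def using carrier_matD[OF cs(1)] carrier_matD[OF cs(2)] by (simp add: mat_dim_simps)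
    also have "\<dots> = 0\<^sub>m (2 ^ ?n) (2 ^ ?n)" unfolding W0 using cs by simp
    finally show False using hopping_nonzero[OF m(1,2) ij(3)] by simp
  qed
  \<comment> \<open>In every product that makes up \<open>W\<close>, each of the four modes
    contributes exactly one operator, itself or its adjoint, and both have the same sign against
    \<open>A\<close>.\<close>
  have sign: "qcommute (2 ^ ?n) (\<sigma> (?q i 0) * \<sigma> (?q j 0) * (\<sigma> (?q i l) * \<sigma> (?q j l))) A W"
    if sign_stringed: "\<And>p B. p < ?n \<Longrightarrow> p \<in> {?q i 0, ?q j 0, ?q i l, ?q j l} \<Longrightarrow> qcommute 2 (- 1) B pauli_Z \<Longrightarrow>
      qcommute (2 ^ ?n) (\<sigma> p) A (stringed ?n p B)" for A \<sigma>
  proof -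
    have jw: "qcommute (2 ^ ?n) (\<sigma> (?q a b)) A (jw N \<nu> a b)"
      "qcommute (2 ^ ?n) (\<sigma> (?q a b)) A (mat_adjoint (jw N \<nu> a b))"
      if "a \<in> {i, j}" "b \<in> {0, l}" for a b
    proof -
      have ab: "a \<in> {1..N}" "b \<le> \<nu>" using that ij l by auto
      have "?q a b \<in> {?q i 0, ?q j 0, ?q i l, ?q j l}" using that by auto
      note * = sign_stringed[OF qubit_less_num_qubits[OF ab] this]
      show "qcommute (2 ^ ?n) (\<sigma> (?q a b)) A (jw N \<nu> a b)"
        unfolding jw_eq_stringed[OF ab] by (rule *[OF qcommute_jw_lowering(1)])
      show "qcommute (2 ^ ?n) (\<sigma> (?q a b)) A (mat_adjoint (jw N \<nu> a b))"
        unfolding jw_adjoint_eq_stringed[OF ab] by (rule *[OF qcommute_jw_lowering(2)])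
    qed
    show ?thesis
      unfolding W_def
      by (intro qcommute_mult_right qcommute_hopping qcommute_edge_op qcommute_majorana_c
          qcommute_majorana_d jw) auto
  qed
  let ?M = "{?q i 0, ?q j 0, ?q i l, ?q j l}"
  \<comment> \<open>\<open>\<zeta>\<close> registers that the qubit carries the mode at
    \<open>p\<close>, and \<open>\<xi>\<close> that the string of this mode passes over the
    qubit.\<close>
  define \<zeta> \<xi> :: "nat \<Rightarrow> complex"
    where "\<zeta> p = (if ?q s k = p then - 1 else 1)" and "\<xi> p = (if ?q s k < p then - 1 else 1)" for p
  have Z: "qcommute (2 ^ ?n) (\<zeta> (?q i 0) * \<zeta> (?q j 0) * (\<zeta> (?q i l) * \<zeta> (?q j l)))
      (on_qubit ?n (?q s k) pauli_Z) W"
    unfolding \<zeta>_def by (rule sign[of "\<lambda>p. if ?q s k = p then - 1 else 1"], rule qcommute_pauli_Z_stringed[OF q])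
  have X: "qcommute (2 ^ ?n) (\<xi> (?q i 0) * \<xi> (?q j 0) * (\<xi> (?q i l) * \<xi> (?q j l)))
      (on_qubit ?n (?q s k) pauli_X) W" if "?q s k \<notin> ?M"
    unfolding \<xi>_def by (rule sign[of "\<lambda>p. if ?q s k < p then - 1 else 1"], rule qcommute_pauli_X_stringed[OF q])
      (use that in blast)
  have eq: "?q s k = ?q a b \<longleftrightarrow> s = a \<and> k = b" and less: "?q s k < ?q a b \<longleftrightarrow> s < a \<or> s = a \<and> k < b"
    if "a \<in> {i, j}" "b \<in> {0, l}" for a b
    using that s ij l qubit_eq_iff[of s a k \<nu> b] qubit_less_iff[of s a k \<nu> b] by auto
  have eqs: "?q s k = ?q i 0 \<longleftrightarrow> s = i \<and> k = 0" "?q s k = ?q j 0 \<longleftrightarrow> s = j \<and> k = 0"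
    "?q s k = ?q i l \<longleftrightarrow> s = i \<and> k = l" "?q s k = ?q j l \<longleftrightarrow> s = j \<and> k = l"
    using eq by auto
  have lesss: "?q s k < ?q i 0 \<longleftrightarrow> s < i" "?q s k < ?q j 0 \<longleftrightarrow> s < j"
    "?q s k < ?q i l \<longleftrightarrow> s < i \<or> s = i \<and> k < l" "?q s k < ?q j l \<longleftrightarrow> s < j \<or> s = j \<and> k < l"
    using less by auto
  consider "s \<in> {i, j}" "k \<in> {0, l}" | "s \<in> {i, j}" "0 < k" "k < l" | "\<not> (s \<in> {i, j} \<and> k \<le> l)"
    by fastforce
  thus ?thesis
  proof cases
    case 1
    have "\<zeta> (?q i 0) * \<zeta> (?q j 0) * (\<zeta> (?q i l) * \<zeta> (?q j l)) = - 1"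
      using 1 ij(3) l unfolding \<zeta>_def eqs by auto
    with Z have "qcommute (2 ^ ?n) (- 1) (on_qubit ?n (?q s k) pauli_Z) W" by simp
    hence "\<not> acts_trivially ?n W (?q s k)"
      by (intro not_acts_trivially[OF q W0 _ pauli_square(2)]) auto
    thus ?thesis using 1 by auto
  next
    case 2
    have "\<xi> (?q i 0) * \<xi> (?q j 0) * (\<xi> (?q i l) * \<xi> (?q j l)) = - 1"
      using 2 ij(3) unfolding \<xi>_def lesss by auto
    moreover have "?q s k \<notin> ?M" using 2 eqs by auto
    ultimately have "qcommute (2 ^ ?n) (- 1) (on_qubit ?n (?q s k) pauli_X) W" using X by simp
    hence "\<not> acts_trivially ?n W (?q s k)"
      by (intro not_acts_trivially[OF q W0 _ pauli_square(1)]) auto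
    thus ?thesis using 2 by auto
  next
    case 3
    have "?q s k \<notin> ?M" using 3 eqs by auto
    moreover have "\<zeta> (?q i 0) * \<zeta> (?q j 0) * (\<zeta> (?q i l) * \<zeta> (?q j l)) = 1"
      using 3 unfolding \<zeta>_def eqs by auto
    moreover have "\<xi> (?q i 0) * \<xi> (?q j 0) * (\<xi> (?q i l) * \<xi> (?q j l)) = 1"
      using 3 ij(3) unfolding \<xi>_def lesss by auto
    ultimately have "acts_trivially ?n W (?q s k)" using X Z by (intro acts_triviallyI[OF q]) auto
    thus ?thesis using 3 by simp
  qed
qed

lemma pauli_weight_jw_term:
  assumes ij: "i \<in> {1..N}" "j \<in> {1..N}" "i \<noteq> j" and l: "1 \<le> l" "l \<le> \<nu>"
  shows "pauli_weight (num_qubits N \<nu>) (hopping (jw N \<nu>) i j * edge_op (jw N \<nu>) l i j) = 2 * (l + 1)"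
proof -
  let ?W = "hopping (jw N \<nu>) i j * edge_op (jw N \<nu>) l i j"
  note triv = acts_trivially_jw_term[OF assms]
  have "{q. q < num_qubits N \<nu> \<and> \<not> acts_trivially (num_qubits N \<nu>) ?W q} =
      (\<lambda>(s, k). qubit \<nu> s k) ` ({i, j} \<times> {0..l})" (is "?L = ?R")
  proof
    show "?L \<subseteq> ?R"
    proof
      fix q assume q: "q \<in> ?L"
      then obtain s k where "s \<in> {1..N}" "k \<le> \<nu>" "q = qubit \<nu> s k" using ex_qubit by blast
      with q triv[of s k] show "q \<in> ?R" by auto
    qed
    show "?R \<subseteq> ?L"
      using triv ij l qubit_less_num_qubits by fastforce
  qed
  moreover have "inj_on (\<lambda>(s, k). qubit \<nu> s k) ({i, j} \<times> {0..l})"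
    using ij l by (auto simp: inj_on_def qubit_eq_iff)
  ultimately show ?thesis
    using ij(3) by (simp add: pauli_weight_def card_image card_cartesian_product)
qed

section \<open>Matrix exponentials and invariant subspaces\<close>

lemma mult_vec_index:
  assumes "A \<in> carrier_mat d d" "v \<in> carrier_vec d" "r < d"
  shows "(A *\<^sub>v v) $ r = (\<Sum>k<d. A $$ (r, k) * v $ k)"
  using assms by (auto simp: scalar_prod_def atLeast0LessThan intro!: sum.cong)

lemma mat_exp_carrier [simp]: "A \<in> carrier_mat d d \<Longrightarrow> mat_exp A \<in> carrier_mat d d"
  by (auto simp: mat_exp_def)

text \<open>The sum of all entry norms dominates every column sum, so each further factor costs at
  most this constant.\<close>

lemma norm_pow_mat_index_le:
  fixes A :: "complex mat"
  assumes A: "A \<in> carrier_mat d d" and "r < d" "c < d"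
  shows "norm ((A ^\<^sub>m m) $$ (r, c)) \<le> (\<Sum>i<d. \<Sum>j<d. norm (A $$ (i, j))) ^ m"
  using assms(2,3)
proof (induction m arbitrary: c)
  case 0
  thus ?case using A by simp
next
  case (Suc m)
  let ?B = "\<Sum>i<d. \<Sum>j<d. norm (A $$ (i, j))"
  have B: "0 \<le> ?B" by (intro sum_nonneg) auto
  have P: "A ^\<^sub>m m \<in> carrier_mat d d" using A by (rule pow_carrier_mat)
  have "norm ((A ^\<^sub>m Suc m) $$ (r, c)) = norm (\<Sum>k<d. (A ^\<^sub>m m) $$ (r, k) * A $$ (k, c))"
    using A P Suc.prems by (auto simp: scalar_prod_def atLeast0LessThan intro!: arg_cong[of _ _ norm] sum.cong)
  also have "\<dots> \<le> (\<Sum>k<d. ?B ^ m * norm (A $$ (k, c)))"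
    using Suc by (intro order_trans[OF norm_sum] sum_mono) (auto simp: norm_mult intro!: mult_right_mono)
  also have "\<dots> \<le> ?B ^ m * ?B"
    unfolding sum_distrib_left[symmetric] using B Suc.prems
    by (intro mult_left_mono sum_mono) (auto intro!: member_le_sum)
  finally show ?case by (simp add: mult.commute)
qed

text \<open>\<open>mat_exp\<close> is an entrywise \<open>suminf\<close>, which is informative only
  once convergence is known; the scalar exponential series of the entry bound dominates it.\<close>

lemma mat_exp_vec_sums:
  assumes A: "A \<in> carrier_mat d d" and v: "v \<in> carrier_vec d" and r: "r < d"
  shows "(\<lambda>m. ((A ^\<^sub>m m) *\<^sub>v v) $ r / fact m) sums ((mat_exp A *\<^sub>v v) $ r)"
proof -
  let ?B = "\<Sum>i<d. \<Sum>j<d. norm (A $$ (i, j))"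
  have P: "A ^\<^sub>m m \<in> carrier_mat d d" for m using A by (rule pow_carrier_mat)
  have "(\<lambda>m. (A ^\<^sub>m m) $$ (r, c) / fact m) sums (mat_exp A $$ (r, c))" if c: "c < d" for c
  proof -
    have "norm ((A ^\<^sub>m m) $$ (r, c) / fact m) \<le> inverse (fact m) * ?B ^ m" for m
      using norm_pow_mat_index_le[OF A r c, of m]
      by (simp add: norm_divide divide_inverse norm_mult norm_inverse mult.commute[of _ "inverse _"] mult_left_mono)
    hence "summable (\<lambda>m. (A ^\<^sub>m m) $$ (r, c) / fact m)"
      by (rule summable_comparison_test'[OF summable_exp])
    thus ?thesis using A r c by (simp add: mat_exp_def summable_sums)
  qed
  hence "(\<lambda>m. \<Sum>c<d. ((A ^\<^sub>m m) $$ (r, c) / fact m) * v $ c) sums (\<Sum>c<d. mat_exp A $$ (r, c) * v $ c)"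
    by (intro sums_sum sums_mult2) auto
  moreover have "(\<Sum>c<d. ((A ^\<^sub>m m) $$ (r, c) / fact m) * v $ c) = ((A ^\<^sub>m m) *\<^sub>v v) $ r / fact m" for m
    unfolding mult_vec_index[OF P v r] by (simp add: sum_divide_distrib)
  moreover have "(\<Sum>c<d. mat_exp A $$ (r, c) * v $ c) = (mat_exp A *\<^sub>v v) $ r"
    by (rule mult_vec_index[OF mat_exp_carrier[OF A] v r, symmetric])
  ultimately show ?thesis by simp
qed

text \<open>The relation between \<open>A\<close>, \<open>B\<close> and \<open>C\<close> is known
  only on \<open>S\<close>, so powers are compared on vectors without leaving \<open>S\<close>; the
  two series then agree term by term.\<close>

lemma mat_exp_intertwine:
  assumes A: "A \<in> carrier_mat d d" and B: "B \<in> carrier_mat d d" and C: "C \<in> carrier_mat d d"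
    and S: "S \<subseteq> carrier_vec d" "\<And>w. w \<in> S \<Longrightarrow> B *\<^sub>v w \<in> S"
      "\<And>w. w \<in> S \<Longrightarrow> A *\<^sub>v (C *\<^sub>v w) = C *\<^sub>v (B *\<^sub>v w)"
    and v: "v \<in> S"
  shows "mat_exp A *\<^sub>v (C *\<^sub>v v) = C *\<^sub>v (mat_exp B *\<^sub>v v)"
proof -
  have pow: "(A ^\<^sub>m m) *\<^sub>v (C *\<^sub>v w) = C *\<^sub>v ((B ^\<^sub>m m) *\<^sub>v w)" if "w \<in> S" for m w
    using that
  \<comment> \<open>Powers grow on the right, so the step replaces \<open>w\<close> by
    \<open>B *\<^sub>v w\<close>, which is again in \<open>S\<close>.\<close>
  proof (induction m arbitrary: w)
    case 0
    hence "w \<in> carrier_vec d" using S(1) by auto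
    thus ?case using A B C by simp
  next
    case (Suc m)
    have w: "w \<in> carrier_vec d" using Suc.prems S(1) by auto
    note cs = A B C w pow_carrier_mat[OF A, of m] pow_carrier_mat[OF B, of m]
    have "(A ^\<^sub>m Suc m) *\<^sub>v (C *\<^sub>v w) = (A ^\<^sub>m m) *\<^sub>v (A *\<^sub>v (C *\<^sub>v w))"
      using cs by (simp add: assoc_mult_mat_vec[of _ d d _ d])
    also have "\<dots> = C *\<^sub>v ((B ^\<^sub>m m) *\<^sub>v (B *\<^sub>v w))" using Suc S(2,3) by simp
    also have "\<dots> = C *\<^sub>v ((B ^\<^sub>m Suc m) *\<^sub>v w)"
      using cs by (simp add: assoc_mult_mat_vec[of _ d d _ d])
    finally show ?case .
  qed
  have vc: "v \<in> carrier_vec d" using S(1) v by auto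
  have Cv: "C *\<^sub>v v \<in> carrier_vec d" using C vc by simp
  have Eb: "mat_exp B *\<^sub>v v \<in> carrier_vec d" using mat_exp_carrier[OF B] vc by simp
  show ?thesis
  proof (rule eq_vecI)
    fix r assume "r < dim_vec (C *\<^sub>v (mat_exp B *\<^sub>v v))"
    hence r: "r < d" using C by simp
    have "(\<lambda>m. \<Sum>k<d. C $$ (r, k) * (((B ^\<^sub>m m) *\<^sub>v v) $ k / fact m)) sums
        (\<Sum>k<d. C $$ (r, k) * (mat_exp B *\<^sub>v v) $ k)"
      using mat_exp_vec_sums[OF B vc] by (intro sums_sum sums_mult) auto
    also have "(\<Sum>k<d. C $$ (r, k) * (mat_exp B *\<^sub>v v) $ k) = (C *\<^sub>v (mat_exp B *\<^sub>v v)) $ r"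
      by (rule mult_vec_index[OF C Eb r, symmetric])
    also have "(\<lambda>m. \<Sum>k<d. C $$ (r, k) * (((B ^\<^sub>m m) *\<^sub>v v) $ k / fact m)) =
        (\<lambda>m. ((A ^\<^sub>m m) *\<^sub>v (C *\<^sub>v v)) $ r / fact m)"
    proof
      fix m
      have "(B ^\<^sub>m m) *\<^sub>v v \<in> carrier_vec d" using pow_carrier_mat[OF B, of m] vc by simp
      from mult_vec_index[OF C this r] show "(\<Sum>k<d. C $$ (r, k) * (((B ^\<^sub>m m) *\<^sub>v v) $ k / fact m)) =
          ((A ^\<^sub>m m) *\<^sub>v (C *\<^sub>v v)) $ r / fact m"
        unfolding pow[OF v] by (simp add: sum_divide_distrib)
    qed
    finally show "(mat_exp A *\<^sub>v (C *\<^sub>v v)) $ r = (C *\<^sub>v (mat_exp B *\<^sub>v v)) $ r"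
      using sums_unique2[OF mat_exp_vec_sums[OF A Cv r]] by blast
  qed (use mat_exp_carrier[OF A] C in auto)
qed

section \<open>Subspaces invariant under an exponential\<close>

definition vec_subspace :: "nat \<Rightarrow> complex vec set \<Rightarrow> bool" where
  "vec_subspace d S \<longleftrightarrow> S \<subseteq> carrier_vec d \<and> 0\<^sub>v d \<in> S \<and>
     (\<forall>v\<in>S. \<forall>w\<in>S. v + w \<in> S) \<and> (\<forall>v\<in>S. \<forall>c. c \<cdot>\<^sub>v v \<in> S)"

lemma vec_subspaceD:
  assumes "vec_subspace d S"
  shows "v \<in> S \<Longrightarrow> v \<in> carrier_vec d" "0\<^sub>v d \<in> S" "v \<in> S \<Longrightarrow> w \<in> S \<Longrightarrow> v + w \<in> S"
    "v \<in> S \<Longrightarrow> c \<cdot>\<^sub>v v \<in> S"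
  using assms by (auto simp: vec_subspace_def)

lemma vec_subspace_minus:
  assumes S: "vec_subspace d S" and v: "v \<in> S" "w \<in> S"
  shows "v - w \<in> S"
proof -
  have "v - w = v + (- 1) \<cdot>\<^sub>v w"
    using vec_subspaceD(1)[OF S v(1)] vec_subspaceD(1)[OF S v(2)] by (intro eq_vecI) auto
  thus ?thesis using vec_subspaceD[OF S] v by simp
qed

text \<open>The projection is built coordinate by coordinate: at stage \<open>k\<close> it fixes the vectors of the
  subspace that are supported on the first \<open>k\<close> coordinates.\<close>

lemma subspace_projection:
  assumes S: "vec_subspace d S"
  obtains K where "K \<in> carrier_mat d d" "\<And>v. v \<in> carrier_vec d \<Longrightarrow> K *\<^sub>v v \<in> S"
    "\<And>v. v \<in> S \<Longrightarrow> K *\<^sub>v v = v"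
proof -
  note SD = vec_subspaceD[OF S]
  have "\<exists>K \<in> carrier_mat d d. (\<forall>v \<in> carrier_vec d. K *\<^sub>v v \<in> S) \<and>
      (\<forall>v \<in> S. (\<forall>i<d. k \<le> i \<longrightarrow> v $ i = 0) \<longrightarrow> K *\<^sub>v v = v)" if "k \<le> d" for k
    using that
  proof (induction k)
    case 0
    have z: "0\<^sub>m d d *\<^sub>v v = 0\<^sub>v d" if "v \<in> carrier_vec d" for v :: "complex vec"
      using that by (intro eq_vecI) (auto simp: scalar_prod_def)
    show ?case
    proof (rule bexI[of _ "0\<^sub>m d d"], intro conjI ballI impI)
      fix v assume v: "v \<in> S" "\<forall>i<d. 0 \<le> i \<longrightarrow> v $ i = 0"
      have "v = 0\<^sub>v d" using v SD(1)[OF v(1)] by (intro eq_vecI) auto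
      thus "0\<^sub>m d d *\<^sub>v v = v" using z by simp
    qed (use z SD in auto)
  next
    case (Suc k)
    then obtain K where K: "K \<in> carrier_mat d d" "\<And>v. v \<in> carrier_vec d \<Longrightarrow> K *\<^sub>v v \<in> S"
      "\<And>v. v \<in> S \<Longrightarrow> (\<And>i. i < d \<Longrightarrow> k \<le> i \<Longrightarrow> v $ i = 0) \<Longrightarrow> K *\<^sub>v v = v" by (metis Suc_leD)
    show ?case
    proof (cases "\<exists>u\<in>S. (\<forall>i<d. Suc k \<le> i \<longrightarrow> u $ i = 0) \<and> u $ k \<noteq> 0")
      \<comment> \<open>No new vector has a nonzero coordinate \<open>k\<close>, so \<open>K\<close>
        already fixes all of them.\<close>
      case False
      have "K *\<^sub>v v = v" if v: "v \<in> S" "\<forall>i<d. Suc k \<le> i \<longrightarrow> v $ i = 0" for v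
        using False v by (intro K(3)) (auto simp: le_eq_less_or_eq Suc_le_eq)
      thus ?thesis using K(1,2) by blast
    next
      case True
      then obtain u where u: "u \<in> S" "\<And>i. i < d \<Longrightarrow> Suc k \<le> i \<Longrightarrow> u $ i = 0" "u $ k \<noteq> 0" by blast
      define w where "w = (1 / u $ k) \<cdot>\<^sub>v u"
      have w: "w \<in> S" "w \<in> carrier_vec d" using SD u w_def by auto
      have wi: "w $ k = 1" "\<And>i. i < d \<Longrightarrow> Suc k \<le> i \<Longrightarrow> w $ i = 0"
        using u SD(1)[OF u(1)] Suc.prems by (auto simp: w_def)
      \<comment> \<open>Maps \<open>v\<close> to the multiple of \<open>w\<close> with the same
        coordinate \<open>k\<close>. Subtracting it clears this coordinate, after which
        \<open>K\<close> applies; \<open>X + (K - K * X)\<close> then adds the removed part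
        back.\<close>
      define X where "X = mat d d (\<lambda>(r, c). if c = k then w $ r else 0)"
      have X: "X \<in> carrier_mat d d" by (simp add: X_def)
      have Xv: "X *\<^sub>v v = v $ k \<cdot>\<^sub>v w" if "v \<in> carrier_vec d" for v
      proof (rule eq_vecI)
        fix r assume "r < dim_vec (v $ k \<cdot>\<^sub>v w)"
        hence r: "r < d" using w by simp
        have "(X *\<^sub>v v) $ r = (\<Sum>c<d. if c = k then w $ r * v $ c else 0)"
          unfolding mult_vec_index[OF X that r] by (rule sum.cong) (use r in \<open>auto simp: X_def\<close>)
        thus "(X *\<^sub>v v) $ r = (v $ k \<cdot>\<^sub>v w) $ r" using r w Suc.prems by simp
      qed (use w X in auto)
      have K'v: "(X + (K - K * X)) *\<^sub>v v = X *\<^sub>v v + K *\<^sub>v (v - X *\<^sub>v v)" if v: "v \<in> carrier_vec d" for v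
      proof -
        have c: "X *\<^sub>v v \<in> carrier_vec d" using X v by simp
        have "(X + (K - K * X)) *\<^sub>v v = X *\<^sub>v v + (K *\<^sub>v v - K *\<^sub>v (X *\<^sub>v v))"
          using X K(1) v by (simp add: add_mult_distrib_mat_vec[of _ d d] minus_mult_distrib_mat_vec[of _ d d]
              minus_carrier_mat mult_carrier_mat[of _ d d])
        thus ?thesis using mult_minus_distrib_mat_vec[OF K(1) v c] by simp
      qed
      show ?thesis
      proof (rule bexI[of _ "X + (K - K * X)"], intro conjI ballI impI)
        show "X + (K - K * X) \<in> carrier_mat d d"
          using X K(1) by (auto intro!: carrier_matI)
        show "(X + (K - K * X)) *\<^sub>v v \<in> S" if v: "v \<in> carrier_vec d" for v
        proof -
          have "X *\<^sub>v v \<in> carrier_vec d" "X *\<^sub>v v \<in> S" using X v w(2) SD(4)[OF w(1)] Xv by auto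
          thus ?thesis unfolding K'v[OF v] using v by (intro SD(3) K(2)) auto
        qed
        show "(X + (K - K * X)) *\<^sub>v v = v" if v: "v \<in> S" "\<forall>i<d. Suc k \<le> i \<longrightarrow> v $ i = 0" for v
        proof -
          have vc: "v \<in> carrier_vec d" using v SD by auto
          have Xvc: "X *\<^sub>v v \<in> carrier_vec d" using X vc by simp
          have "K *\<^sub>v (v - X *\<^sub>v v) = v - X *\<^sub>v v"
          proof (rule K(3))
            show "v - X *\<^sub>v v \<in> S" using v w(1) SD Xv[OF vc] by (auto intro: vec_subspace_minus[OF S])
            show "(v - X *\<^sub>v v) $ i = 0" if i: "i < d" "k \<le> i" for i
              using v(2) wi i w(2) vc by (cases "i = k") (auto simp: Xv[OF vc])
          qed
          moreover have "a + (v - a) = v" if "a \<in> carrier_vec d" for a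
            using that vc by (intro eq_vecI) auto
          ultimately show ?thesis unfolding K'v[OF vc] using Xvc by simp
        qed
      qed
    qed
  qed
  from this[of d] obtain K where "K \<in> carrier_mat d d" "\<And>v. v \<in> carrier_vec d \<Longrightarrow> K *\<^sub>v v \<in> S"
    "\<And>v. v \<in> S \<Longrightarrow> K *\<^sub>v v = v" by auto
  thus ?thesis by (rule that)
qed

text \<open>Replaces the closedness of subspaces: for a projection \<open>K\<close> onto
  \<open>S\<close>, the exponential applied to \<open>v = K v\<close> equals \<open>K\<close>
  applied to the exponential of \<open>v\<close>, and the values of \<open>K\<close> lie in
  \<open>S\<close>.\<close>

lemma mat_exp_invariant_subspace:
  assumes S: "vec_subspace d S" and B: "B \<in> carrier_mat d d"
    and inv: "\<And>w. w \<in> S \<Longrightarrow> B *\<^sub>v w \<in> S" and v: "v \<in> S"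
  shows "mat_exp B *\<^sub>v v \<in> S"
proof -
  obtain K where K: "K \<in> carrier_mat d d" "\<And>v. v \<in> carrier_vec d \<Longrightarrow> K *\<^sub>v v \<in> S"
    "\<And>v. v \<in> S \<Longrightarrow> K *\<^sub>v v = v"
    using subspace_projection[OF S] by blast
  have "mat_exp B *\<^sub>v (K *\<^sub>v v) = K *\<^sub>v (mat_exp B *\<^sub>v v)"
    by (rule mat_exp_intertwine[OF B B K(1) _ inv]) (use S K(3) inv v in \<open>auto simp: vec_subspace_def\<close>)
  moreover have "mat_exp B *\<^sub>v v \<in> carrier_vec d"
    using mat_exp_carrier[OF B] vec_subspaceD(1)[OF S v] by simp
  ultimately show ?thesis using K v by metis
qed

section \<open>Sums of operators over edges\<close>

lemma mat_sum_carrier [simp]: "mat_sum d F S \<in> carrier_mat d d"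
  by (simp add: mat_sum_def)

text \<open>The leading factor \<open>A\<close> is later the identity for the transformed
  Hamiltonian and the auxiliary polynomial for the original one.\<close>

lemma mult_mat_sum_vec_index:
  assumes F: "\<And>e. e \<in> S \<Longrightarrow> F e \<in> carrier_mat d d" and A: "A \<in> carrier_mat d d"
    and v: "v \<in> carrier_vec d" and r: "r < d"
  shows "(A *\<^sub>v (mat_sum d F S *\<^sub>v v)) $ r = (\<Sum>e\<in>S. (A *\<^sub>v (F e *\<^sub>v v)) $ r)"
proof -
  have Fv: "(mat_sum d F S *\<^sub>v v) $ k = (\<Sum>e\<in>S. (F e *\<^sub>v v) $ k)" if k: "k < d" for k
  proof -
    have "(mat_sum d F S *\<^sub>v v) $ k = (\<Sum>c<d. \<Sum>e\<in>S. F e $$ (k, c) * v $ c)"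
      unfolding mult_vec_index[OF mat_sum_carrier v k]
      using k by (auto simp: mat_sum_def sum_distrib_right intro!: sum.cong)
    also have "\<dots> = (\<Sum>e\<in>S. \<Sum>c<d. F e $$ (k, c) * v $ c)" by (rule sum.swap)
    also have "\<dots> = (\<Sum>e\<in>S. (F e *\<^sub>v v) $ k)"
    proof (rule sum.cong)
      fix e assume "e \<in> S"
      thus "(\<Sum>c<d. F e $$ (k, c) * v $ c) = (F e *\<^sub>v v) $ k"
        using mult_vec_index[OF F v k] by simp
    qed simp
    finally show ?thesis .
  qed
  have "mat_sum d F S *\<^sub>v v \<in> carrier_vec d" using v by (simp add: mult_mat_vec_carrier[of _ d d])
  hence "(A *\<^sub>v (mat_sum d F S *\<^sub>v v)) $ r = (\<Sum>k<d. A $$ (r, k) * (mat_sum d F S *\<^sub>v v) $ k)"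
    by (rule mult_vec_index[OF A _ r])
  also have "\<dots> = (\<Sum>k<d. \<Sum>e\<in>S. A $$ (r, k) * (F e *\<^sub>v v) $ k)"
    using Fv by (auto simp: sum_distrib_left intro!: sum.cong)
  also have "\<dots> = (\<Sum>e\<in>S. \<Sum>k<d. A $$ (r, k) * (F e *\<^sub>v v) $ k)" by (rule sum.swap)
  also have "\<dots> = (\<Sum>e\<in>S. (A *\<^sub>v (F e *\<^sub>v v)) $ r)"
  proof (rule sum.cong)
    fix e assume "e \<in> S"
    hence "F e *\<^sub>v v \<in> carrier_vec d" using F[of e] v by simp
    from mult_vec_index[OF A this r] show "(\<Sum>k<d. A $$ (r, k) * (F e *\<^sub>v v) $ k) = (A *\<^sub>v (F e *\<^sub>v v)) $ r" by simp
  qed simp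
  finally show ?thesis .
qed

lemma mat_sum_vec_subspace:
  assumes T: "vec_subspace d T" and "finite S" and F: "\<And>e. e \<in> S \<Longrightarrow> F e \<in> carrier_mat d d"
    and v: "v \<in> carrier_vec d" and "\<And>e. e \<in> S \<Longrightarrow> F e *\<^sub>v v \<in> T"
  shows "mat_sum d F S *\<^sub>v v \<in> T"
  using assms(2,3,5)
proof (induction S rule: finite_induct)
  case empty
  have "mat_sum d F {} *\<^sub>v v = 0\<^sub>v d"
    using v by (intro eq_vecI) (auto simp: mat_sum_def scalar_prod_def)
  thus ?case using vec_subspaceD(2)[OF T] by simp
next
  case (insert x S)
  have "mat_sum d F (insert x S) = F x + mat_sum d F S"
    using insert.hyps insert.prems(1)[of x] by (intro eq_matI) (auto simp: mat_sum_def)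
  moreover have "F x \<in> carrier_mat d d" using insert.prems(1) by simp
  ultimately have "mat_sum d F (insert x S) *\<^sub>v v = F x *\<^sub>v v + mat_sum d F S *\<^sub>v v"
    using v by (simp add: add_mult_distrib_mat_vec[of _ d d])
  thus ?case using vec_subspaceD(3)[OF T] insert by simp
qed

text \<open>The two Hamiltonians are summed over different index sets. The increasing pairs are an
  orientation too, and the sum over any orientation equals the sum of
  \<open>g (Min e, Max e)\<close> over the edges.\<close>

lemma sum_orientation:
  assumes D: "orientation E D" and E: "\<And>e. e \<in> E \<Longrightarrow> card e = 2"
    and sym: "\<And>i j. {i, j} \<in> E \<Longrightarrow> g (i, j) = g (j, i)"
  shows "sum g D = sum g {(i, j). i < j \<and> {i, j} \<in> E}"
proof -
  have oriented: "sum g D' = (\<Sum>e\<in>E. g (Min e, Max e))" if D': "orientation E D'" for D'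
  proof -
    have "sum g D' = (\<Sum>p\<in>D'. (\<lambda>e. g (Min e, Max e)) (case p of (i, j) \<Rightarrow> {i, j}))"
    proof (rule sum.cong[OF refl])
      fix p assume "p \<in> D'"
      then obtain i j where ij: "p = (i, j)" "{i, j} \<in> E" using orientationD(1)[OF D'] by (cases p) auto
      thus "g p = (\<lambda>e. g (Min e, Max e)) (case p of (i, j) \<Rightarrow> {i, j})"
        using sym[OF ij(2)] by (simp add: min_def max_def)
    qed
    thus ?thesis
      using sum.reindex_bij_betw[of "\<lambda>(i, j). {i, j}" D' E "\<lambda>e. g (Min e, Max e)"] D'
      by (simp add: orientation_def)
  qed
  have "\<exists>p\<in>{(i, j). i < j \<and> {i, j} \<in> E}. e = (\<lambda>(i, j). {i, j}) p" if e: "e \<in> E" for e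
  proof -
    obtain x y where xy: "e = {x, y}" "x \<noteq> y" using E[OF e] by (auto simp: card_2_iff)
    have "(min x y, max x y) \<in> {(i, j). i < j \<and> {i, j} \<in> E}" "e = (\<lambda>(i, j). {i, j}) (min x y, max x y)"
      using e xy by (auto simp: min_def max_def insert_commute)
    thus ?thesis by blast
  qed
  hence "(\<lambda>(i, j). {i, j}) ` {(i, j). i < j \<and> {i, j} \<in> E} = E" by (auto simp: image_iff)
  hence "orientation E {(i, j). i < j \<and> {i, j} \<in> E}"
    by (auto simp: orientation_def bij_betw_def inj_on_def doubleton_eq_iff)
  thus ?thesis using oriented[OF D] oriented by simp
qed

section \<open>Fock states\<close>

locale fock_space = car_modes +
  fixes vac :: "complex vec"
  assumes vac_carrier [simp]: "vac \<in> carrier_vec d"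
    and vac_nonzero: "vac \<noteq> 0\<^sub>v d"
    and annihilates_vac: "(i, k) \<in> modes \<Longrightarrow> f i k *\<^sub>v vac = 0\<^sub>v d"

lemma fock_space_fermion_modes:
  assumes "fermion_modes N \<nu> d f vac"
  shows "fock_space N \<nu> d f vac"
proof -
  interpret fermion_modes N \<nu> d f vac by (rule assms)
  interpret car_modes N \<nu> d f
    by unfold_locales (fact mode_carrier anticommute anticommute_adjoint)+
  show ?thesis
    by unfold_locales (auto simp: vac_carrier vac_nonzero annihilates_vac modes_def)
qed

context fock_space
begin

lemma vec_assoc:
  "A \<in> carrier_mat d d \<Longrightarrow> B \<in> carrier_mat d d \<Longrightarrow> v \<in> carrier_vec d \<Longrightarrow>
    (A * B) *\<^sub>v v = A *\<^sub>v (B *\<^sub>v v)"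
  by (rule assoc_mult_mat_vec)

lemma qcommute_vec:
  assumes "qcommute d s A B" "v \<in> carrier_vec d"
  shows "A *\<^sub>v (B *\<^sub>v v) = s \<cdot>\<^sub>v (B *\<^sub>v (A *\<^sub>v v))"
proof -
  note cs = qcommuteD[OF assms(1)]
  have "A *\<^sub>v (B *\<^sub>v v) = (s \<cdot>\<^sub>m (B * A)) *\<^sub>v v"
    using cs(3) vec_assoc[OF cs(1,2) assms(2)] by simp
  also have "\<dots> = s \<cdot>\<^sub>v ((B * A) *\<^sub>v v)" by (rule smult_mat_vec[of _ d d]) (use cs assms in auto)
  also have "(B * A) *\<^sub>v v = B *\<^sub>v (A *\<^sub>v v)" by (rule vec_assoc[OF cs(2,1) assms(2)])
  finally show ?thesis .
qed

section \<open>Creation polynomials and the states they generate\<close>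

lemma poly_carrier:
  assumes "A \<in> creation_polynomials d f M" "M \<subseteq> modes"
  shows "A \<in> carrier_mat d d"
  using assms by (induction rule: creation_polynomials.induct) (auto intro: carrier)

lemma zero_poly: "0\<^sub>m d d \<in> creation_polynomials d f M"
proof -
  have "(0 :: complex) \<cdot>\<^sub>m 1\<^sub>m d = 0\<^sub>m d d" by (intro eq_matI) auto
  moreover have "(0 :: complex) \<cdot>\<^sub>m 1\<^sub>m d \<in> creation_polynomials d f M"
    by (intro creation_polynomials.smult creation_polynomials.one)
  ultimately show ?thesis by simp
qed

text \<open>Normal ordering: the contractions leave a remainder in creation operators of the same
  modes, and \<open>A'\<close> arises from \<open>A\<close> by negating every creation
  operator.\<close>

lemma mode_mult_poly:
  assumes A: "A \<in> creation_polynomials d f M" and M: "M \<subseteq> modes" and ik: "(i, k) \<in> modes"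
  shows "\<exists>A' \<in> creation_polynomials d f M. \<exists>A'' \<in> creation_polynomials d f M.
    f i k * A = A' * f i k + A''"
  using A
proof (induction rule: creation_polynomials.induct)
  case one
  have "f i k * 1\<^sub>m d = 1\<^sub>m d * f i k + 0\<^sub>m d d" using carrier[OF ik] by simp
  thus ?case using creation_polynomials.one zero_poly by blast
next
  case (creation j l)
  hence jl: "(j, l) \<in> modes" using M by auto
  let ?b' = "mat_adjoint (f j l)"
  define \<delta> :: "complex mat" where "\<delta> = (if i = j \<and> k = l then 1\<^sub>m d else 0\<^sub>m d d)"
  have eq: "f i k * ?b' + ?b' * f i k = \<delta>"
    using anticommute_adjoint[of i k j l] modesD ik jl by (simp add: \<delta>_def)
  have "f i k * ?b' = (- 1 \<cdot>\<^sub>m ?b') * f i k + \<delta>"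
    unfolding eq[symmetric] using ik jl
    by (intro eq_matI) (auto simp: mat_dim_simps simp del: index_mult_mat(1))
  moreover have "\<delta> \<in> creation_polynomials d f M"
    using creation_polynomials.one zero_poly by (simp add: \<delta>_def)
  ultimately show ?case using creation_polynomials.smult creation_polynomials.creation[OF creation] by blast
next
  case (smult A c)
  then obtain A' A'' where *: "A' \<in> creation_polynomials d f M" "A'' \<in> creation_polynomials d f M"
    "f i k * A = A' * f i k + A''" by blast
  have cs: "A \<in> carrier_mat d d" "A' \<in> carrier_mat d d" "A'' \<in> carrier_mat d d"
    using smult * poly_carrier M by auto
  have "f i k * (c \<cdot>\<^sub>m A) = c \<cdot>\<^sub>m (f i k * A)" using ik cs by (simp add: mat_dim_simps)
  also have "\<dots> = (c \<cdot>\<^sub>m A') * f i k + c \<cdot>\<^sub>m A''"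
    unfolding *(3) using ik cs by (simp add: mat_dim_simps smult_distrib_mat)
  finally show ?case using * creation_polynomials.smult by blast
next
  case (add A B)
  then obtain A' A'' B' B'' where *: "A' \<in> creation_polynomials d f M" "A'' \<in> creation_polynomials d f M"
    "f i k * A = A' * f i k + A''" "B' \<in> creation_polynomials d f M" "B'' \<in> creation_polynomials d f M"
    "f i k * B = B' * f i k + B''" by blast
  have cs: "A \<in> carrier_mat d d" "A' \<in> carrier_mat d d" "A'' \<in> carrier_mat d d"
    "B \<in> carrier_mat d d" "B' \<in> carrier_mat d d" "B'' \<in> carrier_mat d d"
    using add * poly_carrier M by auto
  have "f i k * (A + B) = f i k * A + f i k * B" using ik cs by (simp add: mat_distrib_simps)
  also have "\<dots> = (A' + B') * f i k + (A'' + B'')"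
    unfolding *(3,6) using ik cs
    by (intro eq_matI) (auto simp: mat_distrib_simps simp del: index_mult_mat(1))
  finally show ?case using * creation_polynomials.add by blast
next
  case (mult A B)
  then obtain A' A'' B' B'' where *: "A' \<in> creation_polynomials d f M" "A'' \<in> creation_polynomials d f M"
    "f i k * A = A' * f i k + A''" "B' \<in> creation_polynomials d f M" "B'' \<in> creation_polynomials d f M"
    "f i k * B = B' * f i k + B''" by blast
  have cs: "A \<in> carrier_mat d d" "A' \<in> carrier_mat d d" "A'' \<in> carrier_mat d d"
    "B \<in> carrier_mat d d" "B' \<in> carrier_mat d d" "B'' \<in> carrier_mat d d"
    using mult * poly_carrier M by auto
  have "f i k * (A * B) = (f i k * A) * B" using ik cs by (simp add: mat_dim_simps)
  also have "\<dots> = A' * (f i k * B) + A'' * B"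
    unfolding *(3) using ik cs by (simp add: mat_dim_simps mat_distrib_simps)
  also have "\<dots> = (A' * B') * f i k + (A' * B'' + A'' * B)"
    unfolding *(6) using ik cs
    by (intro eq_matI) (auto simp: mat_dim_simps mat_distrib_simps simp del: index_mult_mat(1))
  finally show ?case using * mult.hyps creation_polynomials.add creation_polynomials.mult by blast
qed

text \<open>Contains the zero vector, unlike \<open>aux_states\<close> and
  \<open>phys_states\<close>, so that it is a subspace.\<close>

definition states :: "(nat \<times> nat) set \<Rightarrow> complex vec set" where
  "states M = (\<lambda>A. A *\<^sub>v vac) ` creation_polynomials d f M"

lemma vac_in_states: "vac \<in> states M"
  unfolding states_def by (rule image_eqI[OF _ creation_polynomials.one]) simp

lemma states_subspace:
  assumes M: "M \<subseteq> modes"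
  shows "vec_subspace d (states M)"
proof -
  have "A *\<^sub>v vac \<in> carrier_vec d" if "A \<in> creation_polynomials d f M" for A
    using poly_carrier[OF that M] by simp
  moreover have "0\<^sub>v d \<in> states M"
    unfolding states_def by (rule image_eqI[OF _ zero_poly])
      (auto intro!: eq_vecI simp: scalar_prod_def carrier_vecD[OF vac_carrier])
  moreover have "A *\<^sub>v vac + B *\<^sub>v vac \<in> states M"
    if "A \<in> creation_polynomials d f M" "B \<in> creation_polynomials d f M" for A B
    unfolding states_def using that poly_carrier[OF _ M]
    by (intro image_eqI[OF _ creation_polynomials.add[OF that]])
      (simp add: add_mult_distrib_mat_vec[of _ d d])
  moreover have "c \<cdot>\<^sub>v (A *\<^sub>v vac) \<in> states M" if "A \<in> creation_polynomials d f M" for A c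
    unfolding states_def using that poly_carrier[OF _ M]
    by (intro image_eqI[OF _ creation_polynomials.smult[OF that]]) (simp add: smult_mat_vec[of _ d d])
  ultimately show ?thesis unfolding vec_subspace_def by (auto simp: states_def)
qed

text \<open>On the vacuum only the remainder of the normal ordering survives.\<close>

lemma states_mode:
  assumes M: "M \<subseteq> modes" and ik: "(i, k) \<in> modes" and v: "v \<in> states M"
  shows "f i k *\<^sub>v v \<in> states M"
proof -
  obtain A where A: "A \<in> creation_polynomials d f M" "v = A *\<^sub>v vac" using v by (auto simp: states_def)
  obtain A' A'' where *: "A' \<in> creation_polynomials d f M" "A'' \<in> creation_polynomials d f M"
    "f i k * A = A' * f i k + A''" using mode_mult_poly[OF A(1) M ik] by blast
  note cs = carrier[OF ik] poly_carrier[OF A(1) M] poly_carrier[OF *(1) M] poly_carrier[OF *(2) M]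
  have "f i k *\<^sub>v v = (A' * f i k + A'') *\<^sub>v vac"
    unfolding A(2) *(3)[symmetric] using cs by (simp add: vec_assoc)
  also have "\<dots> = A' *\<^sub>v (f i k *\<^sub>v vac) + A'' *\<^sub>v vac"
    using cs by (simp add: vec_assoc add_mult_distrib_mat_vec[of _ d d] mult_carrier_mat[of _ d d])
  also have "\<dots> = A'' *\<^sub>v vac"
    unfolding annihilates_vac[OF ik] using cs by (simp add: mat_vec_zero[of _ d])
  finally show ?thesis using *(2) by (auto simp: states_def)
qed

lemma states_mode_adjoint:
  assumes M: "M \<subseteq> modes" and ik: "(i, k) \<in> M" and v: "v \<in> states M"
  shows "mat_adjoint (f i k) *\<^sub>v v \<in> states M"
proof -
  obtain A where A: "A \<in> creation_polynomials d f M" "v = A *\<^sub>v vac" using v by (auto simp: states_def)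
  have "f i k \<in> carrier_mat d d" using ik M carrier by auto
  hence "mat_adjoint (f i k) *\<^sub>v v = (mat_adjoint (f i k) * A) *\<^sub>v vac"
    unfolding A(2) using poly_carrier[OF A(1) M] by (simp add: vec_assoc)
  thus ?thesis using creation_polynomials.mult[OF creation_polynomials.creation[OF ik] A(1)]
    by (auto simp: states_def)
qed

lemma states_majorana:
  assumes M: "M \<subseteq> modes" and ik: "(i, k) \<in> M" and v: "v \<in> states M"
  shows "majorana_c f i k *\<^sub>v v \<in> states M" "majorana_d f i k *\<^sub>v v \<in> states M"
proof -
  note S = states_subspace[OF M]
  have ik': "(i, k) \<in> modes" using ik M by auto
  note cs = carrier[OF ik'] mat_adjoint_carrier[OF carrier[OF ik']] vec_subspaceD(1)[OF S v]
  note st = states_mode[OF M ik' v] states_mode_adjoint[OF M ik v]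
  show "majorana_c f i k *\<^sub>v v \<in> states M"
    unfolding majorana_c_def using cs st vec_subspaceD(3)[OF S]
    by (simp add: add_mult_distrib_mat_vec[of _ d d])
  have "majorana_d f i k *\<^sub>v v = (- \<i>) \<cdot>\<^sub>v (f i k *\<^sub>v v - mat_adjoint (f i k) *\<^sub>v v)"
    unfolding majorana_d_def using cs
    by (simp add: smult_mat_vec[of _ d d] minus_mult_distrib_mat_vec[of _ d d] minus_carrier_mat)
  thus "majorana_d f i k *\<^sub>v v \<in> states M"
    using vec_subspaceD(4)[OF S vec_subspace_minus[OF S st]] by simp
qed

lemma states_edge_op:
  assumes M: "M \<subseteq> modes" and m: "(i, l) \<in> M" "(j, l) \<in> M" and v: "v \<in> states M"
  shows "edge_op f l i j *\<^sub>v v \<in> states M"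
proof -
  note S = states_subspace[OF M]
  have m': "(i, l) \<in> modes" "(j, l) \<in> modes" using m M by auto
  note cs = majorana_c_carrier[OF m'(1)] majorana_d_carrier[OF m'(2)] vec_subspaceD(1)[OF S v]
  have "edge_op f l i j *\<^sub>v v = \<i> \<cdot>\<^sub>v (majorana_c f i l *\<^sub>v (majorana_d f j l *\<^sub>v v))"
    unfolding edge_op_def using cs
    by (simp add: smult_mat_vec[of _ d d] vec_assoc mult_carrier_mat[of _ d d])
  thus ?thesis
    using vec_subspaceD(4)[OF S] states_majorana[OF M] m v by simp
qed

lemma states_hopping:
  assumes M: "M \<subseteq> modes" and m: "(i, 0) \<in> M" "(j, 0) \<in> M" and v: "v \<in> states M"
  shows "hopping f i j *\<^sub>v v \<in> states M"
proof -
  note S = states_subspace[OF M]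
  have m': "(i, 0) \<in> modes" "(j, 0) \<in> modes" using m M by auto
  note cs = carrier[OF m'(1)] carrier[OF m'(2)] vec_subspaceD(1)[OF S v]
  have "hopping f i j *\<^sub>v v =
      mat_adjoint (f i 0) *\<^sub>v (f j 0 *\<^sub>v v) + mat_adjoint (f j 0) *\<^sub>v (f i 0 *\<^sub>v v)"
    unfolding hopping_def using cs
    by (simp add: add_mult_distrib_mat_vec[of _ d d] vec_assoc mult_carrier_mat[of _ d d])
  thus ?thesis
    using vec_subspaceD(3)[OF S] states_mode[OF M] states_mode_adjoint[OF M] m m' v by simp
qed

text \<open>If \<open>\<psi>\<close> is stabilised by all edge operators but the one of \<open>(i, j)\<close>, project it onto the
  \<open>+1\<close> eigenspace of the latter. The projection vanishes only if \<open>\<psi>\<close> is in the \<open>-1\<close>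
  eigenspace, and then \<open>c\<^sub>i\<close>, which anticommutes with this edge operator alone, repairs the sign.\<close>

lemma stabilized_state_exists:
  assumes M: "M \<subseteq> modes" and "finite D"
    and mem: "\<And>i j. (i, j) \<in> D \<Longrightarrow> (i, L i j) \<in> M \<and> (j, L i j) \<in> M \<and> i \<noteq> j"
    and layered: "\<And>i j i' j'. (i, j) \<in> D \<Longrightarrow> (i', j') \<in> D \<Longrightarrow> L i j = L i' j' \<Longrightarrow>
      (i, j) \<noteq> (i', j') \<Longrightarrow> i \<noteq> i' \<and> j \<noteq> j'"
  shows "\<exists>\<psi>\<in>states M. \<psi> \<noteq> 0\<^sub>v d \<and> (\<forall>(i, j)\<in>D. edge_op f (L i j) i j *\<^sub>v \<psi> = \<psi>)"
  using assms(2-)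
proof (induction D rule: finite_induct)
  case empty
  show ?case using vac_in_states vac_nonzero by auto
next
  case (insert e D)
  obtain i j where e: "e = (i, j)" by force
  note S = states_subspace[OF M]
  define P where "P = edge_op f (L i j) i j"
  define c where "c = majorana_c f i (L i j)"
  have mM: "(i, L i j) \<in> M" "(j, L i j) \<in> M" and "i \<noteq> j" using insert.prems(1) e by auto
  hence m: "(i, L i j) \<in> modes" "(j, L i j) \<in> modes" using M by auto
  have P: "P \<in> carrier_mat d d" and PP: "P * P = 1\<^sub>m d"
    unfolding P_def using edge_op_carrier[OF m] edge_op_square[OF m \<open>i \<noteq> j\<close>] by auto
  have c: "c \<in> carrier_mat d d" "c * c = 1\<^sub>m d"
    unfolding c_def using majorana_c_carrier majorana_c_square m(1) by auto
  have cP: "qcommute d (1 * - 1) c P"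
    unfolding P_def c_def
    by (intro qcommute_edge_op qcommute_self majorana_c_carrier qcommute_majorana_c_d m)
  have "\<exists>\<psi>\<in>states M. \<psi> \<noteq> 0\<^sub>v d \<and> (\<forall>(i, j)\<in>D. edge_op f (L i j) i j *\<^sub>v \<psi> = \<psi>)"
    by (rule insert.IH; rule insert.prems; simp)
  then obtain \<psi> where \<psi>: "\<psi> \<in> states M" "\<psi> \<noteq> 0\<^sub>v d"
    and all: "\<forall>(i, j)\<in>D. edge_op f (L i j) i j *\<^sub>v \<psi> = \<psi>" by blast
  have stab: "edge_op f (L i' j') i' j' *\<^sub>v \<psi> = \<psi>" if "(i', j') \<in> D" for i' j'
    using bspec[OF all that] by simp
  have \<psi>c: "\<psi> \<in> carrier_vec d" using vec_subspaceD(1)[OF S] \<psi>(1) .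
  have Q: "qcommute d 1 (edge_op f (L i' j') i' j') P \<and> qcommute d 1 (edge_op f (L i' j') i' j') c"
    if "(i', j') \<in> D" for i' j'
  proof -
    have m': "(i', L i' j') \<in> modes" "(j', L i' j') \<in> modes" "i' \<noteq> j'"
      using insert.prems(1)[of i' j'] that M by auto
    have lay: "L i j = L i' j' \<Longrightarrow> i \<noteq> i' \<and> j \<noteq> j'"
      using insert.prems(2)[of i j i' j'] that e insert.hyps(2) by auto
    \<comment> \<open>No other edge of this layer has tail \<open>i\<close>, so \<open>c\<close>
      anticommutes with both factors of every other edge operator.\<close>
    have "qcommute d (- 1 * - 1) c (edge_op f (L i' j') i' j')"
      unfolding c_def using lay m m'
      by (intro qcommute_edge_op qcommute_majoranas(1) qcommute_majorana_c_d) auto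
    moreover have "qcommute d 1 P (edge_op f (L i' j') i' j')"
      unfolding P_def using m m' \<open>i \<noteq> j\<close> lay by (intro qcommute_edge_ops)
    ultimately show ?thesis by (auto intro: qcommute_sym)
  qed
  have P\<psi>: "P *\<^sub>v \<psi> \<in> states M"
    unfolding P_def by (rule states_edge_op[OF M mM \<psi>(1)])
  have P\<psi>c: "P *\<^sub>v \<psi> \<in> carrier_vec d" using P \<psi>c by simp
  have PP\<psi>: "P *\<^sub>v (P *\<^sub>v \<psi>) = \<psi>" using vec_assoc[OF P P \<psi>c] PP \<psi>c by simp
  show ?case
  proof (cases "\<psi> + P *\<^sub>v \<psi> = 0\<^sub>v d")
    case False
    have "P *\<^sub>v (\<psi> + P *\<^sub>v \<psi>) = \<psi> + P *\<^sub>v \<psi>"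
      using mult_add_distrib_mat_vec[OF P \<psi>c P\<psi>c] PP\<psi> comm_add_vec[OF \<psi>c P\<psi>c] by simp
    moreover have "edge_op f (L i' j') i' j' *\<^sub>v (\<psi> + P *\<^sub>v \<psi>) = \<psi> + P *\<^sub>v \<psi>"
      if ij': "(i', j') \<in> D" for i' j'
    proof -
      note QP = conjunct1[OF Q[OF ij']]
      show ?thesis
        using mult_add_distrib_mat_vec[OF qcommuteD(1)[OF QP] \<psi>c P\<psi>c] qcommute_vec[OF QP \<psi>c]
          stab[OF ij'] by simp
    qed
    ultimately show ?thesis
      using False vec_subspaceD(3)[OF S \<psi>(1) P\<psi>] by (auto simp: e P_def)
  next
    case True
    have neg: "P *\<^sub>v \<psi> = (- 1) \<cdot>\<^sub>v \<psi>"
    proof (rule eq_vecI)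
      fix r assume "r < dim_vec ((- 1) \<cdot>\<^sub>v \<psi>)"
      hence r: "r < d" using \<psi>c by simp
      have "(\<psi> + P *\<^sub>v \<psi>) $ r = 0" using True r by simp
      thus "(P *\<^sub>v \<psi>) $ r = ((- 1) \<cdot>\<^sub>v \<psi>) $ r"
        using r \<psi>c P\<psi>c P by (simp add: add_eq_0_iff del: index_mult_mat_vec)
    qed (use P \<psi>c in auto)
    have c\<psi>: "c *\<^sub>v \<psi> \<in> carrier_vec d" using c \<psi>c by simp
    have "P *\<^sub>v (c *\<^sub>v \<psi>) = (- 1) \<cdot>\<^sub>v (c *\<^sub>v ((- 1) \<cdot>\<^sub>v \<psi>))"
      using qcommute_vec[OF qcommute_sym[OF cP] \<psi>c] neg by simp
    also have "\<dots> = c *\<^sub>v \<psi>"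
      using mult_mat_vec[OF c(1) \<psi>c] c\<psi> by (simp add: smult_smult_assoc)
    finally have "P *\<^sub>v (c *\<^sub>v \<psi>) = c *\<^sub>v \<psi>" .
    moreover have "edge_op f (L i' j') i' j' *\<^sub>v (c *\<^sub>v \<psi>) = c *\<^sub>v \<psi>" if ij': "(i', j') \<in> D" for i' j'
      using qcommute_vec[OF conjunct2[OF Q[OF ij']] \<psi>c] stab[OF ij'] by simp
    moreover have "c *\<^sub>v \<psi> \<in> states M" unfolding c_def by (rule states_majorana[OF M mM(1) \<psi>(1)])
    moreover have "c *\<^sub>v \<psi> \<noteq> 0\<^sub>v d"
    proof
      assume "c *\<^sub>v \<psi> = 0\<^sub>v d"
      hence "c *\<^sub>v (c *\<^sub>v \<psi>) = 0\<^sub>v d" using mat_vec_zero[OF c(1)] by simp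
      moreover have "c *\<^sub>v (c *\<^sub>v \<psi>) = \<psi>" using vec_assoc[OF c(1) c(1) \<psi>c] c(2) \<psi>c by simp
      ultimately show False using \<psi>(2) by simp
    qed
    ultimately show ?thesis by (auto simp: e P_def)
  qed
qed

section \<open>Parity and dressed states\<close>

lemma qcommute_poly:
  assumes A: "A \<in> creation_polynomials d f M" and X: "X \<in> carrier_mat d d"
    and gen: "\<And>i k. (i, k) \<in> M \<Longrightarrow> qcommute d 1 X (mat_adjoint (f i k))"
  shows "qcommute d 1 X A"
  using A
proof (induction rule: creation_polynomials.induct)
  case (mult A B)
  thus ?case using qcommute_mult_right[of d 1 X A 1 B] by simp
qed (use X gen in \<open>auto intro: qcommute_smult_right qcommute_add_right\<close>)

text \<open>\<open>G\<close> is 1 - 2n with n the number operator of the mode, hence its parity.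
  Nilpotency makes it anticommute with its own mode; being quadratic, it commutes with all
  others.\<close>

lemma mode_parity:
  assumes ik: "(i, k) \<in> modes"
  defines "G \<equiv> f i k * mat_adjoint (f i k) - mat_adjoint (f i k) * f i k"
  shows "G *\<^sub>v vac = vac" and "G \<in> carrier_mat d d"
    and "(j, l) \<in> modes \<Longrightarrow> qcommute d (if (j, l) = (i, k) then - 1 else 1) G (f j l)"
    and "(j, l) \<in> modes \<Longrightarrow> qcommute d (if (j, l) = (i, k) then - 1 else 1) G (mat_adjoint (f j l))"
proof -
  let ?b = "f i k" and ?b' = "mat_adjoint (f i k)"
  note b = carrier[OF ik] mat_adjoint_carrier[OF carrier[OF ik]]
  note nil = nilpotent_mode[OF ik] nilpotent_mode_adjoint[OF ik]
  show G: "G \<in> carrier_mat d d" unfolding G_def using ik by (auto intro!: carrier_matI)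
  have ann: "(?b' * ?b) *\<^sub>v vac = 0\<^sub>v d"
    using b ik by (simp add: vec_assoc annihilates_vac mat_vec_zero[of _ d])
  have "vac = (?b * ?b' + ?b' * ?b) *\<^sub>v vac" unfolding mode_anticommutator_adjoint[OF ik] by simp
  also have "\<dots> = (?b * ?b') *\<^sub>v vac"
    using b ann mult_mat_vec_carrier[OF mult_carrier_mat[OF b] vac_carrier] by (simp add: add_mult_distrib_mat_vec[of _ d d] mult_carrier_mat[of _ d d])
  finally have even: "(?b * ?b') *\<^sub>v vac = vac" ..
  have "G *\<^sub>v vac = (?b * ?b') *\<^sub>v vac - (?b' * ?b) *\<^sub>v vac"
    unfolding G_def by (rule minus_mult_distrib_mat_vec[of _ d d]) (use b in \<open>auto intro!: mult_carrier_mat\<close>)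
  also have "\<dots> = vac"
    unfolding ann even by (intro eq_vecI) (auto simp: carrier_vecD[OF vac_carrier])
  finally show "G *\<^sub>v vac = vac" .
  have Gb: "G * ?b = (- 1) \<cdot>\<^sub>m (?b * G)"
  proof -
    have "G * ?b = ?b * (?b' * ?b) - ?b' * (?b * ?b)"
      unfolding G_def using ik by (simp add: mat_dim_simps mat_distrib_simps)
    moreover have "?b * G = (?b * ?b) * ?b' - ?b * (?b' * ?b)"
      unfolding G_def using ik by (simp add: mat_dim_simps mat_distrib_simps)
    moreover have "?b * (?b' * ?b) \<in> carrier_mat d d" using ik by (auto intro!: carrier_matI)
    ultimately show ?thesis
      unfolding nil using b by (intro eq_matI) (auto simp del: index_mult_mat(1))
  qed
  have Gb': "G * ?b' = (- 1) \<cdot>\<^sub>m (?b' * G)"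
  proof -
    have "G * ?b' = ?b * (?b' * ?b') - ?b' * (?b * ?b')"
      unfolding G_def using ik by (simp add: mat_dim_simps mat_distrib_simps)
    moreover have "?b' * G = ?b' * (?b * ?b') - (?b' * ?b') * ?b"
      unfolding G_def using ik by (simp add: mat_dim_simps mat_distrib_simps)
    moreover have "?b' * (?b * ?b') \<in> carrier_mat d d" using ik by (auto intro!: carrier_matI)
    ultimately show ?thesis
      unfolding nil using b by (intro eq_matI) (auto simp del: index_mult_mat(1))
  qed
  have comm: "qcommute d (- 1 * - 1) G X"
    if "qcommute d (- 1) ?b X" "qcommute d (- 1) ?b' X" for X
    unfolding G_def using that by (intro qcommute_minus_left qcommute_mult_left)
  show "qcommute d (if (j, l) = (i, k) then - 1 else 1) G (f j l)" if "(j, l) \<in> modes"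
  proof (cases "(j, l) = (i, k)")
    case True
    thus ?thesis using G b Gb by (simp add: qcommute_def)
  next
    case False
    thus ?thesis
      using comm[OF qcommute_modes[OF ik that] qcommute_adjoint_modes[OF ik that]] by auto
  qed
  show "qcommute d (if (j, l) = (i, k) then - 1 else 1) G (mat_adjoint (f j l))" if "(j, l) \<in> modes"
  proof (cases "(j, l) = (i, k)")
    case True
    thus ?thesis using G b Gb' by (simp add: qcommute_def)
  next
    case False
    thus ?thesis
      using comm[OF qcommute_modes_adjoint[OF ik that] qcommute_adjoint_modes_adjoint[OF ik that]] by auto
  qed
qed

text \<open>The product of the single-mode parities: a mode in \<open>M\<close> anticommutes with
  exactly one factor, any other mode with none.\<close>

lemma parity_operator:
  assumes "finite M" "M \<subseteq> modes"
  shows "\<exists>\<Gamma> \<in> carrier_mat d d. \<Gamma> *\<^sub>v vac = vac \<and>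
    (\<forall>(j, l)\<in>modes. qcommute d (if (j, l) \<in> M then - 1 else 1) \<Gamma> (f j l) \<and>
      qcommute d (if (j, l) \<in> M then - 1 else 1) \<Gamma> (mat_adjoint (f j l)))"
  using assms
proof (induction M rule: finite_induct)
  case empty
  show ?case
    using carrier by (intro bexI[of _ "1\<^sub>m d"]) (auto intro!: qcommute_sym[OF qcommute_one])
next
  case (insert m M)
  obtain i k where m: "m = (i, k)" by force
  have ik: "(i, k) \<in> modes" using insert.prems m by simp
  obtain \<Gamma> where \<Gamma>: "\<Gamma> \<in> carrier_mat d d" "\<Gamma> *\<^sub>v vac = vac"
    and all: "\<forall>(j, l)\<in>modes. qcommute d (if (j, l) \<in> M then - 1 else 1) \<Gamma> (f j l) \<and>
      qcommute d (if (j, l) \<in> M then - 1 else 1) \<Gamma> (mat_adjoint (f j l))"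
    using insert.IH insert.prems by blast
  have anti: "qcommute d (if (j, l) \<in> M then - 1 else 1) \<Gamma> (f j l)"
      "qcommute d (if (j, l) \<in> M then - 1 else 1) \<Gamma> (mat_adjoint (f j l))"
    if "(j, l) \<in> modes" for j l
    using bspec[OF all that] by simp_all
  define G where "G = f i k * mat_adjoint (f i k) - mat_adjoint (f i k) * f i k"
  note G = mode_parity[OF ik, folded G_def]
  have sign: "(if (j, l) = (i, k) then - 1 else 1) * (if (j, l) \<in> M then - 1 else 1) =
      (if (j, l) \<in> insert m M then - 1 else 1 :: complex)" for j l
    using insert.hyps(2) m by auto
  show ?case
  proof (rule bexI[of _ "G * \<Gamma>"], safe)
    show "(G * \<Gamma>) *\<^sub>v vac = vac" using G(1,2) \<Gamma> by (simp add: vec_assoc)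
    fix j l assume jl: "(j, l) \<in> modes"
    show "qcommute d (if (j, l) \<in> insert m M then - 1 else 1) (G * \<Gamma>) (f j l)"
      unfolding sign[symmetric] by (rule qcommute_mult_left[OF G(3)[OF jl] anti(1)[OF jl]])
    show "qcommute d (if (j, l) \<in> insert m M then - 1 else 1) (G * \<Gamma>) (mat_adjoint (f j l))"
      unfolding sign[symmetric] by (rule qcommute_mult_left[OF G(4)[OF jl] anti(2)[OF jl]])
  qed (use G(2) \<Gamma> in \<open>auto intro!: mult_carrier_mat\<close>)
qed

text \<open>Multiplying each creation operator of a mode outside \<open>M\<close> by the parity of the modes in \<open>M\<close>
  makes it commute with these modes, without changing its action on vectors of even parity.\<close>

lemma dressed_polynomial:
  assumes M: "finite M" "M \<subseteq> modes" and M': "M' \<subseteq> modes" "M \<inter> M' = {}"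
    and B: "B \<in> creation_polynomials d f M'"
  shows "\<exists>B' \<in> carrier_mat d d. B' *\<^sub>v vac = B *\<^sub>v vac \<and>
    (\<forall>(j, l)\<in>M. qcommute d 1 B' (f j l) \<and> qcommute d 1 B' (mat_adjoint (f j l)))"
proof -
  obtain \<Gamma> where \<Gamma>: "\<Gamma> \<in> carrier_mat d d" "\<Gamma> *\<^sub>v vac = vac"
    and all: "\<forall>(j, l)\<in>modes. qcommute d (if (j, l) \<in> M then - 1 else 1) \<Gamma> (f j l) \<and>
      qcommute d (if (j, l) \<in> M then - 1 else 1) \<Gamma> (mat_adjoint (f j l))"
    using parity_operator[OF M] by blast
  have anti: "qcommute d (if (j, l) \<in> M then - 1 else 1) \<Gamma> (f j l)"
      "qcommute d (if (j, l) \<in> M then - 1 else 1) \<Gamma> (mat_adjoint (f j l))"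
    if "(j, l) \<in> modes" for j l
    using bspec[OF all that] by simp_all
  have \<Gamma>B: "qcommute d 1 \<Gamma> B" if "B \<in> creation_polynomials d f M'" for B
  proof (rule qcommute_poly[OF that \<Gamma>(1)])
    fix i k assume "(i, k) \<in> M'"
    hence "(i, k) \<in> modes" "(i, k) \<notin> M" using M' by auto
    thus "qcommute d 1 \<Gamma> (mat_adjoint (f i k))" using anti(2)[of i k] by simp
  qed
  \<comment> \<open>Agreement on the vacuum alone would not pass through products: the left factor
    acts on the image under the right one, which is again even because \<open>\<Gamma>\<close>
    commutes with it.\<close>
  have "\<exists>B' \<in> carrier_mat d d. (\<forall>\<xi>\<in>carrier_vec d. \<Gamma> *\<^sub>v \<xi> = \<xi> \<longrightarrow> B' *\<^sub>v \<xi> = B *\<^sub>v \<xi>) \<and>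
    (\<forall>(j, l)\<in>M. qcommute d 1 B' (f j l) \<and> qcommute d 1 B' (mat_adjoint (f j l)))"
    using B
  proof (induction rule: creation_polynomials.induct)
    case one
    have "qcommute d 1 (1\<^sub>m d) (f j l) \<and> qcommute d 1 (1\<^sub>m d) (mat_adjoint (f j l))" if "(j, l) \<in> M" for j l
      using that M carrier[of j l] by (auto intro!: qcommute_sym[OF qcommute_one])
    thus ?case by (intro bexI[of _ "1\<^sub>m d"]) auto
  next
    case (creation i k)
    hence ik: "(i, k) \<in> modes" "(i, k) \<notin> M" using M' by auto
    let ?b' = "mat_adjoint (f i k)"
    have b': "?b' \<in> carrier_mat d d" using carrier[OF ik(1)] by simp
    \<comment> \<open>Against a mode of \<open>M\<close> the creation operator and the parity each
      give a minus sign.\<close>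
    have "qcommute d 1 (?b' * \<Gamma>) (f j l) \<and> qcommute d 1 (?b' * \<Gamma>) (mat_adjoint (f j l))"
      if jl: "(j, l) \<in> M" for j l
    proof -
      have jl': "(j, l) \<in> modes" "(i, k) \<noteq> (j, l)" using jl ik M by auto
      show ?thesis
        using qcommute_mult_left[OF qcommute_adjoint_modes[OF ik(1) jl'] anti(1)[OF jl'(1)]]
          qcommute_mult_left[OF qcommute_adjoint_modes_adjoint[OF ik(1) jl'(1)] anti(2)[OF jl'(1)]] jl
        by simp
    qed
    moreover have "?b' * \<Gamma> \<in> carrier_mat d d" using b' \<Gamma>(1) by (rule mult_carrier_mat)
    ultimately show ?case using b' \<Gamma>(1) by (intro bexI[of _ "?b' * \<Gamma>"]) (auto simp: vec_assoc)
  next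
    case (smult A c)
    then obtain A' where A': "A' \<in> carrier_mat d d"
      "\<And>\<xi>. \<xi> \<in> carrier_vec d \<Longrightarrow> \<Gamma> *\<^sub>v \<xi> = \<xi> \<Longrightarrow> A' *\<^sub>v \<xi> = A *\<^sub>v \<xi>"
      "\<forall>(j, l)\<in>M. qcommute d 1 A' (f j l) \<and> qcommute d 1 A' (mat_adjoint (f j l))" by blast
    have A: "A \<in> carrier_mat d d" using smult.hyps M' poly_carrier by blast
    show ?case
      using A A' by (intro bexI[of _ "c \<cdot>\<^sub>m A'"]) (auto simp: smult_mat_vec[of _ d d] intro!: qcommute_smult_left)
  next
    case (add A B)
    then obtain A' B' where A': "A' \<in> carrier_mat d d"
      "\<And>\<xi>. \<xi> \<in> carrier_vec d \<Longrightarrow> \<Gamma> *\<^sub>v \<xi> = \<xi> \<Longrightarrow> A' *\<^sub>v \<xi> = A *\<^sub>v \<xi>"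
      "\<forall>(j, l)\<in>M. qcommute d 1 A' (f j l) \<and> qcommute d 1 A' (mat_adjoint (f j l))"
      and B': "B' \<in> carrier_mat d d"
      "\<And>\<xi>. \<xi> \<in> carrier_vec d \<Longrightarrow> \<Gamma> *\<^sub>v \<xi> = \<xi> \<Longrightarrow> B' *\<^sub>v \<xi> = B *\<^sub>v \<xi>"
      "\<forall>(j, l)\<in>M. qcommute d 1 B' (f j l) \<and> qcommute d 1 B' (mat_adjoint (f j l))" by blast
    have AB: "A \<in> carrier_mat d d" "B \<in> carrier_mat d d" using add.hyps M' poly_carrier by blast+
    show ?case
      using AB A' B'
      by (intro bexI[of _ "A' + B'"])
        (auto simp: add_mult_distrib_mat_vec[of _ d d] intro!: qcommute_add_left)
  next
    case (mult A B)
    then obtain A' B' where A': "A' \<in> carrier_mat d d"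
      "\<And>\<xi>. \<xi> \<in> carrier_vec d \<Longrightarrow> \<Gamma> *\<^sub>v \<xi> = \<xi> \<Longrightarrow> A' *\<^sub>v \<xi> = A *\<^sub>v \<xi>"
      "\<forall>(j, l)\<in>M. qcommute d 1 A' (f j l) \<and> qcommute d 1 A' (mat_adjoint (f j l))"
      and B': "B' \<in> carrier_mat d d"
      "\<And>\<xi>. \<xi> \<in> carrier_vec d \<Longrightarrow> \<Gamma> *\<^sub>v \<xi> = \<xi> \<Longrightarrow> B' *\<^sub>v \<xi> = B *\<^sub>v \<xi>"
      "\<forall>(j, l)\<in>M. qcommute d 1 B' (f j l) \<and> qcommute d 1 B' (mat_adjoint (f j l))" by blast
    have AB: "A \<in> carrier_mat d d" "B \<in> carrier_mat d d" using mult.hyps M' poly_carrier by blast+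
    have "(A' * B') *\<^sub>v \<xi> = (A * B) *\<^sub>v \<xi>" if \<xi>: "\<xi> \<in> carrier_vec d" "\<Gamma> *\<^sub>v \<xi> = \<xi>" for \<xi>
    proof -
      have "\<Gamma> *\<^sub>v (B *\<^sub>v \<xi>) = B *\<^sub>v \<xi>"
        using qcommute_vec[OF \<Gamma>B[OF mult.hyps(2)] \<xi>(1)] \<xi>(2) by simp
      thus ?thesis using AB A' B' \<xi> by (simp add: vec_assoc)
    qed
    moreover have "\<forall>(j, l)\<in>M. qcommute d 1 (A' * B') (f j l) \<and> qcommute d 1 (A' * B') (mat_adjoint (f j l))"
    proof
      fix p assume p: "p \<in> M"
      have "qcommute d 1 (A' * B') X" if "qcommute d 1 A' X" "qcommute d 1 B' X" for X
        using qcommute_mult_left[OF that] by simp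
      thus "case p of (j, l) \<Rightarrow> qcommute d 1 (A' * B') (f j l) \<and> qcommute d 1 (A' * B') (mat_adjoint (f j l))"
        using bspec[OF A'(3) p] bspec[OF B'(3) p] by (cases p) simp
    qed
    moreover have "A' * B' \<in> carrier_mat d d" using A'(1) B'(1) by (rule mult_carrier_mat)
    ultimately show ?case by (intro bexI[of _ "A' * B'"]) auto
  qed
  thus ?thesis using \<Gamma>(2) by auto
qed

section \<open>Joint states and their evolution\<close>

abbreviation aux_modes :: "(nat \<times> nat) set" where
  "aux_modes \<equiv> {1..N} \<times> {1..\<nu>}"

abbreviation phys_modes :: "(nat \<times> nat) set" where
  "phys_modes \<equiv> {1..N} \<times> {0}"

lemma aux_phys_modes:
  "finite aux_modes" "aux_modes \<subseteq> modes" "phys_modes \<subseteq> modes" "aux_modes \<inter> phys_modes = {}"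
  by (auto simp: modes_def)

lemma dressed_state:
  assumes "\<phi> \<in> states phys_modes"
  shows "\<exists>C \<in> carrier_mat d d. \<phi> = C *\<^sub>v vac \<and>
    (\<forall>(i, k)\<in>aux_modes. qcommute d 1 C (f i k) \<and> qcommute d 1 C (mat_adjoint (f i k)))"
proof -
  obtain B where B: "B \<in> creation_polynomials d f phys_modes" "\<phi> = B *\<^sub>v vac"
    using assms by (auto simp: states_def)
  from dressed_polynomial[OF aux_phys_modes B(1)]
  obtain C where "C \<in> carrier_mat d d" "C *\<^sub>v vac = \<phi>"
    "\<forall>(i, k)\<in>aux_modes. qcommute d 1 C (f i k) \<and> qcommute d 1 C (mat_adjoint (f i k))"
    unfolding B(2)[symmetric] by blast
  thus ?thesis by (intro bexI[of _ C] conjI) simp_all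
qed

text \<open>Supplies the uniqueness behind the definite description: with a dressed operator
  \<open>C\<close> for \<open>\<phi>\<close>, applying \<open>A\<close> to \<open>\<phi>\<close> is
  the same as applying \<open>C\<close> to A|vac>, so \<open>A\<close> matters only through
  A|vac>.\<close>

lemma joint_state_eq:
  assumes A: "A \<in> aux_polynomials N \<nu> d f" and \<phi>: "\<phi> \<in> states phys_modes"
  shows "joint_state N \<nu> d f vac (A *\<^sub>v vac) \<phi> = A *\<^sub>v \<phi>"
  unfolding joint_state_def
proof (rule the_equality)
  obtain B where B: "B \<in> phys_polynomials N d f" "\<phi> = B *\<^sub>v vac"
    using \<phi> by (auto simp: states_def phys_polynomials_def)
  have carA: "A \<in> carrier_mat d d" if "A \<in> aux_polynomials N \<nu> d f" for A
    using poly_carrier aux_phys_modes that unfolding aux_polynomials_def by blast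
  have carB: "B \<in> carrier_mat d d" if "B \<in> phys_polynomials N d f" for B
    using poly_carrier aux_phys_modes that unfolding phys_polynomials_def by blast
  show "\<exists>A'\<in>aux_polynomials N \<nu> d f. \<exists>B\<in>phys_polynomials N d f.
      A' *\<^sub>v vac = A *\<^sub>v vac \<and> B *\<^sub>v vac = \<phi> \<and> A *\<^sub>v \<phi> = (A' * B) *\<^sub>v vac"
    using carA[OF A] carB[OF B(1)] B(2)
    by (intro bexI[OF _ A] bexI[OF _ B(1)]) (simp add: vec_assoc)
  obtain C where C: "C \<in> carrier_mat d d" "\<phi> = C *\<^sub>v vac"
    and all: "\<forall>(i, k)\<in>aux_modes. qcommute d 1 C (f i k) \<and> qcommute d 1 C (mat_adjoint (f i k))"
    using dressed_state[OF \<phi>] by blast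
  have comm: "qcommute d 1 C (f i k)" "qcommute d 1 C (mat_adjoint (f i k))"
    if "(i, k) \<in> aux_modes" for i k
    using bspec[OF all that] by simp_all
  have A\<phi>: "A' *\<^sub>v \<phi> = C *\<^sub>v (A' *\<^sub>v vac)" if A': "A' \<in> aux_polynomials N \<nu> d f" for A'
  proof -
    have "qcommute d 1 C A'" 
      using A' C(1) comm(2) unfolding aux_polynomials_def by (rule qcommute_poly)
    from qcommute_vec[OF this vac_carrier] show ?thesis
      using C(1,2) carA[OF A'] by simp
  qed
  fix \<xi>
  assume "\<exists>A'\<in>aux_polynomials N \<nu> d f. \<exists>B\<in>phys_polynomials N d f.
      A' *\<^sub>v vac = A *\<^sub>v vac \<and> B *\<^sub>v vac = \<phi> \<and> \<xi> = (A' * B) *\<^sub>v vac"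
  then obtain A' B where "A' \<in> aux_polynomials N \<nu> d f" "B \<in> phys_polynomials N d f"
    "A' *\<^sub>v vac = A *\<^sub>v vac" "B *\<^sub>v vac = \<phi>" "\<xi> = (A' * B) *\<^sub>v vac" by blast
  thus "\<xi> = A *\<^sub>v \<phi>" using A\<phi>[of A'] A\<phi>[OF A] carA carB by (simp add: vec_assoc)
qed

lemma edge_op_joint:
  assumes A: "A \<in> aux_polynomials N \<nu> d f" and \<phi>: "\<phi> \<in> states phys_modes"
    and m: "(i, l) \<in> aux_modes" "(j, l) \<in> aux_modes"
    and stab: "edge_op f l i j *\<^sub>v (A *\<^sub>v vac) = A *\<^sub>v vac"
  shows "edge_op f l i j *\<^sub>v (A *\<^sub>v \<phi>) = A *\<^sub>v \<phi>"
proof -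
  obtain C where C: "C \<in> carrier_mat d d" "\<phi> = C *\<^sub>v vac"
    and all: "\<forall>(i, k)\<in>aux_modes. qcommute d 1 C (f i k) \<and> qcommute d 1 C (mat_adjoint (f i k))"
    using dressed_state[OF \<phi>] by blast
  have comm: "qcommute d 1 C (f i k)" "qcommute d 1 C (mat_adjoint (f i k))"
    if "(i, k) \<in> aux_modes" for i k
    using bspec[OF all that] by simp_all
  have Ac: "A \<in> carrier_mat d d"
    using A poly_carrier aux_phys_modes unfolding aux_polynomials_def by blast
  have "qcommute d 1 C A"
    using A C(1) comm(2) unfolding aux_polynomials_def by (rule qcommute_poly)
  from qcommute_vec[OF this vac_carrier] have A\<phi>: "A *\<^sub>v \<phi> = C *\<^sub>v (A *\<^sub>v vac)"
    using C(1,2) Ac by simp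
  have "qcommute d (1 * 1) C (edge_op f l i j)"
    by (intro qcommute_edge_op qcommute_majorana_c qcommute_majorana_d comm m)
  hence "C *\<^sub>v (edge_op f l i j *\<^sub>v (A *\<^sub>v vac)) = edge_op f l i j *\<^sub>v (C *\<^sub>v (A *\<^sub>v vac))"
    using qcommute_vec[of 1 C "edge_op f l i j" "A *\<^sub>v vac"] Ac by simp
  thus ?thesis unfolding stab A\<phi> by simp
qed

text \<open>A hopping term is quadratic in the physical modes, so its two signs against an auxiliary
  creation operator cancel.\<close>

lemma hopping_joint:
  assumes A: "A \<in> aux_polynomials N \<nu> d f" and m: "(i, 0) \<in> phys_modes" "(j, 0) \<in> phys_modes"
    and \<phi>: "\<phi> \<in> carrier_vec d"
  shows "hopping f i j *\<^sub>v (A *\<^sub>v \<phi>) = A *\<^sub>v (hopping f i j *\<^sub>v \<phi>)"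
proof -
  have m': "(i, 0) \<in> modes" "(j, 0) \<in> modes" using m aux_phys_modes by auto
  have "qcommute d 1 (hopping f i j) A"
    using A unfolding aux_polynomials_def
  proof (rule qcommute_poly[OF _ hopping_carrier[OF m']])
    fix a k assume "(a, k) \<in> aux_modes"
    hence ak: "(a, k) \<in> modes" "(a, k) \<noteq> (i, 0)" "(a, k) \<noteq> (j, 0)" using aux_phys_modes by auto
    have "qcommute d (- 1 * - 1) (mat_adjoint (f a k)) (hopping f i j)"
      using ak m'
      by (intro qcommute_hopping qcommute_adjoint_modes qcommute_adjoint_modes_adjoint)
    thus "qcommute d 1 (hopping f i j) (mat_adjoint (f a k))" by (auto intro: qcommute_sym)
  qed
  from qcommute_vec[OF this \<phi>] A show ?thesis
    using hopping_carrier[OF m'] \<phi> by simp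
qed

lemma transformed_evolution:
  assumes graph: "simple_graph {1..N} E" and D: "orientation E D"
    and lay: "\<And>e. e \<in> E \<Longrightarrow> lay e \<in> {1..\<nu>}"
    and \<psi>: "\<psi> \<in> aux_states N \<nu> d f vac"
    and stab: "\<And>i j. (i, j) \<in> D \<Longrightarrow> edge_op f (lay {i, j}) i j *\<^sub>v \<psi> = \<psi>"
    and \<phi>: "\<phi> \<in> phys_states N d f vac"
  shows "mat_exp (k \<cdot>\<^sub>m transformed_hamiltonian d f D lay t) *\<^sub>v joint_state N \<nu> d f vac \<psi> \<phi> =
    joint_state N \<nu> d f vac \<psi> (mat_exp (k \<cdot>\<^sub>m hamiltonian d f E t) *\<^sub>v \<phi>)"
proof -
  let ?S = "states phys_modes" and ?L = "{(i, j). i < j \<and> {i, j} \<in> E}"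
  note S = states_subspace[OF aux_phys_modes(3)]
  obtain A where A: "A \<in> aux_polynomials N \<nu> d f" "\<psi> = A *\<^sub>v vac"
    using \<psi> by (auto simp: aux_states_def)
  have Ac: "A \<in> carrier_mat d d"
    using A poly_carrier aux_phys_modes unfolding aux_polynomials_def by blast
  have \<phi>S: "\<phi> \<in> ?S" using \<phi> by (auto simp: phys_states_def phys_polynomials_def states_def)
  have E: "card e = 2" "e \<subseteq> {1..N}" if "e \<in> E" for e using graph that by (auto simp: simple_graph_def)
  have edge: "(i, 0) \<in> phys_modes" "(j, 0) \<in> phys_modes" "(i, lay {i, j}) \<in> aux_modes"
    "(j, lay {i, j}) \<in> aux_modes" if "{i, j} \<in> E" for i j
    using E(2)[OF that] lay[OF that] by auto
  have hop: "hopping f i j \<in> carrier_mat d d" if "{i, j} \<in> E" for i j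
    using edge[OF that] aux_phys_modes by (intro hopping_carrier) auto
  have edgec: "edge_op f (lay {i, j}) i j \<in> carrier_mat d d" if "{i, j} \<in> E" for i j
    using edge[OF that] aux_phys_modes by (intro edge_op_carrier) auto
  define H where "H = hamiltonian d f E t"
  define H' where "H' = transformed_hamiltonian d f D lay t"
  have Hc: "H \<in> carrier_mat d d" "H' \<in> carrier_mat d d"
    by (auto simp: H_def H'_def hamiltonian_def transformed_hamiltonian_def)
  have "finite ?L"
    by (rule finite_subset[of _ "{1..N} \<times> {1..N}"]) (use E(2) in auto)
  have HS: "H *\<^sub>v w \<in> ?S" if w: "w \<in> ?S" for w
    unfolding H_def hamiltonian_def
  proof (rule mat_sum_vec_subspace[OF S \<open>finite ?L\<close>])
    show "w \<in> carrier_vec d" using vec_subspaceD(1)[OF S w] .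
    fix e assume e: "e \<in> ?L"
    then obtain i j where ij: "e = (i, j)" "{i, j} \<in> E" by blast
    show "(case e of (i, j) \<Rightarrow> complex_of_real (t {i, j}) \<cdot>\<^sub>m hopping f i j) \<in> carrier_mat d d"
      using hop[OF ij(2)] ij(1) by simp
    have "hopping f i j *\<^sub>v w \<in> ?S"
      by (rule states_hopping[OF aux_phys_modes(3) edge(1,2)[OF ij(2)] w])
    thus "(case e of (i, j) \<Rightarrow> complex_of_real (t {i, j}) \<cdot>\<^sub>m hopping f i j) *\<^sub>v w \<in> ?S"
      using ij(1) hop[OF ij(2)] vec_subspaceD(1)[OF S w] vec_subspaceD(4)[OF S]
      by (simp add: smult_mat_vec[of _ d d])
  qed
  \<comment> \<open>On \<open>A *\<^sub>v w\<close> every edge operator acts as the identity and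
    drops out; what remains is the original sum taken over \<open>D\<close> instead of the
    increasing pairs. The comparison is made by coordinates, where sums of operators become sums of
    numbers.\<close>
  have H'H: "H' *\<^sub>v (A *\<^sub>v w) = A *\<^sub>v (H *\<^sub>v w)" if w: "w \<in> ?S" for w
  proof (rule eq_vecI)
    fix r assume "r < dim_vec (A *\<^sub>v (H *\<^sub>v w))"
    hence r: "r < d" using Ac by simp
    have wc: "w \<in> carrier_vec d" using vec_subspaceD(1)[OF S w] .
    have Aw: "A *\<^sub>v w \<in> carrier_vec d" using Ac wc by simp
    define g where "g = (\<lambda>(i, j). complex_of_real (t {i, j}) * (A *\<^sub>v (hopping f i j *\<^sub>v w)) $ r)"
    have DE: "{i, j} \<in> E" if "(i, j) \<in> D" for i j using orientationD(1)[OF D that] .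
    have "(1\<^sub>m d *\<^sub>v (H' *\<^sub>v (A *\<^sub>v w))) $ r = sum g D"
      unfolding H'_def transformed_hamiltonian_def
    proof (subst mult_mat_sum_vec_index[OF _ one_carrier_mat Aw r])
      fix e assume "e \<in> D"
      thus "(case e of (i, j) \<Rightarrow> complex_of_real (t {i, j}) \<cdot>\<^sub>m
          (hopping f i j * edge_op f (lay {i, j}) i j)) \<in> carrier_mat d d"
        using DE[of "fst e" "snd e"] hop[of "fst e" "snd e"] edgec[of "fst e" "snd e"]
        by (auto simp: case_prod_unfold intro!: mult_carrier_mat)
    next
      show "(\<Sum>e\<in>D. (1\<^sub>m d *\<^sub>v ((case e of (i, j) \<Rightarrow> complex_of_real (t {i, j}) \<cdot>\<^sub>m
          (hopping f i j * edge_op f (lay {i, j}) i j)) *\<^sub>v (A *\<^sub>v w))) $ r) = sum g D"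
      proof (rule sum.cong[OF refl])
        fix e assume e: "e \<in> D"
        obtain i j where ij: "e = (i, j)" by force
        have ijE: "{i, j} \<in> E" using DE e ij by simp
        note cs = hop[OF ijE] edgec[OF ijE]
        have "(complex_of_real (t {i, j}) \<cdot>\<^sub>m (hopping f i j * edge_op f (lay {i, j}) i j)) *\<^sub>v (A *\<^sub>v w) =
            complex_of_real (t {i, j}) \<cdot>\<^sub>v (hopping f i j *\<^sub>v (edge_op f (lay {i, j}) i j *\<^sub>v (A *\<^sub>v w)))"
          using cs Aw by (simp add: smult_mat_vec[of _ d d] vec_assoc mult_carrier_mat[of _ d d])
        also have "edge_op f (lay {i, j}) i j *\<^sub>v (A *\<^sub>v w) = A *\<^sub>v w"
          using edge_op_joint[OF A(1) w edge(3,4)[OF ijE]] stab[of i j] e ij A(2) by simp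
        also have "hopping f i j *\<^sub>v (A *\<^sub>v w) = A *\<^sub>v (hopping f i j *\<^sub>v w)"
          by (rule hopping_joint[OF A(1) edge(1,2)[OF ijE] wc])
        finally show "(1\<^sub>m d *\<^sub>v ((case e of (i, j) \<Rightarrow> complex_of_real (t {i, j}) \<cdot>\<^sub>m
            (hopping f i j * edge_op f (lay {i, j}) i j)) *\<^sub>v (A *\<^sub>v w))) $ r = g e"
          using Ac r wc cs by (simp add: ij g_def del: index_mult_mat_vec(1))
      qed
    qed
    also have "\<dots> = sum g ?L"
    proof (rule sum_orientation[OF D E(1)])
      fix i j assume ijE: "{i, j} \<in> E"
      have "(i, 0) \<in> modes" "(j, 0) \<in> modes"
        using edge(1,2)[OF ijE] aux_phys_modes(3) by blast+
      hence "hopping f i j = hopping f j i"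
        unfolding hopping_def by (intro comm_add_mat[of _ d d]) (auto intro!: carrier_matI)
      thus "g (i, j) = g (j, i)" by (simp add: g_def insert_commute)
    qed
    also have "\<dots> = (A *\<^sub>v (H *\<^sub>v w)) $ r"
      unfolding H_def hamiltonian_def
    proof (subst mult_mat_sum_vec_index[OF _ Ac wc r])
      fix e assume "e \<in> ?L"
      thus "(case e of (i, j) \<Rightarrow> complex_of_real (t {i, j}) \<cdot>\<^sub>m hopping f i j) \<in> carrier_mat d d"
        using hop by auto
    next
      show "sum g ?L =
          (\<Sum>e\<in>?L. (A *\<^sub>v ((case e of (i, j) \<Rightarrow> complex_of_real (t {i, j}) \<cdot>\<^sub>m hopping f i j) *\<^sub>v w)) $ r)"
      proof (rule sum.cong[OF refl])
        fix e assume "e \<in> ?L"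
        then obtain i j where ij: "e = (i, j)" "{i, j} \<in> E" by blast
        have hw: "hopping f i j *\<^sub>v w \<in> carrier_vec d" using hop[OF ij(2)] wc by simp
        show "g e = (A *\<^sub>v ((case e of (i, j) \<Rightarrow> complex_of_real (t {i, j}) \<cdot>\<^sub>m hopping f i j) *\<^sub>v w)) $ r"
          using smult_mat_vec[OF hop[OF ij(2)] wc] mult_mat_vec[OF Ac hw] Ac hw r
          by (simp add: ij(1) g_def del: index_mult_mat_vec(1))
      qed
    qed
    finally show "(H' *\<^sub>v (A *\<^sub>v w)) $ r = (A *\<^sub>v (H *\<^sub>v w)) $ r"
      using Hc Aw by simp
  qed (use Hc Ac in auto)
  have kH: "k \<cdot>\<^sub>m H \<in> carrier_mat d d" "k \<cdot>\<^sub>m H' \<in> carrier_mat d d" using Hc by auto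
  have kHS: "(k \<cdot>\<^sub>m H) *\<^sub>v w \<in> ?S" if "w \<in> ?S" for w
    using smult_mat_vec[OF Hc(1) vec_subspaceD(1)[OF S that]] HS[OF that] vec_subspaceD(4)[OF S] by simp
  have kH'H: "(k \<cdot>\<^sub>m H') *\<^sub>v (A *\<^sub>v w) = A *\<^sub>v ((k \<cdot>\<^sub>m H) *\<^sub>v w)" if w: "w \<in> ?S" for w
  proof -
    have wc: "w \<in> carrier_vec d" using vec_subspaceD(1)[OF S w] .
    have "A *\<^sub>v w \<in> carrier_vec d" "H *\<^sub>v w \<in> carrier_vec d" using Ac Hc wc by auto
    thus ?thesis
      using smult_mat_vec[OF Hc(1) wc] smult_mat_vec[OF Hc(2)] H'H[OF w] mult_mat_vec[OF Ac] by simp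
  qed
  have "mat_exp (k \<cdot>\<^sub>m H') *\<^sub>v (A *\<^sub>v \<phi>) = A *\<^sub>v (mat_exp (k \<cdot>\<^sub>m H) *\<^sub>v \<phi>)"
    by (rule mat_exp_intertwine[OF kH(2,1) Ac _ kHS kH'H \<phi>S]) (use S in \<open>auto simp: vec_subspace_def\<close>)
  \<comment> \<open>\<open>joint_state_eq\<close> can be used for the evolved vector because it is
    still generated by physical creation operators.\<close>
  moreover have "mat_exp (k \<cdot>\<^sub>m H) *\<^sub>v \<phi> \<in> ?S"
    by (rule mat_exp_invariant_subspace[OF S kH(1) kHS \<phi>S])
  ultimately show ?thesis
    unfolding H_def H'_def A(2) using joint_state_eq[OF A(1)] \<phi>S by metis
qed

end

text \<open>The orientation and the layers are chosen from the graph alone, so the same choice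
  serves the arbitrary representation \<open>f\<close> and the concrete operators \<open>jw\<close>
  in which weights are measured.\<close>

theorem mainTheorem2:
  fixes N \<nu> d :: nat
    and E :: "nat set set"
    and t :: "nat set \<Rightarrow> real"
    and f :: "nat \<Rightarrow> nat \<Rightarrow> complex mat"
    and vac :: "complex vec"
  assumes graph: "simple_graph {1..N} E"
    and chi: "chromatic_index E \<ge> 1"
    and nu: "\<nu> = nat \<lceil>real (chromatic_index E) / 2\<rceil>"
    and fermions: "fermion_modes N \<nu> d f vac"
  shows "\<exists>(D :: (nat \<times> nat) set) (lay :: nat set \<Rightarrow> nat).
    orientation E D \<and> (\<forall>e\<in>E. lay e \<in> {1..\<nu>}) \<and>
    (\<forall>(i, j)\<in>D. mat_adjoint (edge_op f (lay {i, j}) i j) = edge_op f (lay {i, j}) i j \<and>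
       edge_op f (lay {i, j}) i j * edge_op f (lay {i, j}) i j = 1\<^sub>m d) \<and>
    (\<forall>(i, j)\<in>D. \<forall>(i', j')\<in>D.
       edge_op f (lay {i, j}) i j * edge_op f (lay {i', j'}) i' j' =
       edge_op f (lay {i', j'}) i' j' * edge_op f (lay {i, j}) i j) \<and>
    (\<forall>(i, j)\<in>D. let W = hopping (jw N \<nu>) i j * edge_op (jw N \<nu>) (lay {i, j}) i j in
       (\<forall>s\<in>{1..N}. \<forall>k\<in>{0..\<nu>}. \<not> acts_trivially (num_qubits N \<nu>) W (qubit \<nu> s k) \<longrightarrow> s \<in> {i, j}) \<and>
       pauli_weight (num_qubits N \<nu>) W = 2 * (lay {i, j} + 1) \<and>
       2 * (lay {i, j} + 1) \<le> 2 * (\<nu> + 1)) \<and>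
    (\<exists>\<psi>\<in>aux_states N \<nu> d f vac. \<forall>(i, j)\<in>D. edge_op f (lay {i, j}) i j *\<^sub>v \<psi> = \<psi>) \<and>
    (\<forall>\<psi>\<in>aux_states N \<nu> d f vac. (\<forall>(i, j)\<in>D. edge_op f (lay {i, j}) i j *\<^sub>v \<psi> = \<psi>) \<longrightarrow>
       (\<forall>\<phi>\<in>phys_states N d f vac. \<forall>T :: real.
          mat_exp ((- \<i> * complex_of_real T) \<cdot>\<^sub>m transformed_hamiltonian d f D lay t)
            *\<^sub>v joint_state N \<nu> d f vac \<psi> \<phi> =
          joint_state N \<nu> d f vac \<psi>
            (mat_exp ((- \<i> * complex_of_real T) \<cdot>\<^sub>m hamiltonian d f E t) *\<^sub>v \<phi>)))"
proof -
  interpret fock_space N \<nu> d f vac by (rule fock_space_fermion_modes[OF fermions])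
  obtain D lay where D: "orientation E D"
    and lay: "\<And>e. e \<in> E \<Longrightarrow> lay e \<in> {1..nat \<lceil>real (chromatic_index E) / 2\<rceil>}"
    and layered: "\<And>i j i' j'. (i, j) \<in> D \<Longrightarrow> (i', j') \<in> D \<Longrightarrow> lay {i, j} = lay {i', j'} \<Longrightarrow>
      (i, j) \<noteq> (i', j') \<Longrightarrow> i \<noteq> i' \<and> j \<noteq> j'"
    using layered_orientation[OF graph] by metis
  note lay = lay[folded nu]
  have edge: "i \<in> {1..N}" "j \<in> {1..N}" "i \<noteq> j" "lay {i, j} \<in> {1..\<nu>}" if "(i, j) \<in> D" for i j
  proof -
    have "{i, j} \<in> E" using orientationD(1)[OF D that] .
    thus "i \<in> {1..N}" "j \<in> {1..N}" "lay {i, j} \<in> {1..\<nu>}" "i \<noteq> j"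
      using graph lay by (auto simp: simple_graph_def)
  qed
  have modes: "(i, lay {i, j}) \<in> aux_modes" "(j, lay {i, j}) \<in> aux_modes"
    "(i, lay {i, j}) \<in> modes" "(j, lay {i, j}) \<in> modes" if "(i, j) \<in> D" for i j
    using edge[OF that] by (auto simp: modes_def)
  have "finite D"
    by (rule finite_subset[of _ "{1..N} \<times> {1..N}"]) (use edge in auto)
  have hermitian: "mat_adjoint (edge_op f (lay {i, j}) i j) = edge_op f (lay {i, j}) i j \<and>
      edge_op f (lay {i, j}) i j * edge_op f (lay {i, j}) i j = 1\<^sub>m d" if "(i, j) \<in> D" for i j
    using edge_op_adjoint[OF modes(3,4)[OF that] edge(3)[OF that]]
      edge_op_square[OF modes(3,4)[OF that] edge(3)[OF that]] by blast
  have commute: "edge_op f (lay {i, j}) i j * edge_op f (lay {i', j'}) i' j' =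
      edge_op f (lay {i', j'}) i' j' * edge_op f (lay {i, j}) i j"
    if ij: "(i, j) \<in> D" and ij': "(i', j') \<in> D" for i j i' j'
  proof (cases "(i, j) = (i', j')")
    case False
    have "qcommute d 1 (edge_op f (lay {i, j}) i j) (edge_op f (lay {i', j'}) i' j')"
      by (intro qcommute_edge_ops modes[OF ij] modes[OF ij'] edge(3)[OF ij] edge(3)[OF ij'] layered[OF ij ij'] False)
    thus ?thesis by (simp add: qcommute_def)
  qed simp
  have weight: "let W = hopping (jw N \<nu>) i j * edge_op (jw N \<nu>) (lay {i, j}) i j in
      (\<forall>s\<in>{1..N}. \<forall>k\<in>{0..\<nu>}. \<not> acts_trivially (num_qubits N \<nu>) W (qubit \<nu> s k) \<longrightarrow> s \<in> {i, j}) \<and>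
      pauli_weight (num_qubits N \<nu>) W = 2 * (lay {i, j} + 1) \<and>
      2 * (lay {i, j} + 1) \<le> 2 * (\<nu> + 1)" if ij: "(i, j) \<in> D" for i j
  proof -
    have l: "1 \<le> lay {i, j}" "lay {i, j} \<le> \<nu>" using edge(4)[OF ij] by auto
    show ?thesis
      unfolding Let_def
      using acts_trivially_jw_term[OF edge(1-3)[OF ij] l] pauli_weight_jw_term[OF edge(1-3)[OF ij] l] l(2)
      by auto
  qed
  have stabilized: "\<exists>\<psi>\<in>aux_states N \<nu> d f vac. \<forall>(i, j)\<in>D. edge_op f (lay {i, j}) i j *\<^sub>v \<psi> = \<psi>"
  proof -
    have "\<exists>\<psi>\<in>states aux_modes. \<psi> \<noteq> 0\<^sub>v d \<and> (\<forall>(i, j)\<in>D. edge_op f (lay {i, j}) i j *\<^sub>v \<psi> = \<psi>)"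
    proof (rule stabilized_state_exists[OF aux_phys_modes(2) \<open>finite D\<close>])
      show "(i, lay {i, j}) \<in> aux_modes \<and> (j, lay {i, j}) \<in> aux_modes \<and> i \<noteq> j" if "(i, j) \<in> D" for i j
        using modes[OF that] edge[OF that] by blast
    qed (rule layered)
    thus ?thesis by (auto simp: states_def aux_states_def aux_polynomials_def)
  qed
  have evolution: "mat_exp ((- \<i> * complex_of_real T) \<cdot>\<^sub>m transformed_hamiltonian d f D lay t)
        *\<^sub>v joint_state N \<nu> d f vac \<psi> \<phi> =
      joint_state N \<nu> d f vac \<psi> (mat_exp ((- \<i> * complex_of_real T) \<cdot>\<^sub>m hamiltonian d f E t) *\<^sub>v \<phi>)"
    if "\<psi> \<in> aux_states N \<nu> d f vac" and stab: "\<forall>(i, j)\<in>D. edge_op f (lay {i, j}) i j *\<^sub>v \<psi> = \<psi>"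
      and "\<phi> \<in> phys_states N d f vac" for \<psi> \<phi> T
  proof (rule transformed_evolution[OF graph D lay that(1) _ that(3)])
    show "edge_op f (lay {i, j}) i j *\<^sub>v \<psi> = \<psi>" if "(i, j) \<in> D" for i j
      using bspec[OF stab that] by simp
  qed
  show ?thesis
  proof (intro exI[of _ D] exI[of _ lay] conjI)
    show "orientation E D" by (rule D)
    show "\<forall>e\<in>E. lay e \<in> {1..\<nu>}" using lay by blast
  qed (use hermitian commute weight stabilized evolution in \<open>blast+\<close>)
qed

end
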